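(* Let $(R,\mathfrak m)$ be an analytically unramified Cohen-Macaulay local ring of dimension $2$ with infinite residue field, let $I,J$ be $\mathfrak m$-primary ideals of $R$, and let $(a,b)$ be a good joint reduction of $\{\overline{I^rJ^s}\}$. Then for all integers $r,s\ge 0$, $$\lambda\big([H^2_{(at_1,bt_2)}(\overline{\mathcal R'}(I,J))]_{(r,s)}\big)=[\overline e_2(I)+\overline e_2(J)-\overline e_2(IJ)]+g_r(I,J)+h_s(I,J)+rs\,e(I|J)-\lambda(R/\overline{I^rJ^s}).$$
   Context: All rings are commutative; a local ring is Noetherian, and $(R,\mathfrak m)$ is analytically unramified if its $\mathfrak m$-adic completion is reduced. $\overline{K}$ denotes the integral closure of an ideal $K$; $\lambda$ denotes length. Powers $I^r$ with $r\le 0$ are $R$. For an $\mathfrak m$-primary ideal $K$ in an analytically unramified local ring of dimension $2$, there is a polynomial $\overline P_K$ (normal Hilbert polynomial) with $\lambda(R/\overline{K^n})=\overline P_K(n)$ for $n\gg0$; write $\overline P_K(n+1)=\overline e_0(K)\binom{n+2}{2}-\overline e_1(K)\binom{n+1}{1}+\overline e_2(K)$ with integers $\overline e_i(K)$. By Bhattacharya there are integers $e_{(i,j)}(I,J)$ with $\lambda(R/I^rJ^s)=\sum_{i+j\le 2}(-1)^{2-(i+j)}e_{(i,j)}(I,J)\binom{r+i-1}{i}\binom{s+j-1}{j}$ for $r,s\gg0$. Put $e(I|J)=e_{(1,1)}(I,J)$. For each fixed $r\geq 0$, $g_r(I,J)$ is the integer (it exists and is independent of $s$) with $\lambda(\overline{J^s}/\overline{I^rJ^s})=e(I|J)rs+g_r(I,J)$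 for $s\gg0$. For each fixed $s\geq 0$, $h_s(I,J)$ is the integer (it exists and is independent of $r$) with $\lambda(\overline{I^r}/\overline{I^rJ^s})=e(I|J)rs+h_s(I,J)$ for $r\gg0$. A pair $(a,b)$ with $a\in I$, $b\in J$ is a joint reduction of $\{\overline{I^rJ^s}\}$ if $\overline{I^rJ^s}=a\overline{I^{r-1}J^s}+b\overline{I^rJ^{s-1}}$ for $r,s\gg0$. It is a good joint reduction if moreover $(a)\cap\overline{I^rJ^s}=a\overline{I^{r-1}J^s}$ for all $r>0$, $s\in\mathbb Z$, and $(b)\cap\overline{I^rJ^s}=b\overline{I^rJ^{s-1}}$ for all $s>0$, $r\in\mathbb Z$. $\overline{\mathcal R'}(I,J)=\bigoplus_{r,s\in\mathbb Z}\overline{I^rJ^s}\,t_1^rt_2^s$ is the extended Rees ring of the filtration; it is $\mathbb Z^2$-graded, and its local cohomology modules carry the induced $\mathbb Z^2$-grading. *)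

theory Defs
  imports "HOL-Algebra.Algebra" "HOL-Library.Extended_Nat" "HOL-Library.Product_Plus"
begin

section \<open>Local rings\<close>

locale local_ring = noetherian_ring R + cring R for R (structure) +
  fixes \<mm>
  assumes maximal: "maximalideal \<mm> R"
    and unique_maximal: "maximalideal M R \<Longrightarrow> M = \<mm>"

definition krull_dim :: "('a, 'b) ring_scheme \<Rightarrow> enat" where
  "krull_dim R = (SUP n \<in> {n. \<exists>P. (\<forall>i\<le>n. primeideal (P i) R) \<and> (\<forall>i<n. P i \<subset> P (Suc i))}. enat n)"

definition regular_sequence :: "('a, 'b) ring_scheme \<Rightarrow> 'a list \<Rightarrow> bool" where
  "regular_sequence R xs \<longleftrightarrow>
     set xs \<subseteq> carrier R \<and> Idl\<^bsub>R\<^esub> (set xs) \<noteq> carrier R \<and>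
     (\<forall>i<length xs. \<forall>y\<in>carrier R.
        xs ! i \<otimes>\<^bsub>R\<^esub> y \<in> Idl\<^bsub>R\<^esub> (set (take i xs)) \<longrightarrow> y \<in> Idl\<^bsub>R\<^esub> (set (take i xs)))"

definition depth :: "('a, 'b) ring_scheme \<Rightarrow> 'a set \<Rightarrow> enat" where
  "depth R \<mm> = (SUP xs \<in> {xs. regular_sequence R xs \<and> set xs \<subseteq> \<mm>}. enat (length xs))"

definition cohen_macaulay :: "('a, 'b) ring_scheme \<Rightarrow> 'a set \<Rightarrow> bool" where
  "cohen_macaulay R \<mm> \<longleftrightarrow> depth R \<mm> = krull_dim R"

definition radical :: "('a, 'b) ring_scheme \<Rightarrow> 'a set \<Rightarrow> 'a set" where
  "radical R K = {x \<in> carrier R. \<exists>n::nat. x [^]\<^bsub>R\<^esub> n \<in> K}"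

definition primary_ideal :: "('a, 'b) ring_scheme \<Rightarrow> 'a set \<Rightarrow> bool" where
  "primary_ideal R Q \<longleftrightarrow> ideal Q R \<and> Q \<noteq> carrier R \<and>
     (\<forall>x\<in>carrier R. \<forall>y\<in>carrier R. x \<otimes>\<^bsub>R\<^esub> y \<in> Q \<longrightarrow> x \<in> Q \<or> y \<in> radical R Q)"

definition primary_to :: "('a, 'b) ring_scheme \<Rightarrow> 'a set \<Rightarrow> 'a set \<Rightarrow> bool" where
  "primary_to R \<mm> Q \<longleftrightarrow> primary_ideal R Q \<and> radical R Q = \<mm>"

text \<open>Ideal powers with integer exponent; exponents \<open>r \<le> 0\<close> give the unit ideal.\<close>

definition ideal_pow :: "('a, 'b) ring_scheme \<Rightarrow> 'a set \<Rightarrow> int \<Rightarrow> 'a set" where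
  "ideal_pow R I r = I [^]\<^bsub>ideals_set R\<^esub> nat r"

text \<open>The \<open>\<mm>\<close>-adic completion is the inverse limit of the rings \<open>R/\<mm>\<^sup>n\<close>. The transition map
  sends a coset of \<open>\<mm>\<^sup>n\<^sup>+\<^sup>1\<close> to the coset of \<open>\<mm>\<^sup>n\<close> containing it, so compatibility of a family of
  cosets is inclusion.\<close>

definition completion :: "('a, 'b) ring_scheme \<Rightarrow> 'a set \<Rightarrow> (nat \<Rightarrow> 'a set) ring" where
  "completion R \<mm> =
     (let Q = (\<lambda>n. R Quot ideal_pow R \<mm> (int n)) in
      \<lparr>carrier = {f. (\<forall>n. f n \<in> carrier (Q n)) \<and> (\<forall>n. f (Suc n) \<subseteq> f n)},
       monoid.mult = (\<lambda>f g n. f n \<otimes>\<^bsub>Q n\<^esub> g n), one = (\<lambda>n. \<one>\<^bsub>Q n\<^esub>),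
       ring.zero = (\<lambda>n. \<zero>\<^bsub>Q n\<^esub>), add = (\<lambda>f g n. f n \<oplus>\<^bsub>Q n\<^esub> g n)\<rparr>)"

definition reduced_ring :: "('a, 'b) ring_scheme \<Rightarrow> bool" where
  "reduced_ring A \<longleftrightarrow> (\<forall>x\<in>carrier A. \<forall>n::nat. x [^]\<^bsub>A\<^esub> n = \<zero>\<^bsub>A\<^esub> \<longrightarrow> x = \<zero>\<^bsub>A\<^esub>)"

definition analytically_unramified :: "('a, 'b) ring_scheme \<Rightarrow> 'a set \<Rightarrow> bool" where
  "analytically_unramified R \<mm> \<longleftrightarrow> reduced_ring (completion R \<mm>)"

definition integral_closure :: "('a, 'b) ring_scheme \<Rightarrow> 'a set \<Rightarrow> 'a set" where
  "integral_closure R K = {x \<in> carrier R. \<exists>n\<ge>1. \<exists>c.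
     (\<forall>i\<in>{1..n}. c i \<in> ideal_pow R K (int i)) \<and>
     x [^]\<^bsub>R\<^esub> n \<oplus>\<^bsub>R\<^esub> (\<Oplus>\<^bsub>R\<^esub>i\<in>{1..n}. c i \<otimes>\<^bsub>R\<^esub> x [^]\<^bsub>R\<^esub> (n - i)) = \<zero>\<^bsub>R\<^esub>}"


section \<open>Modules and length\<close>

text \<open>A module record extends a ring record; the fields \<open>mult\<close> and \<open>one\<close> play no role for a
  module and are left undefined where there is no natural choice.\<close>

definition module_length :: "('r, 'b) ring_scheme \<Rightarrow> ('r, 'm) module \<Rightarrow> enat" where
  "module_length R M = (SUP n \<in> {n. \<exists>N. (\<forall>i\<le>n. submodule (N i) R M) \<and>
     (\<forall>i<n. N i \<subset> N (Suc i))}. enat n)"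

text \<open>Only meaningful for modules of finite length.\<close>

definition len :: "('r, 'b) ring_scheme \<Rightarrow> ('r, 'm) module \<Rightarrow> int" where
  "len R M = int (the_enat (module_length R M))"

definition quot_module :: "('r, 'm) module \<Rightarrow> 'm set \<Rightarrow> ('r, 'm set) module" where
  "quot_module M N =
     \<lparr>carrier = a_rcosets\<^bsub>M\<^esub> N, monoid.mult = undefined, one = undefined, ring.zero = N,
      add = set_add M,
      smult = (\<lambda>r U. \<Union>x\<in>U. N +>\<^bsub>M\<^esub> (r \<odot>\<^bsub>M\<^esub> x))\<rparr>"

definition ideal_module :: "('a, 'b) ring_scheme \<Rightarrow> 'a set \<Rightarrow> ('a, 'a) module" where
  "ideal_module R N =
     \<lparr>carrier = N, monoid.mult = monoid.mult R, one = one R, ring.zero = ring.zero R, add = add R,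
      smult = monoid.mult R\<rparr>"

abbreviation subquot :: "('a, 'b) ring_scheme \<Rightarrow> 'a set \<Rightarrow> 'a set \<Rightarrow> ('a, 'a set) module" where
  "subquot R N K \<equiv> quot_module (ideal_module R N) K"

definition restrict_scalars :: "('s \<Rightarrow> 'r) \<Rightarrow> ('r, 'm) module \<Rightarrow> ('s, 'm) module" where
  "restrict_scalars \<phi> M =
     \<lparr>carrier = carrier M, monoid.mult = monoid.mult M, one = one M, ring.zero = ring.zero M, add = add M,
      smult = (\<lambda>r. smult M (\<phi> r))\<rparr>"


section \<open>The filtration of integral closures and its numerical invariants\<close>

definition nfilt :: "('a, 'b) ring_scheme \<Rightarrow> 'a set \<Rightarrow> 'a set \<Rightarrow> int \<Rightarrow> int \<Rightarrow> 'a set" where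
  "nfilt R I J r s = integral_closure R (ideal_pow R I r \<cdot>\<^bsub>R\<^esub> ideal_pow R J s)"

text \<open>Each of the following predicates determines the integers it speaks about uniquely: a
  polynomial is determined by its values at large arguments, and \<open>g\<close>, \<open>h\<close> are given by the
  lengths once \<open>e(I|J)\<close> is known.\<close>

definition normal_hilbert_coeffs ::
    "('a, 'b) ring_scheme \<Rightarrow> 'a set \<Rightarrow> (nat \<Rightarrow> int) \<Rightarrow> bool" where
  "normal_hilbert_coeffs R K e \<longleftrightarrow> (\<exists>N. \<forall>n\<ge>N.
     len R (subquot R (carrier R) (integral_closure R (ideal_pow R K (int (n + 1))))) =
       e 0 * int ((n + 2) choose 2) - e 1 * int ((n + 1) choose 1) + e 2)"

definition bhattacharya_coeffs ::
    "('a, 'b) ring_scheme \<Rightarrow> 'a set \<Rightarrow> 'a set \<Rightarrow> (nat \<Rightarrow> nat \<Rightarrow> int) \<Rightarrow> bool" where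
  "bhattacharya_coeffs R I J e \<longleftrightarrow> (\<exists>N. \<forall>r\<ge>N. \<forall>s\<ge>N.
     len R (subquot R (carrier R) (ideal_pow R I (int r) \<cdot>\<^bsub>R\<^esub> ideal_pow R J (int s))) =
       (\<Sum>(i, j)\<in>{(i, j). i + j \<le> 2}. (-1) ^ (2 - (i + j)) * e i j *
          int ((r + i - 1) choose i) * int ((s + j - 1) choose j)))"

definition is_g ::
    "('a, 'b) ring_scheme \<Rightarrow> 'a set \<Rightarrow> 'a set \<Rightarrow> int \<Rightarrow> (nat \<Rightarrow> int) \<Rightarrow> bool" where
  "is_g R I J eIJ g \<longleftrightarrow> (\<forall>r. \<exists>N. \<forall>s\<ge>N.
     len R (subquot R (integral_closure R (ideal_pow R J (int s))) (nfilt R I J (int r) (int s))) =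
       eIJ * int r * int s + g r)"

definition is_h ::
    "('a, 'b) ring_scheme \<Rightarrow> 'a set \<Rightarrow> 'a set \<Rightarrow> int \<Rightarrow> (nat \<Rightarrow> int) \<Rightarrow> bool" where
  "is_h R I J eIJ h \<longleftrightarrow> (\<forall>s. \<exists>N. \<forall>r\<ge>N.
     len R (subquot R (integral_closure R (ideal_pow R I (int r))) (nfilt R I J (int r) (int s))) =
       eIJ * int r * int s + h s)"

definition joint_reduction ::
    "('a, 'b) ring_scheme \<Rightarrow> 'a set \<Rightarrow> 'a set \<Rightarrow> 'a \<Rightarrow> 'a \<Rightarrow> bool" where
  "joint_reduction R I J a b \<longleftrightarrow> a \<in> I \<and> b \<in> J \<and>
     (\<exists>N. \<forall>r\<ge>N. \<forall>s\<ge>N. nfilt R I J r s =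
        (a <#\<^bsub>R\<^esub> nfilt R I J (r - 1) s) <+>\<^bsub>R\<^esub> (b <#\<^bsub>R\<^esub> nfilt R I J r (s - 1)))"

definition good_joint_reduction ::
    "('a, 'b) ring_scheme \<Rightarrow> 'a set \<Rightarrow> 'a set \<Rightarrow> 'a \<Rightarrow> 'a \<Rightarrow> bool" where
  "good_joint_reduction R I J a b \<longleftrightarrow> joint_reduction R I J a b \<and>
     (\<forall>r s. r > 0 \<longrightarrow> PIdl\<^bsub>R\<^esub> a \<inter> nfilt R I J r s = a <#\<^bsub>R\<^esub> nfilt R I J (r - 1) s) \<and>
     (\<forall>r s. s > 0 \<longrightarrow> PIdl\<^bsub>R\<^esub> b \<inter> nfilt R I J r s = b <#\<^bsub>R\<^esub> nfilt R I J r (s - 1))"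


section \<open>The extended Rees ring\<close>

text \<open>An element \<open>\<Sum> f\<^sub>(\<^sub>r\<^sub>,\<^sub>s\<^sub>) t\<^sub>1\<^sup>r t\<^sub>2\<^sup>s\<close> is represented by its finitely supported coefficient
  function \<open>f\<close> on \<open>\<int>\<^sup>2\<close>.\<close>

definition laurent_monom :: "('a, 'b) ring_scheme \<Rightarrow> 'a \<Rightarrow> int \<times> int \<Rightarrow> int \<times> int \<Rightarrow> 'a" where
  "laurent_monom R c d = (\<lambda>p. if p = d then c else \<zero>\<^bsub>R\<^esub>)"

definition ext_rees :: "('a, 'b) ring_scheme \<Rightarrow> (int \<Rightarrow> int \<Rightarrow> 'a set) \<Rightarrow> (int \<times> int \<Rightarrow> 'a) ring" where
  "ext_rees R F =
     \<lparr>carrier = {f. finite {p. f p \<noteq> \<zero>\<^bsub>R\<^esub>} \<and> (\<forall>r s. f (r, s) \<in> F r s)},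
      monoid.mult = (\<lambda>f g p. \<Oplus>\<^bsub>R\<^esub>q\<in>{q. f q \<noteq> \<zero>\<^bsub>R\<^esub>}. f q \<otimes>\<^bsub>R\<^esub> g (p - q)),
      one = laurent_monom R \<one>\<^bsub>R\<^esub> (0, 0),
      ring.zero = (\<lambda>p. \<zero>\<^bsub>R\<^esub>),
      add = (\<lambda>f g p. f p \<oplus>\<^bsub>R\<^esub> g p)\<rparr>"

definition ext_rees_comp ::
    "('a, 'b) ring_scheme \<Rightarrow> (int \<Rightarrow> int \<Rightarrow> 'a set) \<Rightarrow> int \<times> int \<Rightarrow> (int \<times> int \<Rightarrow> 'a) set" where
  "ext_rees_comp R F d = {f \<in> carrier (ext_rees R F). \<forall>p. p \<noteq> d \<longrightarrow> f p = \<zero>\<^bsub>R\<^esub>}"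


section \<open>Localization and local cohomology\<close>

text \<open>The fraction \<open>a/s\<close> in \<open>S\<^sup>-\<^sup>1A\<close>, as an equivalence class of pairs.\<close>

definition frac :: "('a, 'b) ring_scheme \<Rightarrow> 'a set \<Rightarrow> 'a \<Rightarrow> 'a \<Rightarrow> ('a \<times> 'a) set" where
  "frac A S a s = {(b, t). b \<in> carrier A \<and> t \<in> S \<and>
     (\<exists>u\<in>S. u \<otimes>\<^bsub>A\<^esub> (t \<otimes>\<^bsub>A\<^esub> a \<ominus>\<^bsub>A\<^esub> s \<otimes>\<^bsub>A\<^esub> b) = \<zero>\<^bsub>A\<^esub>)}"

definition localization :: "('a, 'b) ring_scheme \<Rightarrow> 'a set \<Rightarrow> ('a, ('a \<times> 'a) set) module" where
  "localization A S =
     \<lparr>carrier = {frac A S a s | a s. a \<in> carrier A \<and> s \<in> S},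
      monoid.mult = (\<lambda>U V. \<Union>(a, s)\<in>U. \<Union>(b, t)\<in>V. frac A S (a \<otimes>\<^bsub>A\<^esub> b) (s \<otimes>\<^bsub>A\<^esub> t)),
      one = frac A S \<one>\<^bsub>A\<^esub> \<one>\<^bsub>A\<^esub>,
      ring.zero = frac A S \<zero>\<^bsub>A\<^esub> \<one>\<^bsub>A\<^esub>,
      add = (\<lambda>U V. \<Union>(a, s)\<in>U. \<Union>(b, t)\<in>V.
               frac A S (t \<otimes>\<^bsub>A\<^esub> a \<oplus>\<^bsub>A\<^esub> s \<otimes>\<^bsub>A\<^esub> b) (s \<otimes>\<^bsub>A\<^esub> t)),
      smult = (\<lambda>c U. \<Union>(a, s)\<in>U. frac A S (c \<otimes>\<^bsub>A\<^esub> a) s)\<rparr>"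

text \<open>The canonical map \<open>S\<^sup>-\<^sup>1A \<rightarrow> S'\<^sup>-\<^sup>1A\<close>, \<open>a/s \<mapsto> a/s\<close>, for \<open>S \<subseteq> S'\<close>; it depends only on \<open>S'\<close>.\<close>

definition loc_map :: "('a, 'b) ring_scheme \<Rightarrow> 'a set \<Rightarrow> ('a \<times> 'a) set \<Rightarrow> ('a \<times> 'a) set" where
  "loc_map A S' U = (\<Union>(a, s)\<in>U. frac A S' a s)"

text \<open>Local cohomology \<open>H\<^sup>p\<^sub>(\<^sub>x\<^sub>0\<^sub>,\<^sub>\<dots>\<^sub>,\<^sub>x\<^sub>n\<^sub>-\<^sub>1\<^sub>)(A)\<close> is the cohomology of the Cech complex with terms
  \<open>\<Oplus> A\<^bsub>x_T\<^esub>\<close>, where \<open>T\<close> runs over the \<open>p\<close>-element subsets of \<open>{0..<n}\<close> and \<open>x_T\<close> is the product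
  of the \<open>x\<^sub>j\<close>, \<open>j \<in> T\<close>. Inverting \<open>x_T\<close> is the same as inverting all monomials in the \<open>x\<^sub>j\<close>,
  \<open>j \<in> T\<close>; with the latter, the multiplicative sets grow with \<open>T\<close>.\<close>

definition monomials :: "('a, 'b) ring_scheme \<Rightarrow> 'a list \<Rightarrow> nat set \<Rightarrow> 'a set" where
  "monomials A xs T = {\<Otimes>\<^bsub>A\<^esub>j\<in>T. (xs ! j) [^]\<^bsub>A\<^esub> (k j) | k :: nat \<Rightarrow> nat. True}"

definition cech_index :: "'a list \<Rightarrow> nat \<Rightarrow> nat set set" where
  "cech_index xs p = {T. T \<subseteq> {0..<length xs} \<and> card T = p}"

abbreviation cech_loc ::
    "('a, 'b) ring_scheme \<Rightarrow> 'a list \<Rightarrow> nat set \<Rightarrow> ('a, ('a \<times> 'a) set) module" where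
  "cech_loc A xs T \<equiv> localization A (monomials A xs T)"

definition cech_cochains ::
    "('a, 'b) ring_scheme \<Rightarrow> 'a list \<Rightarrow> nat \<Rightarrow> ('a, nat set \<Rightarrow> ('a \<times> 'a) set) module" where
  "cech_cochains A xs p =
     \<lparr>carrier = (\<Pi>\<^sub>E T\<in>cech_index xs p. carrier (cech_loc A xs T)),
      monoid.mult = undefined, one = undefined,
      ring.zero = (\<lambda>T\<in>cech_index xs p. \<zero>\<^bsub>cech_loc A xs T\<^esub>),
      add = (\<lambda>\<alpha> \<beta>. \<lambda>T\<in>cech_index xs p. \<alpha> T \<oplus>\<^bsub>cech_loc A xs T\<^esub> \<beta> T),
      smult = (\<lambda>c \<alpha>. \<lambda>T\<in>cech_index xs p. c \<odot>\<^bsub>cech_loc A xs T\<^esub> \<alpha> T)\<rparr>"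

definition cech_d :: "('a, 'b) ring_scheme \<Rightarrow> 'a list \<Rightarrow> nat \<Rightarrow>
    (nat set \<Rightarrow> ('a \<times> 'a) set) \<Rightarrow> nat set \<Rightarrow> ('a \<times> 'a) set" where
  "cech_d A xs p \<alpha> = (\<lambda>T\<in>cech_index xs (Suc p).
     \<Oplus>\<^bsub>cech_loc A xs T\<^esub>j\<in>T.
       (let y = loc_map A (monomials A xs T) (\<alpha> (T - {j})) in
        if even (card {i \<in> T. i < j}) then y else \<ominus>\<^bsub>cech_loc A xs T\<^esub> y))"

definition cech_cocycles ::
    "('a, 'b) ring_scheme \<Rightarrow> 'a list \<Rightarrow> nat \<Rightarrow> (nat set \<Rightarrow> ('a \<times> 'a) set) set" where
  "cech_cocycles A xs p =
     {\<alpha> \<in> carrier (cech_cochains A xs p). cech_d A xs p \<alpha> = \<zero>\<^bsub>cech_cochains A xs (Suc p)\<^esub>}"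

definition cech_coboundaries ::
    "('a, 'b) ring_scheme \<Rightarrow> 'a list \<Rightarrow> nat \<Rightarrow> (nat set \<Rightarrow> ('a \<times> 'a) set) set" where
  "cech_coboundaries A xs p = (case p of
      0 \<Rightarrow> {\<zero>\<^bsub>cech_cochains A xs 0\<^esub>}
    | Suc q \<Rightarrow> cech_d A xs q ` carrier (cech_cochains A xs q))"

definition local_cohomology :: "('a, 'b) ring_scheme \<Rightarrow> 'a list \<Rightarrow> nat \<Rightarrow>
    ('a, (nat set \<Rightarrow> ('a \<times> 'a) set) set) module" where
  "local_cohomology A xs p =
     quot_module ((cech_cochains A xs p)\<lparr>carrier := cech_cocycles A xs p\<rparr>)
       (cech_coboundaries A xs p)"

text \<open>Let \<open>A\<close> be graded with components \<open>G d\<close>, and let the \<open>x\<^sub>j\<close> be homogeneous. A fraction \<open>a/s\<close>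
  with \<open>s\<close> homogeneous of degree \<open>e\<close> and \<open>a\<close> of degree \<open>d + e\<close> has degree \<open>d\<close>. The Cech
  complex is then a complex of graded modules, and the component of degree \<open>d\<close> of its cohomology
  consists of the classes of cocycles of degree \<open>d\<close>.\<close>

definition frac_comp ::
    "('a, 'b) ring_scheme \<Rightarrow> ('d::plus \<Rightarrow> 'a set) \<Rightarrow> 'a set \<Rightarrow> 'd \<Rightarrow> ('a \<times> 'a) set set" where
  "frac_comp A G S d = {frac A S a s | a s e. s \<in> S \<and> s \<in> G e \<and> a \<in> G (d + e)}"

definition local_cohomology_comp :: "('a, 'b) ring_scheme \<Rightarrow> ('d::plus \<Rightarrow> 'a set) \<Rightarrow> 'a list \<Rightarrow>
    nat \<Rightarrow> 'd \<Rightarrow> ('a, (nat set \<Rightarrow> ('a \<times> 'a) set) set) module" where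
  "local_cohomology_comp A G xs p d =
     (local_cohomology A xs p)\<lparr>carrier :=
        {cech_coboundaries A xs p +>\<^bsub>cech_cochains A xs p\<^esub> \<alpha> | \<alpha>. \<alpha> \<in> cech_cocycles A xs p \<and>
           (\<forall>T\<in>cech_index xs p. \<alpha> T \<in> frac_comp A G (monomials A xs T) d)}\<rparr>"

text \<open>\<open>[H\<^sup>p\<^sub>(\<^sub>a\<^sub>t\<^sub>1\<^sub>,\<^sub>b\<^sub>t\<^sub>2\<^sub>)]\<^sub>d\<close> of the extended Rees ring of the filtration of integral closures of
  \<open>I\<^sup>rJ\<^sup>s\<close>, as a module over \<open>R\<close>, the component of degree \<open>(0, 0)\<close> of the extended Rees ring. It
  is not a module over the whole Rees ring.\<close>

definition rees_local_cohomology_comp where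
  "rees_local_cohomology_comp R I J a b p d =
     restrict_scalars (\<lambda>c. laurent_monom R c (0, 0))
       (local_cohomology_comp (ext_rees R (nfilt R I J)) (ext_rees_comp R (nfilt R I J))
          [laurent_monom R a (1, 0), laurent_monom R b (0, 1)] p d)"

end

theory Submission
  imports Defs
begin

text \<open>Write \<open>F r s\<close> for the integral closure of \<open>I\<^sup>rJ\<^sup>s\<close>. Since \<open>a\<close> and \<open>b\<close> are nonzerodivisors, every
  fraction of degree \<open>(r, s)\<close> is \<open>f / (at\<^sub>1)\<^sup>k(bt\<^sub>2)\<^sup>k\<close> with \<open>f \<in> F (r+k) (s+k)\<close>, and the component of the
  local cohomology is the direct limit over \<open>k\<close> of the quotients of \<open>F (r+k) (s+k)\<close> by
  \<open>a\<^sup>k F r (s+k) + b\<^sup>k F (r+k) s\<close>. A good joint reduction makes the transition maps, which multiply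
  by \<open>ab\<close>, injective. As \<open>(a, b)\<close> is \<open>\<mm>\<close>-primary and the depth is 2, all syzygies of \<open>(a\<^sup>k, b\<^sup>k)\<close> are
  trivial, and with \<open>L r s = \<lambda>(R / F r s)\<close> the \<open>k\<close>-th quotient has length
  \<open>k\<^sup>2 \<lambda>(R/(a, b)) + L r (s+k) + L (r+k) s - L r s - L (r+k) (s+k)\<close>.
  For \<open>k = 1\<close> and large \<open>r, s\<close> the quotient vanishes, because \<open>(a, b)\<close> is a joint reduction. So the
  mixed second difference of \<open>L\<close> is eventually the constant \<open>\<lambda>(R/(a, b))\<close>, and \<open>L\<close> is determined up
  to functions of one variable. Comparison with \<open>g\<close>, \<open>h\<close> and the normal Hilbert polynomials then gives
  the length for all large \<open>k\<close>; it does not depend on \<open>k\<close>, so the limit is attained.\<close>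

section \<open>Lengths of intervals of ideals\<close>

definition chain_len :: "'a set set \<Rightarrow> enat" where
  "chain_len \<F> = (SUP n \<in> {n. \<exists>H. (\<forall>i\<le>n. H i \<in> \<F>) \<and> (\<forall>i<n. H i \<subset> H (Suc i))}. enat n)"

lemma le_chain_len_iff:
  assumes "\<F> \<noteq> {}"
  shows "enat k \<le> chain_len \<F> \<longleftrightarrow> (\<exists>H. (\<forall>i\<le>k. H i \<in> \<F>) \<and> (\<forall>i<k. H i \<subset> H (Suc i)))"
    (is "_ \<longleftrightarrow> ?C k")
proof
  assume k: "enat k \<le> chain_len \<F>"
  show "?C k"
  proof (rule ccontr)
    assume no: "\<not> ?C k"
    have lt: "n < k" if "?C n" for n
    proof (rule ccontr)
      assume "\<not> n < k"
      then have le: "k \<le> n" by simp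
      obtain H where "\<forall>i\<le>n. H i \<in> \<F>" "\<forall>i<n. H i \<subset> H (Suc i)" using \<open>?C n\<close> by blast
      then have "?C k" using le by (intro exI[of _ H]) auto
      with no show False by blast
    qed
    have "?C 0" using assms by auto
    then have "0 < k" using lt by blast
    have "chain_len \<F> \<le> enat (k - 1)"
      unfolding chain_len_def
    proof (rule SUP_least)
      fix n assume "n \<in> {n. ?C n}"
      then have "n < k" using lt by simp
      then show "enat n \<le> enat (k - 1)" by simp
    qed
    with k have "enat k \<le> enat (k - 1)" by (rule order_trans)
    with \<open>0 < k\<close> show False by simp
  qed
next
  assume "?C k"
  then show "enat k \<le> chain_len \<F>"
    unfolding chain_len_def by (intro SUP_upper) blast
qed

lemma chain_len_mono:
  assumes "\<And>U. U \<in> \<F> \<Longrightarrow> f U \<in> \<G>"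
    and "\<And>U V. U \<in> \<F> \<Longrightarrow> V \<in> \<F> \<Longrightarrow> U \<subset> V \<Longrightarrow> f U \<subset> f V"
  shows "chain_len \<F> \<le> chain_len \<G>"
  unfolding chain_len_def
proof (rule SUP_mono)
  fix n assume "n \<in> {n. \<exists>H. (\<forall>i\<le>n. H i \<in> \<F>) \<and> (\<forall>i<n. H i \<subset> H (Suc i))}"
  then obtain H where H: "\<forall>i\<le>n. H i \<in> \<F>" "\<forall>i<n. H i \<subset> H (Suc i)" by blast
  have "(\<forall>i\<le>n. f (H i) \<in> \<G>) \<and> (\<forall>i<n. f (H i) \<subset> f (H (Suc i)))"
    using H assms by simp
  then show "\<exists>m\<in>{n. \<exists>H. (\<forall>i\<le>n. H i \<in> \<G>) \<and> (\<forall>i<n. H i \<subset> H (Suc i))}. enat n \<le> enat m"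
    by (intro bexI[of _ n]) (auto intro!: exI[of _ "\<lambda>i. f (H i)"])
qed

lemma card_jumps_le_chain_len:
  assumes "\<And>i. i \<le> n \<Longrightarrow> G i \<in> \<F>" and "\<And>i. i < n \<Longrightarrow> G i \<subseteq> G (Suc i)"
  shows "enat (card {i. i < n \<and> G i \<noteq> G (Suc i)}) \<le> chain_len \<F>"
proof -
  have "\<exists>H. (\<forall>i\<le>card {i. i < n \<and> G i \<noteq> G (Suc i)}. H i \<in> \<F>) \<and>
      (\<forall>i<card {i. i < n \<and> G i \<noteq> G (Suc i)}. H i \<subset> H (Suc i)) \<and>
      H (card {i. i < n \<and> G i \<noteq> G (Suc i)}) = G n"
    using assms
  proof (induction n)
    case 0
    then show ?case by (intro exI[of _ "\<lambda>i. G 0"]) simp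
  next
    case (Suc n)
    define m where "m = card {i. i < n \<and> G i \<noteq> G (Suc i)}"
    obtain H where H: "\<forall>i\<le>m. H i \<in> \<F>" "\<forall>i<m. H i \<subset> H (Suc i)" "H m = G n"
      using Suc.IH Suc.prems unfolding m_def by auto
    show ?case
    proof (cases "G n = G (Suc n)")
      case True
      then have "{i. i < Suc n \<and> G i \<noteq> G (Suc i)} = {i. i < n \<and> G i \<noteq> G (Suc i)}"
        by (auto simp: less_Suc_eq)
      then show ?thesis using H True by (auto simp: m_def)
    next
      case False
      then have "{i. i < Suc n \<and> G i \<noteq> G (Suc i)} = insert n {i. i < n \<and> G i \<noteq> G (Suc i)}"
        by (auto simp: less_Suc_eq)
      then have c: "card {i. i < Suc n \<and> G i \<noteq> G (Suc i)} = Suc m" by (simp add: m_def)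
      have "G n \<subset> G (Suc n)" using False Suc.prems(2)[of n] by auto
      then show ?thesis
        unfolding c using H Suc.prems(1)[of "Suc n"]
        by (intro exI[of _ "H(Suc m := G (Suc n))"]) (auto simp: less_Suc_eq le_Suc_eq)
    qed
  qed
  then show ?thesis
    unfolding chain_len_def by (intro SUP_upper) blast
qed

definition ideal_length :: "('a, 'b) ring_scheme \<Rightarrow> 'a set \<Rightarrow> 'a set \<Rightarrow> enat" where
  "ideal_length R K N = chain_len {H. ideal H R \<and> K \<subseteq> H \<and> H \<subseteq> N}"

context ring
begin

lemma subset_set_add:
  assumes "ideal H R" "ideal N R"
  shows "H \<subseteq> H <+>\<^bsub>R\<^esub> N" "N \<subseteq> H <+>\<^bsub>R\<^esub> N"
proof -
  interpret H: ideal H R by fact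
  interpret N: ideal N R by fact
  show "H \<subseteq> H <+>\<^bsub>R\<^esub> N"
  proof
    fix x assume "x \<in> H"
    then have "x = x \<oplus> \<zero>" "\<zero> \<in> N" by (simp_all add: H.Icarr)
    then show "x \<in> H <+>\<^bsub>R\<^esub> N" using \<open>x \<in> H\<close> unfolding set_add_def' by blast
  qed
  show "N \<subseteq> H <+>\<^bsub>R\<^esub> N"
  proof
    fix x assume "x \<in> N"
    then have "x = \<zero> \<oplus> x" "\<zero> \<in> H" by (simp_all add: N.Icarr)
    then show "x \<in> H <+>\<^bsub>R\<^esub> N" using \<open>x \<in> N\<close> unfolding set_add_def' by blast
  qed
qed

lemma set_add_least:
  assumes "ideal P R" "H \<subseteq> P" "N \<subseteq> P"
  shows "H <+>\<^bsub>R\<^esub> N \<subseteq> P"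
  using assms additive_subgroup.a_closed[OF ideal.axioms(1)[OF assms(1)]]
  unfolding set_add_def' by blast

lemma modular_cancel:
  assumes "ideal H R" "ideal H' R" "ideal N R" "H \<subseteq> H'"
    and "H \<inter> N = H' \<inter> N" "H <+>\<^bsub>R\<^esub> N = H' <+>\<^bsub>R\<^esub> N"
  shows "H = H'"
proof
  interpret H: ideal H R by fact
  interpret H': ideal H' R by fact
  interpret N: ideal N R by fact
  show "H' \<subseteq> H"
  proof
    fix x assume x: "x \<in> H'"
    then have "x \<in> H <+>\<^bsub>R\<^esub> N" using subset_set_add(1)[OF assms(2,3)] assms(6) by blast
    then obtain h n where hn: "h \<in> H" "n \<in> N" "x = h \<oplus> n" unfolding set_add_def' by blast
    have c: "x \<in> carrier R" "h \<in> carrier R" "n \<in> carrier R"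
      using x hn H'.Icarr H.Icarr N.Icarr by auto
    have "n = x \<ominus> h" using c hn(3) by algebra
    then have "n \<in> H'" using x hn(1) assms(4) by (auto simp: a_minus_def)
    then have "n \<in> H" using hn assms(5) by blast
    then show "x \<in> H" using hn by simp
  qed
qed fact

lemma ideal_length_add:
  assumes K: "ideal K R" and N: "ideal N R" and P: "ideal P R" and "K \<subseteq> N" "N \<subseteq> P"
  shows "ideal_length R K P = ideal_length R K N + ideal_length R N P"
proof (rule antisym)
  define F where "F K N = {H. ideal H R \<and> K \<subseteq> H \<and> H \<subseteq> N}" for K N
  have length: "ideal_length R K N = chain_len (F K N)" for K N
    by (simp add: ideal_length_def F_def)
  have F: "H \<in> F K N \<longleftrightarrow> ideal H R \<and> K \<subseteq> H \<and> H \<subseteq> N" for H K N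
    by (simp add: F_def)
  show "ideal_length R K P \<le> ideal_length R K N + ideal_length R N P"
    unfolding length chain_len_def[of "F K P"]
  proof (rule SUP_least)
    fix n assume "n \<in> {n. \<exists>H. (\<forall>i\<le>n. H i \<in> F K P) \<and> (\<forall>i<n. H i \<subset> H (Suc i))}"
    then obtain H where H: "\<forall>i\<le>n. H i \<in> F K P" "\<forall>i<n. H i \<subset> H (Suc i)" by auto
    let ?A = "{i. i < n \<and> H i \<inter> N \<noteq> H (Suc i) \<inter> N}"
    let ?B = "{i. i < n \<and> H i <+>\<^bsub>R\<^esub> N \<noteq> H (Suc i) <+>\<^bsub>R\<^esub> N}"
    have "{..<n} \<subseteq> ?A \<union> ?B"
    proof
      fix i assume "i \<in> {..<n}"
      then have i: "i < n" by simp
      have "H i \<noteq> H (Suc i)" "H i \<subseteq> H (Suc i)" "ideal (H i) R" "ideal (H (Suc i)) R"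
        using H i F by auto
      then show "i \<in> ?A \<union> ?B" using modular_cancel[of "H i" "H (Suc i)" N] N i by auto
    qed
    then have "n \<le> card (?A \<union> ?B)" using card_mono[of "?A \<union> ?B" "{..<n}"] by simp
    also have "\<dots> \<le> card ?A + card ?B" by (rule card_Un_le)
    finally have "enat n \<le> enat (card ?A) + enat (card ?B)" by simp
    also have "\<dots> \<le> chain_len (F K N) + chain_len (F N P)"
    proof (intro add_mono card_jumps_le_chain_len)
      fix i assume i: "i \<le> n"
      show "H i \<inter> N \<in> F K N" using H(1) i assms i_intersect by (auto simp: F)
      show "H i <+>\<^bsub>R\<^esub> N \<in> F N P"
        using H(1) i assms add_ideals subset_set_add set_add_least[OF P, of "H i" N] by (auto simp: F)
    next
      fix i assume i: "i < n"
      then have s: "H i \<subseteq> H (Suc i)" using H by auto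
      then show "H i \<inter> N \<subseteq> H (Suc i) \<inter> N" by auto
      show "H i <+>\<^bsub>R\<^esub> N \<subseteq> H (Suc i) <+>\<^bsub>R\<^esub> N" using s unfolding set_add_def' by blast
    qed
    finally show "enat n \<le> chain_len (F K N) + chain_len (F N P)" .
  qed
  have ne: "F K N \<noteq> {}" "F N P \<noteq> {}" "F K P \<noteq> {}"
    using assms F[of N] by blast+
  have mono: "chain_len (F K N) \<le> chain_len (F K P)" "chain_len (F N P) \<le> chain_len (F K P)"
    using assms by (intro chain_len_mono[of _ "\<lambda>x. x"]; auto simp: F)+
  show "ideal_length R K N + ideal_length R N P \<le> ideal_length R K P"
  proof (cases "chain_len (F K N) = \<infinity> \<or> chain_len (F N P) = \<infinity>")
    case True
    then show ?thesis using mono unfolding length by auto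
  next
    case False
    then obtain m n where mn: "chain_len (F K N) = enat m" "chain_len (F N P) = enat n" by auto
    obtain G where G: "\<forall>i\<le>m. G i \<in> F K N" "\<forall>i<m. G i \<subset> G (Suc i)"
      using le_chain_len_iff[OF ne(1), of m] mn by auto
    obtain H where H: "\<forall>i\<le>n. H i \<in> F N P" "\<forall>i<n. H i \<subset> H (Suc i)"
      using le_chain_len_iff[OF ne(2), of n] mn by auto
    let ?J = "\<lambda>i. if i \<le> m then G i else H (i - m)"
    have "?J i \<in> F K P" if "i \<le> m + n" for i
    proof (cases "i \<le> m")
      case True
      then have "G i \<in> F K N" using G(1) by blast
      then show ?thesis using True assms(5) by (auto simp: F)
    next
      case False
      then have "H (i - m) \<in> F N P" using H(1) that by simp
      then show ?thesis using False assms(4) by (auto simp: F)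
    qed
    moreover have "?J i \<subset> ?J (Suc i)" if "i < m + n" for i
    proof -
      consider "i < m" | "i = m" | "i > m" by linarith
      then show ?thesis
      proof cases
        case 2
        then have "G m \<subseteq> N" "N \<subseteq> H 0" "H 0 \<subset> H (Suc 0)" using G H that by (auto simp: F)
        then show ?thesis using 2 by auto
      next
        case 3
        then have "Suc i - m = Suc (i - m)" by simp
        then show ?thesis using 3 H(2) that by auto
      qed (use G(2) in auto)
    qed
    ultimately have "enat (m + n) \<le> chain_len (F K P)"
      by (subst le_chain_len_iff[OF ne(3)]) (intro exI[of _ ?J]; blast)
    then show ?thesis using mn unfolding length by simp
  qed
qed

lemma ideal_length_zero_imp_eq:
  assumes "ideal K R" "ideal N R" "K \<subseteq> N" "ideal_length R K N = 0"
  shows "K = N"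
proof (rule ccontr)
  assume "K \<noteq> N"
  let ?F = "{H. ideal H R \<and> K \<subseteq> H \<and> H \<subseteq> N}"
  let ?H = "\<lambda>i. if i = (0::nat) then K else N"
  have "\<forall>i\<le>1. ?H i \<in> ?F" "\<forall>i<1. ?H i \<subset> ?H (Suc i)"
    using assms \<open>K \<noteq> N\<close> by auto
  moreover have "?F \<noteq> {}" using assms by auto
  ultimately have "enat 1 \<le> chain_len ?F"
    by (subst le_chain_len_iff) (auto intro!: exI[of _ ?H])
  then show False using assms(4) unfolding ideal_length_def by (simp add: zero_enat_def one_enat_def)
qed

end

lemma (in cring) module_length_eq_ideal_length:
  fixes M :: "('a, 'm) module"
  assumes N: "ideal N R" and K: "ideal K R" "K \<subseteq> N"
    and car: "carrier M = \<phi> ` N"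
    and add: "\<And>x y. x \<in> N \<Longrightarrow> y \<in> N \<Longrightarrow> \<phi> (x \<oplus> y) = \<phi> x \<oplus>\<^bsub>M\<^esub> \<phi> y"
    and zero: "\<phi> \<zero> = \<zero>\<^bsub>M\<^esub>"
    and smult: "\<And>c x. c \<in> carrier R \<Longrightarrow> x \<in> N \<Longrightarrow> \<phi> (c \<otimes> x) = c \<odot>\<^bsub>M\<^esub> \<phi> x"
    and ker: "\<And>x. x \<in> N \<Longrightarrow> \<phi> x = \<phi> \<zero> \<longleftrightarrow> x \<in> K"
  shows "module_length R M = ideal_length R K N"
proof -
  interpret N: ideal N R by fact
  interpret K: ideal K R by fact
  let ?G = "add_monoid M"
  have grp: "group ?G"
  proof (rule groupI)
    fix x y z assume "x \<in> carrier ?G" "y \<in> carrier ?G" "z \<in> carrier ?G"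
    then obtain u v w where u: "x = \<phi> u" "u \<in> N" and v: "y = \<phi> v" "v \<in> N" and w: "z = \<phi> w" "w \<in> N"
      using car by auto
    show "x \<otimes>\<^bsub>?G\<^esub> y \<otimes>\<^bsub>?G\<^esub> z = x \<otimes>\<^bsub>?G\<^esub> (y \<otimes>\<^bsub>?G\<^esub> z)"
      using u v w by (simp add: add[symmetric] N.Icarr a_assoc)
  next
    fix x assume "x \<in> carrier ?G"
    then obtain u where u: "x = \<phi> u" "u \<in> N" using car by auto
    show "\<one>\<^bsub>?G\<^esub> \<otimes>\<^bsub>?G\<^esub> x = x" using u by (simp add: add[symmetric] zero[symmetric] N.Icarr)
    have "\<phi> (\<ominus> u) \<otimes>\<^bsub>?G\<^esub> x = \<one>\<^bsub>?G\<^esub>"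
      using u by (simp add: add[symmetric] zero[symmetric] N.Icarr l_neg)
    then show "\<exists>y\<in>carrier ?G. y \<otimes>\<^bsub>?G\<^esub> x = \<one>\<^bsub>?G\<^esub>" using u car by auto
  qed (use car add[symmetric] zero[symmetric] in auto)
  interpret G: group ?G by fact
  have inv: "inv\<^bsub>?G\<^esub> (\<phi> u) = \<phi> (\<ominus> u)" if "u \<in> N" for u
    using that car by (intro G.inv_equality) (auto simp: add[symmetric] zero[symmetric] N.Icarr l_neg)
  have eqK: "x \<ominus> y \<in> K" if "\<phi> x = \<phi> y" "x \<in> N" "y \<in> N" for x y
  proof -
    have "\<phi> (x \<ominus> y) = \<phi> x \<otimes>\<^bsub>?G\<^esub> inv\<^bsub>?G\<^esub> (\<phi> y)"
      using that inv add by (simp add: a_minus_def)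
    also have "\<dots> = \<phi> y \<otimes>\<^bsub>?G\<^esub> inv\<^bsub>?G\<^esub> (\<phi> y)" using that(1) by (rule arg_cong)
    also have "\<dots> = \<one>\<^bsub>?G\<^esub>" using that(3) car by (intro G.r_inv) auto
    also have "\<dots> = \<phi> \<zero>" by (simp add: zero)
    finally show ?thesis using ker that by (simp add: a_minus_def)
  qed
  let ?F = "{H. ideal H R \<and> K \<subseteq> H \<and> H \<subseteq> N}" and ?S = "{L. submodule L R M}"
  have sub: "submodule (\<phi> ` H) R M" if H: "ideal H R" "H \<subseteq> N" for H
  proof -
    interpret H: ideal H R by fact
    show ?thesis
    proof (intro submodule.intro submodule_axioms.intro subgroup.intro)
      show "\<phi> ` H \<subseteq> carrier ?G" using H(2) car by auto
      show "x \<otimes>\<^bsub>?G\<^esub> y \<in> \<phi> ` H" if "x \<in> \<phi> ` H" "y \<in> \<phi> ` H" for x y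
        using that H(2) by (auto simp: add[symmetric] subset_iff)
      show "\<one>\<^bsub>?G\<^esub> \<in> \<phi> ` H" using zero[symmetric] by auto
      show "inv\<^bsub>?G\<^esub> x \<in> \<phi> ` H" if "x \<in> \<phi> ` H" for x
        using that H(2) by (auto simp: inv subset_iff)
      show "c \<odot>\<^bsub>M\<^esub> x \<in> \<phi> ` H" if "c \<in> carrier R" "x \<in> \<phi> ` H" for c x
        using that H(2) by (auto simp: smult[symmetric] subset_iff H.I_l_closed)
    qed
  qed
  have idl: "ideal {x\<in>N. \<phi> x \<in> L} R" if "submodule L R M" for L
  proof -
    interpret L: submodule L R M by fact
    show ?thesis
    proof (rule idealI[OF ring_axioms])
      show "subgroup {x\<in>N. \<phi> x \<in> L} (add_monoid R)"
      proof (rule add.subgroupI)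
        show "{x\<in>N. \<phi> x \<in> L} \<subseteq> carrier R" using N.Icarr by auto
        have "\<zero> \<in> {x\<in>N. \<phi> x \<in> L}" using zero L.one_closed by simp
        then show "{x\<in>N. \<phi> x \<in> L} \<noteq> {}" by blast
        show "\<ominus> x \<in> {x\<in>N. \<phi> x \<in> L}" if "x \<in> {x\<in>N. \<phi> x \<in> L}" for x
          using that L.m_inv_closed[of "\<phi> x"] inv by auto
        show "x \<oplus> y \<in> {x\<in>N. \<phi> x \<in> L}" if "x \<in> {x\<in>N. \<phi> x \<in> L}" "y \<in> {x\<in>N. \<phi> x \<in> L}" for x y
          using that L.m_closed[of "\<phi> x" "\<phi> y"] by (auto simp: add)
      qed
      fix x c assume x: "x \<in> {x\<in>N. \<phi> x \<in> L}" and c: "c \<in> carrier R"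
      then show *: "c \<otimes> x \<in> {x\<in>N. \<phi> x \<in> L}" using L.smult_closed[of c "\<phi> x"]
        by (auto simp: smult N.I_l_closed)
      show "x \<otimes> c \<in> {x\<in>N. \<phi> x \<in> L}"
        using * x c N.Icarr m_comm[of c x] by auto
    qed
  qed
  have KL: "K \<subseteq> {x\<in>N. \<phi> x \<in> L}" if "submodule L R M" for L
  proof
    fix x assume "x \<in> K"
    then have "x \<in> N" "\<phi> x = \<zero>\<^bsub>M\<^esub>" using K(2) ker[of x] zero by auto
    then show "x \<in> {x\<in>N. \<phi> x \<in> L}"
      using subgroup.one_closed[OF submodule.axioms(1)[OF that]] by simp
  qed
  have img: "\<phi> ` {x\<in>N. \<phi> x \<in> L} = L" if "submodule L R M" for L
    using subgroup.subset[OF submodule.axioms(1)[OF that]] car by auto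
  have pre: "{x\<in>N. \<phi> x \<in> \<phi> ` H} = H" if H: "ideal H R" "K \<subseteq> H" "H \<subseteq> N" for H
  proof
    interpret H: ideal H R by fact
    show "{x\<in>N. \<phi> x \<in> \<phi> ` H} \<subseteq> H"
    proof
      fix x assume "x \<in> {x\<in>N. \<phi> x \<in> \<phi> ` H}"
      then obtain y where y: "x \<in> N" "y \<in> H" "\<phi> x = \<phi> y" by auto
      then have "x \<ominus> y \<in> H" using eqK H by blast
      then have "(x \<ominus> y) \<oplus> y \<in> H" using y by simp
      moreover have "(x \<ominus> y) \<oplus> y = x" using y N.Icarr H.Icarr by algebra
      ultimately show "x \<in> H" by simp
    qed
  qed (use H in auto)
  have "chain_len ?S \<le> chain_len ?F"
  proof (rule chain_len_mono[where f = "\<lambda>L. {x\<in>N. \<phi> x \<in> L}"])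
    show "{x\<in>N. \<phi> x \<in> L} \<in> ?F" if "L \<in> ?S" for L using idl KL that by auto
    show "{x\<in>N. \<phi> x \<in> L} \<subset> {x\<in>N. \<phi> x \<in> L'}" if "L \<in> ?S" "L' \<in> ?S" "L \<subset> L'" for L L'
    proof (rule psubsetI)
      show "{x\<in>N. \<phi> x \<in> L} \<noteq> {x\<in>N. \<phi> x \<in> L'}"
      proof
        assume eq: "{x\<in>N. \<phi> x \<in> L} = {x\<in>N. \<phi> x \<in> L'}"
        have "submodule L R M" "submodule L' R M" using that(1,2) by auto
        from this[THEN img] have "L = L'" unfolding eq by (rule box_equals[OF refl])
        then show False using that(3) by simp
      qed
    qed (use that(3) in auto)
  qed
  moreover have "chain_len ?F \<le> chain_len ?S"
  proof (rule chain_len_mono[where f = "\<lambda>H. \<phi> ` H"])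
    show "\<phi> ` H \<in> ?S" if "H \<in> ?F" for H using sub that by auto
    show "\<phi> ` H \<subset> \<phi> ` H'" if "H \<in> ?F" "H' \<in> ?F" "H \<subset> H'" for H H'
    proof (rule psubsetI)
      show "\<phi> ` H \<noteq> \<phi> ` H'"
      proof
        assume eq: "\<phi> ` H = \<phi> ` H'"
        have "{x\<in>N. \<phi> x \<in> \<phi> ` H} = H" "{x\<in>N. \<phi> x \<in> \<phi> ` H'} = H'"
          using that(1,2) by (simp_all only: mem_Collect_eq pre)
        then have "H = H'" unfolding eq by (rule box_equals[OF refl])
        then show False using that(3) by simp
      qed
    qed (use that(3) in auto)
  qed
  ultimately show ?thesis
    unfolding module_length_def ideal_length_def chain_len_def mem_Collect_eq by (rule antisym)
qed


lemma (in cring) quot_length_eq_ideal_length: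
  fixes M :: "('a, 'c set) module" and C :: "('c, 'd) ring_scheme"
  assumes N: "ideal N R" and K: "ideal K R" "K \<subseteq> N"
    and C: "abelian_group C" and B: "additive_subgroup B C"
    and \<psi>: "\<And>x. x \<in> N \<Longrightarrow> \<psi> x \<in> carrier C"
    and add: "\<And>x y. x \<in> N \<Longrightarrow> y \<in> N \<Longrightarrow> \<psi> (x \<oplus> y) = \<psi> x \<oplus>\<^bsub>C\<^esub> \<psi> y"
    and act: "\<And>c x. c \<in> carrier R \<Longrightarrow> x \<in> N \<Longrightarrow> \<psi> (c \<otimes> x) = act c (\<psi> x)"
    and act_add: "\<And>c u v. c \<in> carrier R \<Longrightarrow> u \<in> carrier C \<Longrightarrow> v \<in> carrier C \<Longrightarrow>
      act c (u \<oplus>\<^bsub>C\<^esub> v) = act c u \<oplus>\<^bsub>C\<^esub> act c v"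
    and act_B: "\<And>c u. c \<in> carrier R \<Longrightarrow> u \<in> B \<Longrightarrow> act c u \<in> B"
    and ker: "\<And>x. x \<in> N \<Longrightarrow> \<psi> x \<in> B \<longleftrightarrow> x \<in> K"
    and M: "carrier M = (\<lambda>x. B +>\<^bsub>C\<^esub> \<psi> x) ` N" "add M = set_add C" "\<zero>\<^bsub>M\<^esub> = B"
      "\<And>c U. c \<in> carrier R \<Longrightarrow> c \<odot>\<^bsub>M\<^esub> U = (\<Union>x\<in>U. B +>\<^bsub>C\<^esub> act c x)"
  shows "module_length R M = ideal_length R K N"
proof (rule module_length_eq_ideal_length[where \<phi> = "\<lambda>x. B +>\<^bsub>C\<^esub> \<psi> x"])
  interpret C: abelian_group C by fact
  interpret B: additive_subgroup B C by fact
  interpret B: abelian_subgroup B C by (rule abelian_subgroupI3[OF B C])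
  interpret N: ideal N R by fact
  have Bc: "B +>\<^bsub>C\<^esub> u = B" if "u \<in> B" for u
    using that B.a_subset by (intro C.a_coset_join2 B.a_subgroup) auto
  have "\<psi> \<zero> \<oplus>\<^bsub>C\<^esub> \<psi> \<zero> = \<psi> \<zero>" using add[of \<zero> \<zero>] by simp
  then have \<psi>0: "\<psi> \<zero> = \<zero>\<^bsub>C\<^esub>" using \<psi>[of \<zero>] C.add.l_cancel_one'[of "\<psi> \<zero>" "\<psi> \<zero>"] by simp
  show "B +>\<^bsub>C\<^esub> \<psi> \<zero> = \<zero>\<^bsub>M\<^esub>" using M(3) \<psi>0 Bc by simp
  show "B +>\<^bsub>C\<^esub> \<psi> (x \<oplus> y) = (B +>\<^bsub>C\<^esub> \<psi> x) \<oplus>\<^bsub>M\<^esub> (B +>\<^bsub>C\<^esub> \<psi> y)" if "x \<in> N" "y \<in> N" for x y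
    using that \<psi> by (simp add: M(2) add B.a_rcos_sum)
  show "B +>\<^bsub>C\<^esub> \<psi> (c \<otimes> x) = c \<odot>\<^bsub>M\<^esub> (B +>\<^bsub>C\<^esub> \<psi> x)" if c: "c \<in> carrier R" and x: "x \<in> N" for c x
  proof -
    have cc: "act c (\<psi> x) \<in> carrier C" using act[OF c x, symmetric] \<psi> N.I_l_closed c x by simp
    have "B +>\<^bsub>C\<^esub> act c u = B +>\<^bsub>C\<^esub> act c (\<psi> x)" if u: "u \<in> B +>\<^bsub>C\<^esub> \<psi> x" for u
    proof -
      obtain v where v: "v \<in> B" "u = v \<oplus>\<^bsub>C\<^esub> \<psi> x"
        using u by (auto simp: a_r_coset_def')
      have "act c u = act c v \<oplus>\<^bsub>C\<^esub> act c (\<psi> x)"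
        using v x c \<psi> B.a_Hcarr act_add by simp
      then have "act c u \<in> B +>\<^bsub>C\<^esub> act c (\<psi> x)"
        using act_B[OF c v(1)] unfolding a_r_coset_def' by auto
      then show ?thesis using C.a_repr_independence[OF _ cc B.a_subgroup] by simp
    qed
    moreover have "B +>\<^bsub>C\<^esub> \<psi> x \<noteq> {}" using B.a_rcos_self \<psi> x by blast
    ultimately have "(\<Union>u\<in>B +>\<^bsub>C\<^esub> \<psi> x. B +>\<^bsub>C\<^esub> act c u) = B +>\<^bsub>C\<^esub> act c (\<psi> x)" by auto
    then show ?thesis using M(4)[OF c] act[OF c x] by simp
  qed
  show "B +>\<^bsub>C\<^esub> \<psi> x = B +>\<^bsub>C\<^esub> \<psi> \<zero> \<longleftrightarrow> x \<in> K" if "x \<in> N" for x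
  proof -
    have "B +>\<^bsub>C\<^esub> \<psi> x = B \<longleftrightarrow> \<psi> x \<in> B"
    proof
      assume "B +>\<^bsub>C\<^esub> \<psi> x = B"
      then show "\<psi> x \<in> B" using B.a_rcos_self[OF \<psi>[OF that]] by simp
    qed (rule Bc)
    then show ?thesis using ker[OF that] \<psi>0 Bc by simp
  qed
qed (use assms in auto)

lemma (in ring) ideal_module_simps [simp]:
  "carrier (ideal_module R N) = N" "add (ideal_module R N) = add R"
  "\<zero>\<^bsub>ideal_module R N\<^esub> = \<zero>" "smult (ideal_module R N) = monoid.mult R"
  by (simp_all add: ideal_module_def)

lemma (in ring) abelian_group_ideal_module:
  assumes "ideal N R"
  shows "abelian_group (ideal_module R N)"
proof -
  interpret N: ideal N R by fact
  show ?thesis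
    by (rule abelian_groupI)
      (auto simp: N.Icarr a_assoc intro: a_comm intro!: bexI[of _ "\<ominus> _"] simp: l_neg)
qed

lemma (in cring) subquot_length:
  assumes N: "ideal N R" and K: "ideal K R" "K \<subseteq> N"
  shows "module_length R (subquot R N K) = ideal_length R K N"
proof (rule quot_length_eq_ideal_length[where C = "ideal_module R N" and B = K
      and \<psi> = "\<lambda>x. x" and act = "(\<otimes>)"])
  interpret K: ideal K R by fact
  interpret N: ideal N R by fact
  show "additive_subgroup K (ideal_module R N)"
  proof (intro additive_subgroup.intro subgroup.intro)
    fix x assume x: "x \<in> K"
    have "inv\<^bsub>add_monoid (ideal_module R N)\<^esub> x = \<ominus> x"
      using x K(2) N.Icarr
      by (intro group.inv_equality[OF abelian_group.a_group[OF abelian_group_ideal_module[OF N]]])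
        (auto simp: l_neg)
    then show "inv\<^bsub>add_monoid (ideal_module R N)\<^esub> x \<in> K" using x by simp
  qed (use K(2) in auto)
  show "carrier (subquot R N K) = (\<lambda>x. K +>\<^bsub>ideal_module R N\<^esub> x) ` N"
    by (auto simp: quot_module_def A_RCOSETS_def' a_r_coset_def')
qed (use N K N[THEN ideal.Icarr] in \<open>auto simp: quot_module_def abelian_group_ideal_module
      ideal.I_l_closed r_distr subset_iff\<close>)

lemma (in cring) ideal_l_coset:
  assumes "ideal Q R" "a \<in> carrier R"
  shows "ideal (a <# Q) R"
proof -
  interpret Q: ideal Q R by fact
  show ?thesis
  proof (rule idealI[OF ring_axioms])
    show "subgroup (a <# Q) (add_monoid R)"
    proof (rule add.subgroupI)
      show "a <# Q \<subseteq> carrier R" using assms(2) Q.Icarr by (auto simp: l_coset_def)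
      have "a \<otimes> \<zero> \<in> a <# Q" using Q.zero_closed unfolding l_coset_def by blast
      then show "a <# Q \<noteq> {}" by blast
      show "\<ominus> x \<in> a <# Q" if x: "x \<in> a <# Q" for x
      proof -
        obtain q where q: "q \<in> Q" "x = a \<otimes> q" using x by (auto simp: l_coset_def)
        then have "\<ominus> x = a \<otimes> (\<ominus> q)" using assms(2) Q.Icarr by (simp add: r_minus)
        then show ?thesis using q by (auto simp: l_coset_def)
      qed
      show "x \<oplus> y \<in> a <# Q" if xy: "x \<in> a <# Q" "y \<in> a <# Q" for x y
      proof -
        obtain q p where q: "q \<in> Q" "x = a \<otimes> q" "p \<in> Q" "y = a \<otimes> p"
          using xy by (auto simp: l_coset_def)
        then have "x \<oplus> y = a \<otimes> (q \<oplus> p)" using assms(2) Q.Icarr by (simp add: r_distr)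
        then show ?thesis using q by (auto simp: l_coset_def)
      qed
    qed
    fix x c assume x: "x \<in> a <# Q" and c: "c \<in> carrier R"
    then obtain q where q: "q \<in> Q" "x = a \<otimes> q" by (auto simp: l_coset_def)
    then have e: "x \<otimes> c = a \<otimes> (q \<otimes> c)" "c \<otimes> x = a \<otimes> (q \<otimes> c)"
      using assms(2) c Q.Icarr m_assoc m_comm by (auto simp: m_ac)
    have "q \<otimes> c \<in> Q" using q c Q.I_r_closed by simp
    then show "x \<otimes> c \<in> a <# Q" "c \<otimes> x \<in> a <# Q"
      unfolding e by (auto simp: l_coset_def)
  qed
qed

lemma (in cring) ideal_length_mult:
  assumes Q: "ideal Q R" and K: "ideal K R" and a: "a \<in> carrier R"
    and C: "ideal C R" "C \<subseteq> Q" "\<And>q. q \<in> Q \<Longrightarrow> a \<otimes> q \<in> K \<longleftrightarrow> q \<in> C"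
  shows "ideal_length R K ((a <# Q) <+>\<^bsub>R\<^esub> K) = ideal_length R C Q"
proof -
  interpret K: ideal K R by fact
  interpret Q: ideal Q R by fact
  let ?P = "(a <# Q) <+>\<^bsub>R\<^esub> K"
  have aQ: "ideal (a <# Q) R" by (rule ideal_l_coset[OF Q a])
  have P: "ideal ?P R" "K \<subseteq> ?P" "a <# Q \<subseteq> ?P"
    using add_ideals[OF aQ K] subset_set_add[OF aQ K] by auto
  interpret P: ideal ?P R by fact
  have KI: "abelian_subgroup K R" by (rule K.is_abelian_subgroup) 
  have "module_length R (subquot R ?P K) = ideal_length R C Q"
  proof (rule quot_length_eq_ideal_length[where C = R and B = K
        and \<psi> = "\<lambda>x. a \<otimes> x" and act = "(\<otimes>)"])
    show "carrier (subquot R ?P K) = (\<lambda>x. K +>\<^bsub>R\<^esub> (a \<otimes> x)) ` Q"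
    proof -
      have "carrier (subquot R ?P K) = (\<lambda>x. K +>\<^bsub>R\<^esub> x) ` ?P"
        by (auto simp: quot_module_def A_RCOSETS_def' a_r_coset_def')
      also have "\<dots> = (\<lambda>x. K +>\<^bsub>R\<^esub> (a \<otimes> x)) ` Q"
      proof
        show "(\<lambda>x. K +>\<^bsub>R\<^esub> (a \<otimes> x)) ` Q \<subseteq> (\<lambda>x. K +>\<^bsub>R\<^esub> x) ` ?P"
          using P(3) by (auto simp: l_coset_def)
        show "(\<lambda>x. K +>\<^bsub>R\<^esub> x) ` ?P \<subseteq> (\<lambda>x. K +>\<^bsub>R\<^esub> (a \<otimes> x)) ` Q"
        proof
          fix U assume "U \<in> (\<lambda>x. K +>\<^bsub>R\<^esub> x) ` ?P"
          then obtain q k where q: "q \<in> Q" "k \<in> K" "U = K +>\<^bsub>R\<^esub> ((a \<otimes> q) \<oplus> k)"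
            by (auto simp: l_coset_def set_add_def')
          have c: "a \<otimes> q \<in> carrier R" "k \<in> carrier R" using q Q.Icarr K.Icarr a by auto
          then have "(a \<otimes> q) \<oplus> k = k \<oplus> (a \<otimes> q)" by (simp add: a_comm)
          then have "(a \<otimes> q) \<oplus> k \<in> K +>\<^bsub>R\<^esub> (a \<otimes> q)"
            using q(2) by (auto simp: a_r_coset_def')
          then have "U = K +>\<^bsub>R\<^esub> (a \<otimes> q)"
            using a_repr_independence[OF _ c(1) K.a_subgroup, of "(a \<otimes> q) \<oplus> k"] q(3) by simp
          then show "U \<in> (\<lambda>x. K +>\<^bsub>R\<^esub> (a \<otimes> x)) ` Q" using q(1) by blast
        qed
      qed
      finally show ?thesis .
    qed
    show "c \<odot>\<^bsub>subquot R ?P K\<^esub> U = (\<Union>x\<in>U. K +>\<^bsub>R\<^esub> (c \<otimes> x))" for c U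
      by (simp add: quot_module_def a_r_coset_def')
    show "add (subquot R ?P K) = set_add R"
      by (intro ext) (simp add: quot_module_def set_add_def')
  qed (use assms Q.Icarr in \<open>auto simp: quot_module_def is_abelian_group K.is_additive_subgroup
        r_distr m_lcomm K.I_l_closed\<close>)
  then show ?thesis using subquot_length[OF P(1) K P(2)] by simp
qed

section \<open>Local rings of depth two\<close>

lemma (in noetherian_ring) exists_maximal_ideal_in:
  assumes "\<Q> \<noteq> {}" and "\<And>A. A \<in> \<Q> \<Longrightarrow> ideal A R"
  shows "\<exists>A\<in>\<Q>. \<forall>Q\<in>\<Q>. A \<subseteq> Q \<longrightarrow> Q = A"
proof (rule subset_Zorn_nonempty[OF assms(1)])
  fix \<C> assume \<C>: "\<C> \<noteq> {}" "subset.chain \<Q> \<C>"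
  then have "subset.chain {A. ideal A R} \<C>"
    using assms(2) by (auto simp: subset.chain_def)
  then have "\<Union>\<C> \<in> \<C>" by (rule ideal_chain_is_trivial[OF \<C>(1)])
  then show "\<Union>\<C> \<in> \<Q>" using \<C>(2) by (auto simp: subset.chain_def)
qed

lemma (in cring) ideal_colon:
  assumes "ideal Q R" "z \<in> carrier R"
  shows "ideal {c \<in> carrier R. z \<otimes> c \<in> Q} R"
proof -
  interpret Q: ideal Q R by fact
  show ?thesis
  proof (rule idealI[OF ring_axioms])
    show "subgroup {c \<in> carrier R. z \<otimes> c \<in> Q} (add_monoid R)"
    proof (rule add.subgroupI)
      have "z \<otimes> \<zero> \<in> Q" using assms(2) by simp
      then show "{c \<in> carrier R. z \<otimes> c \<in> Q} \<noteq> {}" by blast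
    qed (use assms(2) in \<open>auto simp: r_minus r_distr\<close>)
    fix c d assume c: "c \<in> {c \<in> carrier R. z \<otimes> c \<in> Q}" and d: "d \<in> carrier R"
    then have "z \<otimes> (d \<otimes> c) = d \<otimes> (z \<otimes> c)" "z \<otimes> (c \<otimes> d) = d \<otimes> (z \<otimes> c)"
      using assms(2) by (auto simp: m_ac)
    then show "d \<otimes> c \<in> {c \<in> carrier R. z \<otimes> c \<in> Q}" "c \<otimes> d \<in> {c \<in> carrier R. z \<otimes> c \<in> Q}"
      using c d Q.I_l_closed by auto
  qed
qed

text \<open>Exactness of the Koszul complex of the pair \<open>(a, b)\<close> in degree 1.\<close>

definition trivial_syzygies :: "('a, 'b) ring_scheme \<Rightarrow> 'a \<Rightarrow> 'a \<Rightarrow> bool" where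
  "trivial_syzygies R a b \<longleftrightarrow> (\<forall>u\<in>carrier R. \<forall>v\<in>carrier R. u \<otimes>\<^bsub>R\<^esub> a = v \<otimes>\<^bsub>R\<^esub> b \<longrightarrow>
     (\<exists>w\<in>carrier R. u = w \<otimes>\<^bsub>R\<^esub> b \<and> v = w \<otimes>\<^bsub>R\<^esub> a))"

context cring
begin

lemma trivial_syzygiesE:
  assumes "trivial_syzygies R a b" "u \<in> carrier R" "v \<in> carrier R" "u \<otimes> a = v \<otimes> b"
  obtains w where "w \<in> carrier R" "u = w \<otimes> b" "v = w \<otimes> a"
  using assms unfolding trivial_syzygies_def by blast

lemma trivial_syzygies_sym: "trivial_syzygies R a b \<Longrightarrow> trivial_syzygies R b a"
  unfolding trivial_syzygies_def by metis

lemma trivial_syzygies_one: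
  assumes "a \<in> carrier R"
  shows "trivial_syzygies R a \<one>"
  unfolding trivial_syzygies_def using assms by auto

lemma trivial_syzygies_mult:
  assumes "a \<in> carrier R" "b \<in> carrier R" "c \<in> carrier R"
    and "trivial_syzygies R a b" "trivial_syzygies R a c"
  shows "trivial_syzygies R a (b \<otimes> c)"
  unfolding trivial_syzygies_def
proof (intro ballI impI)
  fix u v assume u: "u \<in> carrier R" and v: "v \<in> carrier R" and eq: "u \<otimes> a = v \<otimes> (b \<otimes> c)"
  have "u \<otimes> a = (v \<otimes> b) \<otimes> c" using eq assms u v by (simp add: m_assoc)
  then obtain w where w: "w \<in> carrier R" "u = w \<otimes> c" "v \<otimes> b = w \<otimes> a"
    using trivial_syzygiesE[OF assms(5) u, of "v \<otimes> b"] v assms(2) by auto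
  obtain t where t: "t \<in> carrier R" "w = t \<otimes> b" "v = t \<otimes> a"
    using trivial_syzygiesE[OF assms(4) w(1) v] w(3) by auto
  show "\<exists>w\<in>carrier R. u = w \<otimes> (b \<otimes> c) \<and> v = w \<otimes> a"
    using t w assms by (intro bexI[of _ t]) (auto simp: m_assoc)
qed

lemma trivial_syzygies_pow:
  fixes m n :: nat
  assumes "a \<in> carrier R" "b \<in> carrier R" "trivial_syzygies R a b"
  shows "trivial_syzygies R (a [^] m) (b [^] n)"
proof -
  have *: "trivial_syzygies R c (d [^] n)"
    if "c \<in> carrier R" "d \<in> carrier R" "trivial_syzygies R c d" for c d and n :: nat
    using that by (induction n) (auto intro: trivial_syzygies_one trivial_syzygies_mult)
  show ?thesis
    using assms by (intro * trivial_syzygies_sym[OF *]) (auto intro: trivial_syzygies_sym)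
qed

text \<open>The ideal \<open>(a, b)\<close> annihilates the homology of the Koszul complex of \<open>(a, b)\<close>: multiplying a
  syzygy \<open>(u, v)\<close> by \<open>x\<close> or \<open>y\<close> makes it trivial, and regularity of \<open>x, y\<close> allows to cancel.\<close>

lemma trivial_syzygies_of_regular:
  assumes c: "a \<in> carrier R" "b \<in> carrier R" "p \<in> carrier R" "q \<in> carrier R"
      "p' \<in> carrier R" "q' \<in> carrier R"
    and x: "x = p \<otimes> a \<oplus> q \<otimes> b" and y: "y = p' \<otimes> a \<oplus> q' \<otimes> b"
    and nzd: "\<And>z. z \<in> carrier R \<Longrightarrow> x \<otimes> z = \<zero> \<Longrightarrow> z = \<zero>"
    and xy: "trivial_syzygies R x y"
  shows "trivial_syzygies R a b"
  unfolding trivial_syzygies_def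
proof (intro ballI impI)
  have xc: "x \<in> carrier R" "y \<in> carrier R" using c x y by auto
  have cancel: "z = z'" if "z \<in> carrier R" "z' \<in> carrier R" "x \<otimes> z = x \<otimes> z'" for z z'
  proof -
    have "x \<otimes> (z \<ominus> z') = \<zero>" using that xc by algebra
    then have "z \<ominus> z' = \<zero>" using nzd that by simp
    then show ?thesis using that by (simp add: r_right_minus_eq)
  qed
  fix u v assume uv: "u \<in> carrier R" "v \<in> carrier R" and eq: "u \<otimes> a = v \<otimes> b"
  define w where "w = p \<otimes> v \<oplus> q \<otimes> u"
  define w' where "w' = p' \<otimes> v \<oplus> q' \<otimes> u"
  have wc: "w \<in> carrier R" "w' \<in> carrier R" using c uv by (auto simp: w_def w'_def)
  have lin: "(s \<otimes> a \<oplus> t \<otimes> b) \<otimes> u = (s \<otimes> v \<oplus> t \<otimes> u) \<otimes> b"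
    "(s \<otimes> a \<oplus> t \<otimes> b) \<otimes> v = (s \<otimes> v \<oplus> t \<otimes> u) \<otimes> a"
    if "s \<in> carrier R" "t \<in> carrier R" for s t
  proof -
    have "(s \<otimes> a \<oplus> t \<otimes> b) \<otimes> u = s \<otimes> (u \<otimes> a) \<oplus> t \<otimes> (u \<otimes> b)" using that c uv by algebra
    also have "\<dots> = (s \<otimes> v \<oplus> t \<otimes> u) \<otimes> b" unfolding eq using that c uv by algebra
    finally show "(s \<otimes> a \<oplus> t \<otimes> b) \<otimes> u = (s \<otimes> v \<oplus> t \<otimes> u) \<otimes> b" .
    have "(s \<otimes> a \<oplus> t \<otimes> b) \<otimes> v = s \<otimes> (v \<otimes> a) \<oplus> t \<otimes> (v \<otimes> b)" using that c uv by algebra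
    also have "\<dots> = (s \<otimes> v \<oplus> t \<otimes> u) \<otimes> a" unfolding eq[symmetric] using that c uv by algebra
    finally show "(s \<otimes> a \<oplus> t \<otimes> b) \<otimes> v = (s \<otimes> v \<oplus> t \<otimes> u) \<otimes> a" .
  qed
  have xw: "x \<otimes> u = w \<otimes> b" "x \<otimes> v = w \<otimes> a" and yw: "y \<otimes> u = w' \<otimes> b" "y \<otimes> v = w' \<otimes> a"
    using lin c by (auto simp: x y w_def w'_def)
  define d where "d = y \<otimes> w \<ominus> x \<otimes> w'"
  have dc: "d \<in> carrier R" using xc wc by (simp add: d_def)
  have "d \<otimes> b = y \<otimes> (w \<otimes> b) \<ominus> x \<otimes> (w' \<otimes> b)" unfolding d_def using xc wc c(1,2) by algebra
  also have "\<dots> = \<zero>" unfolding xw[symmetric] yw[symmetric] using xc uv by algebra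
  finally have db: "d \<otimes> b = \<zero>" .
  have "d \<otimes> a = y \<otimes> (w \<otimes> a) \<ominus> x \<otimes> (w' \<otimes> a)" unfolding d_def using xc wc c(1,2) by algebra
  also have "\<dots> = \<zero>" unfolding xw[symmetric] yw[symmetric] using xc uv by algebra
  finally have da: "d \<otimes> a = \<zero>" .
  have "x \<otimes> d = p \<otimes> (d \<otimes> a) \<oplus> q \<otimes> (d \<otimes> b)" unfolding x using c dc by algebra
  then have "x \<otimes> d = \<zero>" using da db c by simp
  then have "d = \<zero>" using nzd dc by simp
  then have "y \<otimes> w = x \<otimes> w'" using xc wc by (simp add: d_def r_right_minus_eq)
  then have "w' \<otimes> x = w \<otimes> y" using xc wc m_comm by metis
  then obtain t where t: "t \<in> carrier R" "w' = t \<otimes> y" "w = t \<otimes> x"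
    using trivial_syzygiesE[OF xy wc(2) wc(1)] by auto
  have "x \<otimes> u = x \<otimes> (t \<otimes> b)" "x \<otimes> v = x \<otimes> (t \<otimes> a)"
    using xw t xc c uv by (auto simp: m_ac)
  then have "u = t \<otimes> b" "v = t \<otimes> a" using cancel uv t c by auto
  then show "\<exists>w\<in>carrier R. u = w \<otimes> b \<and> v = w \<otimes> a" using t by auto
qed

end

lemma ideal_length_self: "ideal_length R K K = 0"
proof -
  have "ideal_length R K K \<le> enat 0"
    unfolding ideal_length_def chain_len_def
  proof (rule SUP_least)
    fix n assume "n \<in> {n. \<exists>H. (\<forall>i\<le>n. H i \<in> {H. ideal H R \<and> K \<subseteq> H \<and> H \<subseteq> K}) \<and>
        (\<forall>i<n. H i \<subset> H (Suc i))}"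
    then obtain H where H: "\<forall>i\<le>n. K \<subseteq> H i \<and> H i \<subseteq> K" "\<forall>i<n. H i \<subset> H (Suc i)"
      by auto
    have "n = 0"
    proof (rule ccontr)
      assume "n \<noteq> 0"
      then have "K \<subseteq> H 0" "H 1 \<subseteq> K" "H 0 \<subset> H 1" using H by auto
      then show False by blast
    qed
    then show "enat n \<le> enat 0" by simp
  qed
  then show ?thesis unfolding zero_enat_def[symmetric] by simp
qed

lemma (in cring) ideal_length_carrier_maximal:
  assumes "maximalideal M R"
  shows "ideal_length R M (carrier R) \<le> 1"
  unfolding ideal_length_def chain_len_def
proof (rule SUP_least)
  let ?F = "{H. ideal H R \<and> M \<subseteq> H \<and> H \<subseteq> carrier R}"
  fix n assume "n \<in> {n. \<exists>H. (\<forall>i\<le>n. H i \<in> ?F) \<and> (\<forall>i<n. H i \<subset> H (Suc i))}"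
  then obtain H where H: "\<And>i. i \<le> n \<Longrightarrow> H i \<in> ?F" "\<And>i. i < n \<Longrightarrow> H i \<subset> H (Suc i)" by auto
  have *: "H i = M \<or> H i = carrier R" if "i \<le> n" for i
    using maximalideal.I_maximal[OF assms] H(1)[OF that] by auto
  have "n \<le> 1"
  proof (rule ccontr)
    assume "\<not> n \<le> 1"
    then have le: "0 \<le> n" "1 \<le> n" "2 \<le> n" "0 < n" "1 < n" by auto
    have "H 0 \<subset> H 1" "H 1 \<subset> H 2" using H(2)[OF le(4)] H(2)[OF le(5)] by (simp_all add: numeral_2_eq_2)
    moreover have "M \<subseteq> H 0" "H 2 \<subseteq> carrier R" using H(1) le(1,3) by auto
    ultimately show False using *[OF le(2)] by blast
  qed
  then show "enat n \<le> 1" by (simp add: one_enat_def)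
qed

context local_ring
begin

lemma max_ideal: "ideal \<mm> R" and one_notin_max: "\<one> \<notin> \<mm>" and max_subset: "\<mm> \<subseteq> carrier R"
proof -
  interpret m: maximalideal \<mm> R by (rule maximal)
  show "ideal \<mm> R" by (rule m.is_ideal)
  show "\<one> \<notin> \<mm>" using m.one_imp_carrier m.I_notcarr by blast
  show "\<mm> \<subseteq> carrier R" by (rule m.a_subset)
qed

lemma proper_ideal_subset_max:
  assumes "ideal Q R" "\<one> \<notin> Q"
  shows "Q \<subseteq> \<mm>"
proof -
  let ?S = "{A. ideal A R \<and> Q \<subseteq> A \<and> \<one> \<notin> A}"
  have "?S \<noteq> {}" using assms by blast
  then have "\<exists>A\<in>?S. \<forall>A'\<in>?S. A \<subseteq> A' \<longrightarrow> A' = A"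
    by (rule exists_maximal_ideal_in) simp
  then obtain A where A: "A \<in> ?S" "\<forall>A'\<in>?S. A \<subseteq> A' \<longrightarrow> A' = A" by blast
  have "maximalideal A R"
  proof (rule maximalidealI)
    show "ideal A R" using A by simp
    show "carrier R \<noteq> A" using A by auto
    fix J assume J: "ideal J R" "A \<subseteq> J" "J \<subseteq> carrier R"
    show "J = A \<or> J = carrier R"
    proof (cases "\<one> \<in> J")
      case True
      then show ?thesis using ideal.one_imp_carrier[OF J(1)] by simp
    next
      case False
      then have "J \<in> ?S" using J A by auto
      then show ?thesis using A J by auto
    qed
  qed
  then have "A = \<mm>" by (rule unique_maximal)
  then show ?thesis using A by auto
qed

lemma cancel_one_minus:
  assumes "b \<in> \<mm>" "c \<in> carrier R" "z \<in> carrier R" "z = c \<otimes> b \<otimes> z"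
  shows "z = \<zero>"
proof -
  interpret m: ideal \<mm> R by (rule max_ideal)
  let ?u = "\<one> \<ominus> c \<otimes> b"
  have b: "b \<in> carrier R" using assms(1) m.Icarr by simp
  have u: "?u \<in> carrier R" using b assms by simp
  have "\<one> \<in> PIdl ?u"
  proof (rule ccontr)
    assume "\<one> \<notin> PIdl ?u"
    then have "PIdl ?u \<subseteq> \<mm>" using proper_ideal_subset_max cgenideal_ideal[OF u] by blast
    then have "?u \<in> \<mm>" using cgenideal_self[OF u] by blast
    moreover have "c \<otimes> b \<in> \<mm>" using assms m.I_l_closed by simp
    ultimately have "?u \<oplus> c \<otimes> b \<in> \<mm>" by simp
    moreover have "?u \<oplus> c \<otimes> b = \<one>" using b assms(2) by algebra
    ultimately show False using one_notin_max by simp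
  qed
  then obtain t where t: "t \<in> carrier R" "\<one> = t \<otimes> ?u" unfolding cgenideal_def by blast
  have "?u \<otimes> z = z \<ominus> c \<otimes> b \<otimes> z" using b assms(2,3) by algebra
  also have "\<dots> = \<zero>" using assms(3) unfolding assms(4)[symmetric] by simp
  finally have uz: "?u \<otimes> z = \<zero>" .
  have "z = (t \<otimes> ?u) \<otimes> z" using t(2) assms(3) by simp
  also have "\<dots> = t \<otimes> (?u \<otimes> z)" using t(1) u assms(3) by (simp add: m_assoc)
  finally show ?thesis using uz t by simp
qed

lemma nonzerodivisor_of_trivial_syzygies:
  assumes a: "a \<in> carrier R" and b: "b \<in> \<mm>" and syz: "trivial_syzygies R a b"
    and z: "z \<in> carrier R" "a \<otimes> z = \<zero>"
  shows "z = \<zero>"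
proof -
  have bc: "b \<in> carrier R" using b max_subset by auto
  let ?S = "{PIdl y | y. y \<in> carrier R \<and> a \<otimes> y = \<zero> \<and> z \<in> PIdl y}"
  have "PIdl z \<in> ?S" using z cgenideal_self by blast
  then have "?S \<noteq> {}" by blast
  then obtain A where A: "A \<in> ?S" "\<forall>Q\<in>?S. A \<subseteq> Q \<longrightarrow> Q = A"
    using exists_maximal_ideal_in[of ?S] cgenideal_ideal by blast
  then obtain y where y: "A = PIdl y" "y \<in> carrier R" "a \<otimes> y = \<zero>" "z \<in> PIdl y" by blast
  have "y \<otimes> a = \<zero> \<otimes> b" using y a bc m_comm by simp
  then obtain w where w: "w \<in> carrier R" "y = w \<otimes> b" "\<zero> = w \<otimes> a"
    using trivial_syzygiesE[OF syz y(2) zero_closed] by auto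
  have "y = b \<otimes> w" using w bc m_comm by simp
  then have "y \<in> PIdl w" unfolding cgenideal_def using bc by blast
  then have sub: "PIdl y \<subseteq> PIdl w" by (rule cgenideal_minimal[OF cgenideal_ideal[OF w(1)]])
  have "a \<otimes> w = \<zero>" using w a m_comm by simp
  then have "PIdl w \<in> ?S" using w sub y by blast
  then have "PIdl w = PIdl y" using A y sub by blast
  then obtain t where t: "t \<in> carrier R" "w = t \<otimes> y" using cgenideal_self[OF w(1)] unfolding cgenideal_def by blast
  have "w = t \<otimes> b \<otimes> w" using t w(1) bc unfolding w(2) by (metis m_comm m_assoc m_closed w(2))
  then have "w = \<zero>" using cancel_one_minus[OF b t(1) w(1)] by simp
  then have "y = \<zero> \<otimes> b" using w(2) by (rule back_subst[of "\<lambda>t. y = t \<otimes> b", rotated])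
  then have "y = \<zero>" using bc by simp
  then show ?thesis using y(4) unfolding cgenideal_def by auto
qed

lemma finite_colength:
  assumes "ideal Q R" and "\<And>x. x \<in> \<mm> \<Longrightarrow> \<exists>n::nat. x [^] n \<in> Q"
  shows "ideal_length R Q (carrier R) \<noteq> \<infinity>"
proof (rule ccontr)
  assume inf: "\<not> ?thesis"
  let ?S = "{A. ideal A R \<and> (\<forall>x\<in>\<mm>. \<exists>n::nat. x [^] n \<in> A) \<and> ideal_length R A (carrier R) = \<infinity>}"
  have "Q \<in> ?S" using assms inf by simp
  then have "?S \<noteq> {}" by blast
  then have "\<exists>A\<in>?S. \<forall>A'\<in>?S. A \<subseteq> A' \<longrightarrow> A' = A"
    by (rule exists_maximal_ideal_in) simp
  then obtain A where A: "A \<in> ?S" "\<forall>A'\<in>?S. A \<subseteq> A' \<longrightarrow> A' = A" by blast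
  have Pi: "ideal A R" using A by simp
  interpret A: ideal A R by (rule Pi)
  have "A \<noteq> carrier R"
  proof
    assume "A = carrier R"
    then show False using A by (simp add: ideal_length_self)
  qed
  then have one: "\<one> \<notin> A" using A.one_imp_carrier by blast
  let ?C = "\<lambda>z. {c \<in> carrier R. z \<otimes> c \<in> A}"
  let ?T = "?C ` {z \<in> carrier R. z \<notin> A}"
  have "?T \<noteq> {}" using one by auto
  then have "\<exists>T\<in>?T. \<forall>T'\<in>?T. T \<subseteq> T' \<longrightarrow> T' = T"
    by (rule exists_maximal_ideal_in) (auto intro!: ideal_colon[OF Pi])
  then obtain T where T: "T \<in> ?T" "\<forall>T'\<in>?T. T \<subseteq> T' \<longrightarrow> T' = T" by blast
  then obtain z where z: "z \<in> carrier R" "z \<notin> A" "T = ?C z" by blast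
  have mC: "\<mm> \<subseteq> ?C z"
  proof
    fix x assume x: "x \<in> \<mm>"
    then have xc: "x \<in> carrier R" using max_subset by auto
    obtain n0 :: nat where "x [^] n0 \<in> A" using x A by auto
    then have ex: "\<exists>n::nat. x [^] n \<otimes> z \<in> A" using z A.I_r_closed by blast
    define n where "n = (LEAST n::nat. x [^] n \<otimes> z \<in> A)"
    have n: "x [^] n \<otimes> z \<in> A" unfolding n_def using ex by (rule LeastI_ex)
    have "n \<noteq> 0" using n z by (intro notI) simp
    then obtain k where k: "n = Suc k" using not0_implies_Suc by blast
    let ?z = "x [^] k \<otimes> z"
    have zk: "?z \<notin> A" using not_less_Least[of k "\<lambda>n. x [^] n \<otimes> z \<in> A"] k n_def by auto
    have zc: "?z \<in> carrier R" using xc z by simp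
    have "?C z \<subseteq> ?C ?z"
    proof
      fix c assume c: "c \<in> ?C z"
      then have "?z \<otimes> c = x [^] k \<otimes> (z \<otimes> c)" using xc z by (simp add: m_assoc)
      then show "c \<in> ?C ?z" using c xc A.I_l_closed by auto
    qed
    then have "?C ?z = ?C z" using T(2) z(3) zk zc by blast
    moreover have "?z \<otimes> x = x [^] n \<otimes> z" using xc z k by (simp add: m_ac)
    then have "x \<in> ?C ?z" using n xc by simp
    ultimately show "x \<in> ?C z" by simp
  qed
  have Ci: "ideal (?C z) R" by (rule ideal_colon[OF Pi z(1)])
  have "\<one> \<notin> ?C z" using z by auto
  then have Cm: "?C z = \<mm>" using mC proper_ideal_subset_max[OF Ci] by blast
  let ?A = "(z <# carrier R) <+>\<^bsub>R\<^esub> A"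
  have zR: "ideal (z <# carrier R) R" by (rule ideal_l_coset[OF oneideal z(1)])
  have A': "ideal ?A R" "A \<subseteq> ?A" "z <# carrier R \<subseteq> ?A"
    using add_ideals[OF zR Pi] subset_set_add[OF zR Pi] by auto
  have "z \<otimes> \<one> \<in> z <# carrier R" unfolding l_coset_def by blast
  then have "z \<in> ?A" using A'(3) z(1) by auto
  then have ne: "?A \<noteq> A" using z by blast
  have "ideal_length R A ?A = ideal_length R (?C z) (carrier R)"
    by (rule ideal_length_mult[OF oneideal Pi z(1) Ci]) auto
  also have "\<dots> \<le> 1" unfolding Cm by (rule ideal_length_carrier_maximal[OF maximal])
  also have "\<dots> < \<infinity>" by (simp add: one_enat_def)
  finally have "ideal_length R A ?A \<noteq> \<infinity>" by simp
  moreover have "ideal_length R ?A (carrier R) \<noteq> \<infinity>"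
  proof
    assume "ideal_length R ?A (carrier R) = \<infinity>"
    then have "?A \<in> ?S" using A' A by blast
    then show False using A(2) A' ne by blast
  qed
  moreover have "ideal_length R A (carrier R) = ideal_length R A ?A + ideal_length R ?A (carrier R)"
    using ideal.axioms(1)[OF A'(1), THEN additive_subgroup.a_subset]
    by (intro ideal_length_add[OF Pi A'(1) oneideal A'(2)])
  ultimately show False using A by auto
qed

lemma exists_regular_pair:
  assumes "depth R \<mm> = 2"
  obtains x y where "x \<in> \<mm>" "y \<in> \<mm>" "\<And>z. z \<in> carrier R \<Longrightarrow> x \<otimes> z = \<zero> \<Longrightarrow> z = \<zero>"
    "trivial_syzygies R x y"
proof -
  have "\<exists>xs. regular_sequence R xs \<and> set xs \<subseteq> \<mm> \<and> 2 \<le> length xs"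
  proof (rule ccontr)
    assume no: "\<not> ?thesis"
    have "depth R \<mm> \<le> enat 1"
      unfolding depth_def
    proof (rule SUP_least)
      fix xs assume "xs \<in> {xs. regular_sequence R xs \<and> set xs \<subseteq> \<mm>}"
      then have "\<not> 2 \<le> length xs" using no by blast
      then show "enat (length xs) \<le> enat 1" by simp
    qed
    moreover have "(2::enat) = enat 2" by (simp add: numeral_eq_enat)
    ultimately show False using assms by simp
  qed
  then obtain xs where xs: "regular_sequence R xs" "set xs \<subseteq> \<mm>" "2 \<le> length xs" by blast
  define x y where "x = xs ! 0" and "y = xs ! 1"
  have xm: "x \<in> \<mm>" "y \<in> \<mm>" 
    using xs(2,3) nth_mem[of 0 xs] nth_mem[of 1 xs] unfolding x_def y_def by fastforce+
  then have xc: "x \<in> carrier R" "y \<in> carrier R" using max_subset by auto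
  have t: "take 0 xs = []" "take 1 xs = [x]"
    using xs(3) by (cases xs; simp add: x_def)+
  have "Idl {} = {\<zero>}" using genideal_zero genideal_minimal[OF zeroideal, of "{}"]
    additive_subgroup.zero_closed[OF ideal.axioms(1)[OF genideal_ideal[of "{}"]]] by auto
  then have nzd: "z = \<zero>" if "z \<in> carrier R" "x \<otimes> z = \<zero>" for z
  proof -
    have "0 < length xs" using xs(3) by linarith
    then have "\<forall>z\<in>carrier R. xs ! 0 \<otimes> z \<in> Idl (set (take 0 xs)) \<longrightarrow> z \<in> Idl (set (take 0 xs))"
      using xs(1) unfolding regular_sequence_def by blast
    then show ?thesis using that \<open>Idl {} = {\<zero>}\<close> unfolding t x_def[symmetric] by simp
  qed
  have yreg: "z \<in> PIdl x" if "z \<in> carrier R" "y \<otimes> z \<in> PIdl x" for z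
  proof -
    have "1 < length xs" using xs(3) by simp
    then have "\<forall>z\<in>carrier R. xs ! 1 \<otimes> z \<in> Idl (set (take 1 xs)) \<longrightarrow> z \<in> Idl (set (take 1 xs))"
      using xs(1) unfolding regular_sequence_def by blast
    then show ?thesis using that unfolding t y_def[symmetric] cgenideal_eq_genideal[OF xc(1)] by simp
  qed
  have "trivial_syzygies R x y"
    unfolding trivial_syzygies_def
  proof (intro ballI impI)
    fix u v assume uv: "u \<in> carrier R" "v \<in> carrier R" "u \<otimes> x = v \<otimes> y"
    then have "y \<otimes> v = u \<otimes> x" using xc m_comm by simp
    then have "y \<otimes> v \<in> PIdl x" unfolding cgenideal_def using uv by blast
    then obtain w where w: "w \<in> carrier R" "v = w \<otimes> x" using yreg uv unfolding cgenideal_def by blast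
    have "x \<otimes> (u \<ominus> w \<otimes> y) = u \<otimes> x \<ominus> (w \<otimes> x) \<otimes> y" using w(1) uv(1) xc by algebra
    also have "\<dots> = \<zero>" unfolding uv(3) w(2) using w(1) xc by algebra
    finally have "u \<ominus> w \<otimes> y = \<zero>" using nzd[of "u \<ominus> w \<otimes> y"] uv(1,2) w(1) xc by simp
    then have "u = w \<otimes> y" using uv(1,2) w(1) xc by (simp add: r_right_minus_eq)
    then show "\<exists>w\<in>carrier R. u = w \<otimes> y \<and> v = w \<otimes> x" using w by blast
  qed
  then show ?thesis using that xm nzd by blast
qed

end

section \<open>The integral closure of an ideal\<close>

lemma ideal_pow_nonpos: "r \<le> 0 \<Longrightarrow> ideal_pow R K r = carrier R"
  by (simp add: ideal_pow_def ideals_set_def nat_pow_def)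

lemma ideal_pow_Suc: "ideal_pow R K (int (Suc n)) = ideal_pow R K (int n) \<cdot>\<^bsub>R\<^esub> K"
  by (simp add: ideal_pow_def ideals_set_def nat_pow_def del: of_nat_Suc)

definition nonzerodivisor :: "('a, 'b) ring_scheme \<Rightarrow> 'a \<Rightarrow> bool" where
  "nonzerodivisor R x \<longleftrightarrow> x \<in> carrier R \<and> (\<forall>z\<in>carrier R. x \<otimes>\<^bsub>R\<^esub> z = \<zero>\<^bsub>R\<^esub> \<longrightarrow> z = \<zero>\<^bsub>R\<^esub>)"

text \<open>By Horner's rule, \<open>integral_forms R K z S d\<close> is the set of all
  \<open>s z\<^sup>d + c\<^sub>1 z\<^sup>d\<^sup>-\<^sup>1 + \<dots> + c\<^sub>d\<close> with \<open>s \<in> S\<close> and \<open>c\<^sub>i \<in> K\<^sup>i\<close>; only \<open>S = {0}\<close> and \<open>S = R\<close> are used.\<close>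

primrec integral_forms ::
    "('a, 'b) ring_scheme \<Rightarrow> 'a set \<Rightarrow> 'a \<Rightarrow> 'a set \<Rightarrow> nat \<Rightarrow> 'a set" where
  "integral_forms R K z S 0 = S"
| "integral_forms R K z S (Suc d) =
     (z <#\<^bsub>R\<^esub> integral_forms R K z S d) <+>\<^bsub>R\<^esub> ideal_pow R K (int (Suc d))"

context cring
begin

lemma nonzerodivisor_mult:
  assumes "nonzerodivisor R x" "nonzerodivisor R y"
  shows "nonzerodivisor R (x \<otimes> y)"
  unfolding nonzerodivisor_def
proof (intro conjI ballI impI)
  have c: "x \<in> carrier R" "y \<in> carrier R" using assms by (simp_all add: nonzerodivisor_def)
  then show "x \<otimes> y \<in> carrier R" by simp
  fix z assume z: "z \<in> carrier R" "x \<otimes> y \<otimes> z = \<zero>"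
  then have "x \<otimes> (y \<otimes> z) = \<zero>" using c by (simp add: m_assoc)
  then have "y \<otimes> z = \<zero>" using assms(1) c z(1) unfolding nonzerodivisor_def by blast
  then show "z = \<zero>" using assms(2) z(1) unfolding nonzerodivisor_def by blast
qed

lemma nonzerodivisor_pow: "nonzerodivisor R x \<Longrightarrow> nonzerodivisor R (x [^] (n::nat))"
proof (induction n)
  case 0
  then show ?case by (simp add: nonzerodivisor_def)
next
  case (Suc n)
  then show ?case by (simp add: nonzerodivisor_mult)
qed

lemma nonzerodivisor_cancel:
  assumes "nonzerodivisor R x" "z \<in> carrier R" "z' \<in> carrier R" "x \<otimes> z = x \<otimes> z'"
  shows "z = z'"
proof -
  have xc: "x \<in> carrier R" using assms(1) by (simp add: nonzerodivisor_def)
  have "x \<otimes> (z \<ominus> z') = x \<otimes> z \<ominus> x \<otimes> z'" using xc assms(2,3) by algebra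
  also have "\<dots> = \<zero>" unfolding assms(4) using xc assms(3) by algebra
  finally have "z \<ominus> z' = \<zero>" using assms unfolding nonzerodivisor_def by simp
  then show ?thesis using assms(2,3) by (simp add: r_right_minus_eq)
qed

lemma mem_coset_add: "x \<in> (z <# S) <+>\<^bsub>R\<^esub> T \<longleftrightarrow> (\<exists>s\<in>S. \<exists>t\<in>T. x = z \<otimes> s \<oplus> t)"
  by (auto simp: l_coset_def set_add_def')

lemma ideal_prod_least:
  assumes "ideal J R" "\<And>x y. x \<in> A \<Longrightarrow> y \<in> B \<Longrightarrow> x \<otimes> y \<in> J"
  shows "A \<cdot> B \<subseteq> J"
proof
  interpret J: ideal J R by fact
  fix s assume "s \<in> A \<cdot> B"
  then show "s \<in> J" by induction (use assms(2) in auto)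
qed

lemma ideal_prod_mono: "A \<subseteq> A' \<Longrightarrow> B \<subseteq> B' \<Longrightarrow> A \<cdot> B \<subseteq> A' \<cdot> B'"
proof
  fix s assume "A \<subseteq> A'" "B \<subseteq> B'" "s \<in> A \<cdot> B"
  from this(3,1,2) show "s \<in> A' \<cdot> B'" by induction (auto intro: ideal_prod.intros)
qed

lemma ideal_ideal_pow:
  assumes "ideal K R"
  shows "ideal (ideal_pow R K r) R"
proof -
  interpret M: comm_monoid "ideals_set R" by (rule ideals_set_is_comm_monoid)
  have "K \<in> carrier (ideals_set R)" using assms by (simp add: ideals_set_def)
  then have "ideal_pow R K r \<in> carrier (ideals_set R)" unfolding ideal_pow_def by simp
  then show ?thesis by (simp add: ideals_set_def)
qed

lemma ideal_pow_prod:
  assumes "ideal K R"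
  shows "ideal_pow R K (int m) \<cdot> ideal_pow R K (int n) = ideal_pow R K (int (m + n))"
proof -
  interpret M: comm_monoid "ideals_set R" by (rule ideals_set_is_comm_monoid)
  have "K \<in> carrier (ideals_set R)" using assms by (simp add: ideals_set_def)
  then have "K [^]\<^bsub>ideals_set R\<^esub> m \<otimes>\<^bsub>ideals_set R\<^esub> K [^]\<^bsub>ideals_set R\<^esub> n = K [^]\<^bsub>ideals_set R\<^esub> (m + n)"
    by (rule M.nat_pow_mult)
  then show ?thesis by (simp add: ideal_pow_def ideals_set_def del: of_nat_add)
qed

lemma ideal_prod_pow_distrib:
  assumes "ideal K R" "ideal L R"
  shows "ideal_pow R (K \<cdot> L) r = ideal_pow R K r \<cdot> ideal_pow R L r"
proof -
  interpret M: comm_monoid "ideals_set R" by (rule ideals_set_is_comm_monoid)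
  have "K \<in> carrier (ideals_set R)" "L \<in> carrier (ideals_set R)"
    using assms by (simp_all add: ideals_set_def)
  then have "(K \<otimes>\<^bsub>ideals_set R\<^esub> L) [^]\<^bsub>ideals_set R\<^esub> nat r =
      K [^]\<^bsub>ideals_set R\<^esub> nat r \<otimes>\<^bsub>ideals_set R\<^esub> L [^]\<^bsub>ideals_set R\<^esub> nat r"
    by (rule M.nat_pow_distrib)
  then show ?thesis by (simp add: ideal_pow_def ideals_set_def)
qed

lemma ideal_pow_one:
  assumes "ideal K R"
  shows "ideal_pow R K 1 = K"
proof -
  interpret M: comm_monoid "ideals_set R" by (rule ideals_set_is_comm_monoid)
  have "K \<in> carrier (ideals_set R)" using assms by (simp add: ideals_set_def)
  then show ?thesis by (simp add: ideal_pow_def)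
qed

lemma ideal_pow_pow:
  assumes "ideal K R" "x \<in> K"
  shows "x [^] (n::nat) \<in> ideal_pow R K (int n)"
proof (induction n)
  case 0
  then show ?case by (simp add: ideal_pow_nonpos)
next
  case (Suc n)
  then show ?case unfolding ideal_pow_Suc using assms(2) by (auto intro: ideal_prod.prod)
qed

lemma ideal_integral_forms:
  assumes "ideal K R" "ideal S R" "z \<in> carrier R"
  shows "ideal (integral_forms R K z S d) R"
proof (induction d)
  case (Suc d)
  then show ?case
    unfolding integral_forms.simps
    by (intro add_ideals ideal_l_coset[OF _ assms(3)] ideal_ideal_pow[OF assms(1)])
qed (simp add: assms)

lemma integral_forms_zero_iff:
  assumes K: "ideal K R" and z: "z \<in> carrier R"
  shows "x \<in> integral_forms R K z {\<zero>} d \<longleftrightarrow> (\<exists>c. (\<forall>i\<in>{1..d}. c i \<in> ideal_pow R K (int i)) \<and>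
    x = (\<Oplus>i\<in>{1..d}. c i \<otimes> z [^] (d - i)))"
proof (induction d arbitrary: x)
  case 0
  then show ?case by simp
next
  case (Suc d)
  have pc: "ideal_pow R K r \<subseteq> carrier R" for r
    by (rule subsetI) (rule ideal.Icarr[OF ideal_ideal_pow[OF K]])
  have step: "z \<otimes> (\<Oplus>i\<in>{1..d}. c i \<otimes> z [^] (d - i)) \<oplus> c (Suc d) =
      (\<Oplus>i\<in>{1..Suc d}. c i \<otimes> z [^] (Suc d - i))"
    if c: "\<forall>i\<in>{1..Suc d}. c i \<in> ideal_pow R K (int i)" for c
  proof -
    have cc: "c i \<in> carrier R" if "i \<in> {1..Suc d}" for i using c pc that by blast
    have "z \<otimes> (\<Oplus>i\<in>{1..d}. c i \<otimes> z [^] (d - i)) = (\<Oplus>i\<in>{1..d}. z \<otimes> (c i \<otimes> z [^] (d - i)))"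
      using cc z by (intro finsum_rdistr) auto
    also have "\<dots> = (\<Oplus>i\<in>{1..d}. c i \<otimes> z [^] (Suc d - i))"
    proof (rule finsum_cong')
      fix i assume i: "i \<in> {1..d}"
      then have "Suc d - i = Suc (d - i)" by auto
      then show "z \<otimes> (c i \<otimes> z [^] (d - i)) = c i \<otimes> z [^] (Suc d - i)"
        using cc[of i] i z by (simp add: m_ac)
    qed (use cc z in auto)
    finally have "z \<otimes> (\<Oplus>i\<in>{1..d}. c i \<otimes> z [^] (d - i)) = (\<Oplus>i\<in>{1..d}. c i \<otimes> z [^] (Suc d - i))" .
    moreover have "{1..Suc d} = insert (Suc d) {1..d}" by auto
    moreover have "(\<Oplus>i\<in>insert (Suc d) {1..d}. c i \<otimes> z [^] (Suc d - i)) =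
        c (Suc d) \<otimes> z [^] (Suc d - Suc d) \<oplus> (\<Oplus>i\<in>{1..d}. c i \<otimes> z [^] (Suc d - i))"
      using cc z by (intro finsum_insert) auto
    moreover have "(\<Oplus>i\<in>{1..d}. c i \<otimes> z [^] (Suc d - i)) \<in> carrier R"
      using cc z by (intro finsum_closed) auto
    ultimately show ?thesis using cc[of "Suc d"] by (simp add: a_comm)
  qed
  show ?case
  proof
    assume "x \<in> integral_forms R K z {\<zero>} (Suc d)"
    then obtain e t where e: "e \<in> integral_forms R K z {\<zero>} d" "t \<in> ideal_pow R K (int (Suc d))"
      "x = z \<otimes> e \<oplus> t" by (auto simp: mem_coset_add simp del: of_nat_Suc)
    obtain c where c: "\<forall>i\<in>{1..d}. c i \<in> ideal_pow R K (int i)" "e = (\<Oplus>i\<in>{1..d}. c i \<otimes> z [^] (d - i))"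
      using Suc e(1) by blast
    let ?c = "c(Suc d := t)"
    have c': "\<forall>i\<in>{1..Suc d}. ?c i \<in> ideal_pow R K (int i)" using c(1) e(2) by auto
    have "(\<Oplus>i\<in>{1..d}. ?c i \<otimes> z [^] (d - i)) = e"
      unfolding c(2) using c(1) pc z by (intro finsum_cong') auto
    then have "x = (\<Oplus>i\<in>{1..Suc d}. ?c i \<otimes> z [^] (Suc d - i))"
      using step[OF c'] e(3) by simp
    then show "\<exists>c. (\<forall>i\<in>{1..Suc d}. c i \<in> ideal_pow R K (int i)) \<and>
        x = (\<Oplus>i\<in>{1..Suc d}. c i \<otimes> z [^] (Suc d - i))" using c' by blast
  next
    assume "\<exists>c. (\<forall>i\<in>{1..Suc d}. c i \<in> ideal_pow R K (int i)) \<and>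
        x = (\<Oplus>i\<in>{1..Suc d}. c i \<otimes> z [^] (Suc d - i))"
    then obtain c where c: "\<forall>i\<in>{1..Suc d}. c i \<in> ideal_pow R K (int i)"
      "x = (\<Oplus>i\<in>{1..Suc d}. c i \<otimes> z [^] (Suc d - i))" by blast
    have "(\<Oplus>i\<in>{1..d}. c i \<otimes> z [^] (d - i)) \<in> integral_forms R K z {\<zero>} d"
      using Suc c(1) by (auto intro!: exI[of _ c])
    moreover have "c (Suc d) \<in> ideal_pow R K (int (Suc d))" using c(1) by (rule bspec) simp
    ultimately show "x \<in> integral_forms R K z {\<zero>} (Suc d)"
      unfolding integral_forms.simps mem_coset_add c(2) step[OF c(1), symmetric] by blast
  qed
qed

lemma integral_closure_iff:
  assumes K: "ideal K R"
  shows "z \<in> integral_closure R K \<longleftrightarrow>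
    z \<in> carrier R \<and> (\<exists>n\<ge>1. z [^] n \<in> integral_forms R K z {\<zero>} n)"
proof -
  have "(\<exists>c. (\<forall>i\<in>{1..n}. c i \<in> ideal_pow R K (int i)) \<and>
      z [^] n \<oplus> (\<Oplus>i\<in>{1..n}. c i \<otimes> z [^] (n - i)) = \<zero>) \<longleftrightarrow> z [^] n \<in> integral_forms R K z {\<zero>} n"
    if z: "z \<in> carrier R" for n
  proof -
    interpret E: ideal "integral_forms R K z {\<zero>} n" R
      by (rule ideal_integral_forms[OF K zeroideal z])
    have neg: "x = \<ominus> y" if "y \<oplus> x = \<zero>" "x \<in> carrier R" "y \<in> carrier R" for x y
      using that minus_equality[of x y] a_comm by simp
    have "(\<exists>c. (\<forall>i\<in>{1..n}. c i \<in> ideal_pow R K (int i)) \<and>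
      z [^] n \<oplus> (\<Oplus>i\<in>{1..n}. c i \<otimes> z [^] (n - i)) = \<zero>) \<longleftrightarrow>
      (\<exists>e\<in>integral_forms R K z {\<zero>} n. z [^] n \<oplus> e = \<zero>)"
      unfolding Bex_def integral_forms_zero_iff[OF K z] by auto
    also have "\<dots> \<longleftrightarrow> z [^] n \<in> integral_forms R K z {\<zero>} n"
    proof
      assume "\<exists>e\<in>integral_forms R K z {\<zero>} n. z [^] n \<oplus> e = \<zero>"
      then obtain e where e: "e \<in> integral_forms R K z {\<zero>} n" "z [^] n \<oplus> e = \<zero>" by blast
      then have "z [^] n = \<ominus> e" using neg[of e "z [^] n"] z E.Icarr a_comm by simp
      then show "z [^] n \<in> integral_forms R K z {\<zero>} n" using e by simp
    next
      assume "z [^] n \<in> integral_forms R K z {\<zero>} n"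
      then have "\<ominus> (z [^] n) \<in> integral_forms R K z {\<zero>} n" by simp
      then show "\<exists>e\<in>integral_forms R K z {\<zero>} n. z [^] n \<oplus> e = \<zero>" using z r_neg by blast
    qed
    finally show ?thesis .
  qed
  then show ?thesis unfolding integral_closure_def by auto
qed

lemma subset_integral_closure:
  assumes K: "ideal K R"
  shows "K \<subseteq> integral_closure R K"
proof
  interpret K: ideal K R by fact
  fix x assume x: "x \<in> K"
  then have xc: "x \<in> carrier R" by (rule K.Icarr)
  have "x [^] (1::nat) \<in> integral_forms R K x {\<zero>} 1"
    using x xc ideal_pow_one[OF K] by (simp add: mem_coset_add)
  then show "x \<in> integral_closure R K"
    unfolding integral_closure_iff[OF K] using xc by blast
qed

lemma integral_closure_subset_carrier: "integral_closure R K \<subseteq> carrier R"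
  by (auto simp: integral_closure_def)

lemma integral_closure_mono:
  assumes "ideal K R" "ideal L R" "K \<subseteq> L"
  shows "integral_closure R K \<subseteq> integral_closure R L"
proof -
  have "ideal_pow R K (int i) \<subseteq> ideal_pow R L (int i)" for i
  proof (induction i)
    case 0
    then show ?case by (simp add: ideal_pow_nonpos)
  next
    case (Suc i)
    then show ?case unfolding ideal_pow_Suc by (rule ideal_prod_mono[OF _ assms(3)])
  qed
  then show ?thesis unfolding integral_closure_def by blast
qed

lemma integral_forms_mult_left:
  assumes K: "ideal K R" and S: "ideal S R" and z: "z \<in> carrier R"
    and "e \<in> integral_forms R K z S d"
  shows "z \<otimes> e \<in> integral_forms R K z S (Suc d)"
proof -
  interpret E: ideal "integral_forms R K z S d" R by (rule ideal_integral_forms[OF K S z])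
  interpret L: ideal "ideal_pow R K (int (Suc d))" R by (rule ideal_ideal_pow[OF K])
  have "z \<otimes> e = z \<otimes> e \<oplus> \<zero>" using E.Icarr[OF assms(4)] z by simp
  then show ?thesis
    unfolding integral_forms.simps mem_coset_add using assms(4) L.zero_closed by blast
qed

lemma integral_forms_pow_mult:
  assumes K: "ideal K R" and S: "ideal S R" and z: "z \<in> carrier R"
    and "e \<in> integral_forms R K z S d"
  shows "z [^] n \<otimes> e \<in> integral_forms R K z S (n + d)"
proof (induction n)
  case 0
  then show ?case using assms ideal.Icarr[OF ideal_integral_forms[OF K S z]] by simp
next
  case (Suc n)
  have "z [^] Suc n \<otimes> e = z \<otimes> (z [^] n \<otimes> e)"
    using z assms(4) ideal.Icarr[OF ideal_integral_forms[OF K S z]] by (simp add: m_ac)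
  then show ?case using integral_forms_mult_left[OF K S z Suc] by (simp only: add_Suc)
qed

lemma ideal_pow_subset_integral_forms:
  assumes K: "ideal K R" and S: "ideal S R" and z: "z \<in> carrier R"
  shows "ideal_pow R K (int (Suc d)) \<subseteq> integral_forms R K z S (Suc d)"
  using subset_set_add(2)[OF ideal_l_coset[OF ideal_integral_forms[OF K S z] z]
      ideal_ideal_pow[OF K]] by simp

lemma integral_forms_ideal_pow_mult:
  assumes K: "ideal K R" and z: "z \<in> carrier R"
    and "e \<in> integral_forms R K z {\<zero>} d" "k \<in> ideal_pow R K (int i)"
  shows "e \<otimes> k \<in> integral_forms R K z {\<zero>} (d + i)"
  using assms(3)
proof (induction d arbitrary: e)
  case 0
  then show ?case
    using additive_subgroup.zero_closed[OF ideal.axioms(1)[OF ideal_integral_forms[OF K zeroideal z]]]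
      ideal.Icarr[OF ideal_ideal_pow[OF K] assms(4)] by simp
next
  case (Suc d)
  interpret E: ideal "integral_forms R K z {\<zero>} l" R for l
    by (rule ideal_integral_forms[OF K zeroideal z])
  interpret L: ideal "ideal_pow R K r" R for r by (rule ideal_ideal_pow[OF K])
  obtain f t where f: "f \<in> integral_forms R K z {\<zero>} d" "t \<in> ideal_pow R K (int (Suc d))"
    "e = z \<otimes> f \<oplus> t" using Suc.prems by (auto simp: mem_coset_add simp del: of_nat_Suc)
  have "e \<otimes> k = z \<otimes> (f \<otimes> k) \<oplus> t \<otimes> k"
    using f z E.Icarr L.Icarr assms(4) by (simp add: l_distr m_assoc del: of_nat_Suc)
  moreover have "z \<otimes> (f \<otimes> k) \<in> integral_forms R K z {\<zero>} (Suc d + i)"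
    using integral_forms_mult_left[OF K zeroideal z Suc.IH[OF f(1)]] by (simp only: add_Suc)
  moreover have "t \<otimes> k \<in> integral_forms R K z {\<zero>} (Suc d + i)"
  proof -
    have "t \<otimes> k \<in> ideal_pow R K (int (Suc d + i))"
      using f(2) assms(4) unfolding ideal_pow_prod[OF K, symmetric] by (rule ideal_prod.prod)
    then show ?thesis using ideal_pow_subset_integral_forms[OF K zeroideal z, of "d + i"] by auto
  qed
  ultimately show ?case by (simp only: E.a_closed)
qed

lemma integral_forms_mult:
  assumes K: "ideal K R" and z: "z \<in> carrier R"
    and "e \<in> integral_forms R K z {\<zero>} d" "f \<in> integral_forms R K z {\<zero>} n"
  shows "e \<otimes> f \<in> integral_forms R K z {\<zero>} (d + n)"
  using assms(3)
proof (induction d arbitrary: e)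
  case 0
  then show ?case
    using additive_subgroup.zero_closed[OF ideal.axioms(1)[OF ideal_integral_forms[OF K zeroideal z]]]
      ideal.Icarr[OF ideal_integral_forms[OF K zeroideal z] assms(4)] by simp
next
  case (Suc d)
  interpret E: ideal "integral_forms R K z {\<zero>} l" R for l
    by (rule ideal_integral_forms[OF K zeroideal z])
  interpret L: ideal "ideal_pow R K r" R for r by (rule ideal_ideal_pow[OF K])
  obtain g t where g: "g \<in> integral_forms R K z {\<zero>} d" "t \<in> ideal_pow R K (int (Suc d))"
    "e = z \<otimes> g \<oplus> t" using Suc.prems by (auto simp: mem_coset_add simp del: of_nat_Suc)
  have "e \<otimes> f = z \<otimes> (g \<otimes> f) \<oplus> f \<otimes> t"
    using g z E.Icarr L.Icarr assms(4) by (simp add: l_distr m_assoc m_comm[of f] del: of_nat_Suc)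
  moreover have "z \<otimes> (g \<otimes> f) \<in> integral_forms R K z {\<zero>} (Suc d + n)"
    using integral_forms_mult_left[OF K zeroideal z Suc.IH[OF g(1)]] by (simp only: add_Suc)
  moreover have "f \<otimes> t \<in> integral_forms R K z {\<zero>} (Suc d + n)"
    using integral_forms_ideal_pow_mult[OF K z assms(4) g(2)] by (simp only: add.commute)
  ultimately show ?case by (simp only: E.a_closed)
qed

definition monic_forms :: "'a set \<Rightarrow> 'a \<Rightarrow> nat \<Rightarrow> 'a set" where
  "monic_forms K z d = {z [^] d \<oplus> e | e. e \<in> integral_forms R K z {\<zero>} d}"

lemma monic_formsE:
  assumes "u \<in> monic_forms K z d"
  obtains e where "u = z [^] d \<oplus> e" "e \<in> integral_forms R K z {\<zero>} d"
  using assms unfolding monic_forms_def by blast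

lemma monic_forms_mult_integral_forms:
  assumes K: "ideal K R" and z: "z \<in> carrier R"
    and "u \<in> monic_forms K z d" "f \<in> integral_forms R K z {\<zero>} n"
  shows "u \<otimes> f \<in> integral_forms R K z {\<zero>} (d + n)"
proof -
  interpret E: ideal "integral_forms R K z {\<zero>} l" R for l
    by (rule ideal_integral_forms[OF K zeroideal z])
  obtain e where e: "u = z [^] d \<oplus> e" "e \<in> integral_forms R K z {\<zero>} d"
    using assms(3) by (rule monic_formsE)
  have "u \<otimes> f = z [^] d \<otimes> f \<oplus> e \<otimes> f" using e z E.Icarr assms(4) by (simp add: l_distr)
  then show ?thesis
    using integral_forms_pow_mult[OF K zeroideal z assms(4)] integral_forms_mult[OF K z e(2) assms(4)]
    by simp
qed

lemma monic_forms_carrier: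
  assumes "ideal K R" "z \<in> carrier R" "u \<in> monic_forms K z d"
  shows "u \<in> carrier R"
proof -
  obtain e where "u = z [^] d \<oplus> e" "e \<in> integral_forms R K z {\<zero>} d"
    using assms(3) by (rule monic_formsE)
  then show ?thesis
    using assms(2) ideal.Icarr[OF ideal_integral_forms[OF assms(1) zeroideal assms(2)]] by simp
qed

lemma monic_forms_add:
  assumes K: "ideal K R" and z: "z \<in> carrier R"
    and "u \<in> monic_forms K z d" "f \<in> integral_forms R K z {\<zero>} d"
  shows "u \<oplus> f \<in> monic_forms K z d"
proof -
  interpret E: ideal "integral_forms R K z {\<zero>} d" R
    by (rule ideal_integral_forms[OF K zeroideal z])
  obtain e where e: "u = z [^] d \<oplus> e" "e \<in> integral_forms R K z {\<zero>} d"
    using assms(3) by (rule monic_formsE)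
  then have "u \<oplus> f = z [^] d \<oplus> (e \<oplus> f)" using z E.Icarr assms(4) by (simp add: a_assoc)
  then show ?thesis using e assms(4) unfolding monic_forms_def by blast
qed

lemma monic_forms_mult:
  assumes K: "ideal K R" and z: "z \<in> carrier R"
    and "u \<in> monic_forms K z d" "v \<in> monic_forms K z n"
  shows "u \<otimes> v \<in> monic_forms K z (d + n)"
proof -
  interpret E: ideal "integral_forms R K z {\<zero>} l" R for l
    by (rule ideal_integral_forms[OF K zeroideal z])
  obtain e where e: "u = z [^] d \<oplus> e" "e \<in> integral_forms R K z {\<zero>} d"
    using assms(3) by (rule monic_formsE)
  obtain f where f: "v = z [^] n \<oplus> f" "f \<in> integral_forms R K z {\<zero>} n"
    using assms(4) by (rule monic_formsE)
  have c: "u \<in> carrier R" "e \<in> carrier R" "f \<in> carrier R"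
    using monic_forms_carrier[OF K z assms(3)] e f E.Icarr by auto
  have "u \<otimes> v = u \<otimes> z [^] n \<oplus> u \<otimes> f" using f(1) c z by (simp add: r_distr)
  also have "u \<otimes> z [^] n = z [^] (d + n) \<oplus> z [^] n \<otimes> e"
    using nat_pow_mult[OF z, of d n] c(2) z unfolding e(1) by (simp add: l_distr m_comm[of e])
  finally have eq: "u \<otimes> v = z [^] (d + n) \<oplus> z [^] n \<otimes> e \<oplus> u \<otimes> f" .
  have "z [^] n \<otimes> e \<in> integral_forms R K z {\<zero>} (d + n)"
    using integral_forms_pow_mult[OF K zeroideal z e(2), of n] by (simp only: add.commute)
  then have "z [^] (d + n) \<oplus> z [^] n \<otimes> e \<in> monic_forms K z (d + n)"
    unfolding monic_forms_def by blast
  then show ?thesis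
    unfolding eq by (rule monic_forms_add[OF K z _ monic_forms_mult_integral_forms[OF K z assms(3) f(2)]])
qed

text \<open>This replaces the determinant in the determinant trick by fraction-free Gaussian elimination.\<close>

lemma monic_form_annihilates:
  fixes m :: nat
  assumes K: "ideal K R" and z: "z \<in> carrier R"
    and "d \<ge> 1" "\<And>j. j < m \<Longrightarrow> w j \<in> carrier R"
    and "\<And>i. i < m \<Longrightarrow> D i i \<in> monic_forms K z d"
    and "\<And>i j. i < m \<Longrightarrow> j < m \<Longrightarrow> i \<noteq> j \<Longrightarrow> D i j \<in> integral_forms R K z {\<zero>} d"
    and "\<And>i. i < m \<Longrightarrow> (\<Oplus>j\<in>{..<m}. D i j \<otimes> w j) = \<zero>"
  shows "\<exists>n\<ge>1. \<exists>u\<in>monic_forms K z n. \<forall>j<m. u \<otimes> w j = \<zero>"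
  using assms(3-)
proof (induction m arbitrary: d D)
  case 0
  interpret E: ideal "integral_forms R K z {\<zero>} 1" R
    by (rule ideal_integral_forms[OF K zeroideal z])
  have "z [^] (1::nat) \<oplus> \<zero> \<in> monic_forms K z 1" unfolding monic_forms_def using E.zero_closed by blast
  then show ?case by (intro exI[of _ 1] conjI bexI[of _ "z [^] (1::nat) \<oplus> \<zero>"]) auto
next
  case (Suc m)
  interpret E: ideal "integral_forms R K z {\<zero>} l" R for l
    by (rule ideal_integral_forms[OF K zeroideal z])
  have wc: "w j \<in> carrier R" if "j \<le> m" for j using Suc.prems(2) that by simp
  have Dc: "D i j \<in> carrier R" if "i \<le> m" "j \<le> m" for i j
    using Suc.prems(3)[of i] Suc.prems(4)[of i j] monic_forms_carrier[OF K z] E.Icarr that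
    by (cases "i = j") auto
  let ?s = "\<lambda>i. \<Oplus>j\<in>{..<m}. D i j \<otimes> w j"
  have sc: "?s i \<in> carrier R" if "i \<le> m" for i
    using Dc wc that by (intro finsum_closed) auto
  have row: "D i m \<otimes> w m \<oplus> ?s i = \<zero>" if "i \<le> m" for i
  proof -
    have "(\<Oplus>j\<in>insert m {..<m}. D i j \<otimes> w j) = D i m \<otimes> w m \<oplus> ?s i"
      using Dc wc that by (intro finsum_insert) auto
    then show ?thesis using Suc.prems(5)[of i] that by (simp add: lessThan_Suc)
  qed
  have elim: "a \<otimes> s \<oplus> (\<ominus> b) \<otimes> t = a \<otimes> (b \<otimes> v \<oplus> s) \<ominus> b \<otimes> (a \<otimes> v \<oplus> t)"
    if "a \<in> carrier R" "b \<in> carrier R" "v \<in> carrier R" "s \<in> carrier R" "t \<in> carrier R" for a b v s t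
    using that by algebra
  let ?D = "\<lambda>i j. D m m \<otimes> D i j \<oplus> (\<ominus> D i m) \<otimes> D m j"
  have "\<exists>n\<ge>1. \<exists>u\<in>monic_forms K z n. \<forall>j<m. u \<otimes> w j = \<zero>"
  proof (rule Suc.IH[of "d + d" ?D])
    show "1 \<le> d + d" using Suc.prems(1) by simp
    show "w j \<in> carrier R" if "j < m" for j using wc that by simp
    have E1: "(\<ominus> D i m) \<otimes> D m j \<in> integral_forms R K z {\<zero>} (d + d)" if "i < m" "j < m" for i j
      using Suc.prems(4)[of i m] Suc.prems(4)[of m j] that by (intro integral_forms_mult[OF K z]) auto
    show "?D i i \<in> monic_forms K z (d + d)" if "i < m" for i
      using Suc.prems(3) that by (intro monic_forms_add[OF K z monic_forms_mult[OF K z] E1]) auto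
    show "?D i j \<in> integral_forms R K z {\<zero>} (d + d)" if "i < m" "j < m" "i \<noteq> j" for i j
      using Suc.prems(3)[of m] Suc.prems(4)[of i j] that
      by (intro E.a_closed monic_forms_mult_integral_forms[OF K z] E1) auto
    show "(\<Oplus>j\<in>{..<m}. ?D i j \<otimes> w j) = \<zero>" if i: "i < m" for i
    proof -
      have "(\<Oplus>j\<in>{..<m}. ?D i j \<otimes> w j) =
          (\<Oplus>j\<in>{..<m}. D m m \<otimes> (D i j \<otimes> w j) \<oplus> (\<ominus> D i m) \<otimes> (D m j \<otimes> w j))"
        using Dc wc i by (intro finsum_cong') (auto simp: l_distr m_assoc)
      also have "\<dots> = (\<Oplus>j\<in>{..<m}. D m m \<otimes> (D i j \<otimes> w j)) \<oplus>
          (\<Oplus>j\<in>{..<m}. (\<ominus> D i m) \<otimes> (D m j \<otimes> w j))"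
        using Dc wc i by (intro finsum_addf) auto
      also have "(\<Oplus>j\<in>{..<m}. D m m \<otimes> (D i j \<otimes> w j)) = D m m \<otimes> ?s i"
        using Dc wc i by (intro finsum_rdistr[symmetric]) auto
      also have "(\<Oplus>j\<in>{..<m}. (\<ominus> D i m) \<otimes> (D m j \<otimes> w j)) = (\<ominus> D i m) \<otimes> ?s m"
        using Dc wc i by (intro finsum_rdistr[symmetric]) auto
      also have "D m m \<otimes> ?s i \<oplus> (\<ominus> D i m) \<otimes> ?s m =
          D m m \<otimes> (D i m \<otimes> w m \<oplus> ?s i) \<ominus> D i m \<otimes> (D m m \<otimes> w m \<oplus> ?s m)"
        using elim[of "D m m" "D i m" "w m" "?s i" "?s m"] Dc wc sc i by simp
      also have "\<dots> = \<zero>" using row[of i] row[of m] i Dc by (simp add: a_minus_def)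
      finally show ?thesis .
    qed
  qed
  then obtain n u where n: "n \<ge> 1" and u: "u \<in> monic_forms K z n" "\<forall>j<m. u \<otimes> w j = \<zero>" by blast
  have uc: "u \<in> carrier R" by (rule monic_forms_carrier[OF K z u(1)])
  have mm: "D m m \<in> carrier R" using Dc by simp
  have us: "u \<otimes> ?s m = \<zero>"
  proof -
    have "u \<otimes> ?s m = (\<Oplus>j\<in>{..<m}. u \<otimes> (D m j \<otimes> w j))"
      using Dc wc uc by (intro finsum_rdistr) auto
    also have "\<dots> = (\<Oplus>j\<in>{..<m}. \<zero>)"
    proof (rule finsum_cong')
      fix j assume j: "j \<in> {..<m}"
      then have "u \<otimes> (D m j \<otimes> w j) = D m j \<otimes> (u \<otimes> w j)" using Dc wc uc by (simp add: m_lcomm)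
      also have "\<dots> = \<zero>" using u j Dc by simp
      finally show "u \<otimes> (D m j \<otimes> w j) = \<zero>" .
    qed auto
    also have "\<dots> = \<zero>" by simp
    finally show ?thesis .
  qed
  have elim2: "(a \<otimes> b) \<otimes> v = a \<otimes> (b \<otimes> v \<oplus> t) \<ominus> a \<otimes> t"
    if "a \<in> carrier R" "b \<in> carrier R" "v \<in> carrier R" "t \<in> carrier R" for a b v t
    using that by algebra
  have "\<forall>j<Suc m. (u \<otimes> D m m) \<otimes> w j = \<zero>"
  proof (intro allI impI)
    fix j assume "j < Suc m"
    then consider "j < m" | "j = m" by linarith
    then show "(u \<otimes> D m m) \<otimes> w j = \<zero>"
    proof cases
      case 1
      then have "(u \<otimes> D m m) \<otimes> w j = D m m \<otimes> (u \<otimes> w j)" using uc mm wc by (simp add: m_ac)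
      then show ?thesis using 1 u mm by simp
    next
      case 2
      have "(u \<otimes> D m m) \<otimes> w m = u \<otimes> (D m m \<otimes> w m \<oplus> ?s m) \<ominus> u \<otimes> ?s m"
        using elim2[OF uc mm wc[of m] sc[of m]] by simp
      then show ?thesis using row[of m] us uc 2 by (simp add: a_minus_def)
    qed
  qed
  moreover have "u \<otimes> D m m \<in> monic_forms K z (n + d)"
    using monic_forms_mult[OF K z u(1) Suc.prems(3)[of m]] by simp
  moreover have "n + d \<ge> 1" using n by simp
  ultimately show ?case by blast
qed


lemma ideal_combinations:
  fixes m :: nat
  assumes K: "ideal K R" and w: "\<And>j. j < m \<Longrightarrow> w j \<in> carrier R"
  shows "ideal {x. \<exists>k. (\<forall>j<m. k j \<in> K) \<and> x = (\<Oplus>j\<in>{..<m}. k j \<otimes> w j)} R" (is "ideal ?S R")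
proof -
  interpret K: ideal K R by fact
  have closed: "(\<Oplus>j\<in>{..<m}. k j \<otimes> w j) \<in> carrier R" if "\<forall>j<m. k j \<in> K" for k
    using that w K.Icarr by (intro finsum_closed) auto
  have mult: "c \<otimes> x \<in> ?S" if c: "c \<in> carrier R" and x: "x \<in> ?S" for c x
  proof -
    obtain k where k: "\<forall>j<m. k j \<in> K" "x = (\<Oplus>j\<in>{..<m}. k j \<otimes> w j)" using x by blast
    have "c \<otimes> x = (\<Oplus>j\<in>{..<m}. c \<otimes> (k j \<otimes> w j))"
      unfolding k(2) using c k(1) w K.Icarr by (intro finsum_rdistr) auto
    also have "\<dots> = (\<Oplus>j\<in>{..<m}. (c \<otimes> k j) \<otimes> w j)"
      using c k(1) w K.Icarr by (intro finsum_cong') (auto simp: m_assoc)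
    finally show ?thesis using k(1) c K.I_l_closed by (intro CollectI exI[of _ "\<lambda>j. c \<otimes> k j"]) auto
  qed
  have car: "?S \<subseteq> carrier R" using closed by blast
  show ?thesis
  proof (rule idealI[OF ring_axioms])
    show "subgroup ?S (add_monoid R)"
    proof (rule add.subgroupI)
      have "(\<Oplus>j\<in>{..<m}. \<zero> \<otimes> w j) \<in> ?S"
        by (intro CollectI exI[of _ "\<lambda>j. \<zero>"]) auto
      then show "?S \<noteq> {}" by blast
      show "\<ominus> x \<in> ?S" if x: "x \<in> ?S" for x
      proof -
        have "x \<in> carrier R" using x car by (rule rev_subsetD)
        then have "\<ominus> x = (\<ominus> \<one>) \<otimes> x" by (simp add: l_minus)
        then show ?thesis using mult[OF _ x, of "\<ominus> \<one>"] by simp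
      qed
      show "x \<oplus> y \<in> ?S" if x: "x \<in> ?S" and y: "y \<in> ?S" for x y
      proof -
        obtain k where k: "\<forall>j<m. k j \<in> K" "x = (\<Oplus>j\<in>{..<m}. k j \<otimes> w j)" using x by blast
        obtain l where l: "\<forall>j<m. l j \<in> K" "y = (\<Oplus>j\<in>{..<m}. l j \<otimes> w j)" using y by blast
        have "x \<oplus> y = (\<Oplus>j\<in>{..<m}. k j \<otimes> w j \<oplus> l j \<otimes> w j)"
          unfolding k(2) l(2) using k(1) l(1) w K.Icarr by (intro finsum_addf[symmetric]) auto
        also have "\<dots> = (\<Oplus>j\<in>{..<m}. (k j \<oplus> l j) \<otimes> w j)"
          using k(1) l(1) w K.Icarr by (intro finsum_cong') (auto simp: l_distr)
        finally show ?thesis using k(1) l(1) by (intro CollectI exI[of _ "\<lambda>j. k j \<oplus> l j"]) auto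
      qed
    qed (rule car)
    fix x c assume x: "x \<in> ?S" and c: "c \<in> carrier R"
    show "c \<otimes> x \<in> ?S" by (rule mult[OF c x])
    have "x \<otimes> c = c \<otimes> x" using rev_subsetD[OF x car] c by (rule m_comm)
    then show "x \<otimes> c \<in> ?S" using mult[OF c x] by simp
  qed
qed

end

lemma (in noetherian_ring) exists_generators:
  assumes "ideal M R"
  obtains m :: nat and w where "\<forall>j<m. w j \<in> M" "M = Idl (w ` {..<m})"
proof -
  obtain A where A: "A \<subseteq> carrier R" "finite A" "M = Idl A"
    using finetely_gen[OF assms] by blast
  obtain n :: nat and f where f: "A = f ` {i. i < n}" "inj_on f {i. i < n}"
    using finite_imp_nat_seg_image_inj_on[OF A(2)] by blast
  have "A \<subseteq> M" unfolding A(3) by (rule genideal_self[OF A(1)])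
  then show ?thesis
    using that[of n f] f(1) A(3) by (auto simp: lessThan_def)
qed

locale noetherian_cring = noetherian_ring R + cring R for R (structure)
begin

lemma ideal_prod_combinations:
  fixes m :: nat
  assumes K: "ideal K R" and M: "M = Idl (w ` {..<m})"
    and w: "\<And>j. j < m \<Longrightarrow> w j \<in> carrier R" and x: "x \<in> K \<cdot> M"
  shows "\<exists>k. (\<forall>j<m. k j \<in> K) \<and> x = (\<Oplus>j\<in>{..<m}. k j \<otimes> w j)"
proof -
  interpret K: ideal K R by fact
  let ?S = "\<lambda>K. {x. \<exists>k. (\<forall>j<m. k j \<in> K) \<and> x = (\<Oplus>j\<in>{..<m}. k j \<otimes> w j)}"
  have "M \<subseteq> ?S (carrier R)"
    unfolding M
  proof (rule genideal_minimal[OF ideal_combinations[OF oneideal w]])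
    show "w ` {..<m} \<subseteq> ?S (carrier R)"
    proof
      fix y assume "y \<in> w ` {..<m}"
      then obtain i where i: "i < m" "y = w i" by blast
      have "(\<Oplus>j\<in>{..<m}. (if i = j then \<one> else \<zero>) \<otimes> w j) = (\<Oplus>j\<in>{..<m}. if i = j then w j else \<zero>)"
        using w by (intro finsum_cong') auto
      also have "\<dots> = w i" using i w by (intro add.finprod_singleton) auto
      finally have "y = (\<Oplus>j\<in>{..<m}. (if i = j then \<one> else \<zero>) \<otimes> w j)" using i by simp
      then show "y \<in> ?S (carrier R)"
        by (intro CollectI exI[of _ "\<lambda>j. if i = j then \<one> else \<zero>"]) auto
    qed
  qed
  have "K \<cdot> M \<subseteq> ?S K"
  proof (rule ideal_prod_least[OF ideal_combinations[OF K w]])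
    fix k x assume k: "k \<in> K" and "x \<in> M"
    then obtain r where r: "\<forall>j<m. r j \<in> carrier R" "x = (\<Oplus>j\<in>{..<m}. r j \<otimes> w j)"
      using \<open>M \<subseteq> ?S (carrier R)\<close> by blast
    have "k \<otimes> x = (\<Oplus>j\<in>{..<m}. k \<otimes> (r j \<otimes> w j))"
      unfolding r(2) using k r(1) w K.Icarr by (intro finsum_rdistr) auto
    also have "\<dots> = (\<Oplus>j\<in>{..<m}. (k \<otimes> r j) \<otimes> w j)"
      using k r(1) w K.Icarr by (intro finsum_cong') (auto simp: m_assoc)
    finally show "k \<otimes> x \<in> ?S K"
      using r(1) k K.I_r_closed by (intro CollectI exI[of _ "\<lambda>j. k \<otimes> r j"]) auto
  qed
  then show ?thesis using x by blast
qed

lemma integral_of_ideal_mult: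
  assumes K: "ideal K R" and M: "ideal M R" and z: "z \<in> carrier R"
    and y: "y \<in> M" "nonzerodivisor R y"
    and zM: "\<And>x. x \<in> M \<Longrightarrow> z \<otimes> x \<in> K \<cdot> M"
  shows "z \<in> integral_closure R K"
proof -
  interpret K: ideal K R by fact
  interpret M: ideal M R by fact
  interpret E: ideal "integral_forms R K z {\<zero>} l" R for l
    by (rule ideal_integral_forms[OF K zeroideal z])
  obtain m :: nat and w where w: "\<forall>j<m. w j \<in> M" and gen: "M = Idl (w ` {..<m})"
    by (rule exists_generators[OF M])
  have wc: "w j \<in> carrier R" if "j < m" for j using w that M.Icarr by blast
  have "\<exists>k. (\<forall>j<m. k j \<in> K) \<and> z \<otimes> w i = (\<Oplus>j\<in>{..<m}. k j \<otimes> w j)" if "i < m" for i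
    by (rule ideal_prod_combinations[OF K gen wc zM]) (use w that in auto)
  then obtain k where k: "\<And>i j. i < m \<Longrightarrow> j < m \<Longrightarrow> k i j \<in> K"
    "\<And>i. i < m \<Longrightarrow> z \<otimes> w i = (\<Oplus>j\<in>{..<m}. k i j \<otimes> w j)" by metis
  let ?D = "\<lambda>i j. if i = j then z \<oplus> (\<ominus> k i j) else \<ominus> k i j"
  have K1: "x \<in> integral_forms R K z {\<zero>} 1" if "x \<in> K" for x
    using that z ideal_pow_one[OF K] K.Icarr by (simp add: mem_coset_add)
  have "\<exists>n\<ge>1. \<exists>u\<in>monic_forms K z n. \<forall>j<m. u \<otimes> w j = \<zero>"
  proof (rule monic_form_annihilates[OF K z, of 1 m w ?D])
    show "?D i i \<in> monic_forms K z 1" if "i < m" for i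
    proof -
      have "z [^] (1::nat) \<oplus> (\<ominus> k i i) \<in> monic_forms K z 1"
        unfolding monic_forms_def using K1 k(1)[OF that that] by blast
      then show ?thesis using z by simp
    qed
    show "?D i j \<in> integral_forms R K z {\<zero>} 1" if "i < m" "j < m" "i \<noteq> j" for i j
      using K1 k(1) that by simp
    show "(\<Oplus>j\<in>{..<m}. ?D i j \<otimes> w j) = \<zero>" if i: "i < m" for i
    proof -
      have kc: "k i j \<in> carrier R" if "j < m" for j using k(1) i that K.Icarr by blast
      have "(\<Oplus>j\<in>{..<m}. ?D i j \<otimes> w j) =
          (\<Oplus>j\<in>{..<m}. (if i = j then z \<otimes> w j else \<zero>) \<oplus> (\<ominus> \<one>) \<otimes> (k i j \<otimes> w j))"
        using kc wc z by (intro finsum_cong') (auto simp: l_distr l_minus)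
      also have "\<dots> = (\<Oplus>j\<in>{..<m}. if i = j then z \<otimes> w j else \<zero>) \<oplus>
          (\<Oplus>j\<in>{..<m}. (\<ominus> \<one>) \<otimes> (k i j \<otimes> w j))"
        using kc wc z by (intro finsum_addf) auto
      also have "(\<Oplus>j\<in>{..<m}. if i = j then z \<otimes> w j else \<zero>) = z \<otimes> w i"
        using i wc z by (intro add.finprod_singleton) auto
      also have "(\<Oplus>j\<in>{..<m}. (\<ominus> \<one>) \<otimes> (k i j \<otimes> w j)) = (\<ominus> \<one>) \<otimes> (\<Oplus>j\<in>{..<m}. k i j \<otimes> w j)"
        using kc wc by (intro finsum_rdistr[symmetric]) auto
      also have "\<dots> = \<ominus> (z \<otimes> w i)" unfolding k(2)[OF i, symmetric] using z wc i by (simp add: l_minus)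
      also have "z \<otimes> w i \<oplus> \<ominus> (z \<otimes> w i) = \<zero>" using z wc i by (simp add: r_neg)
      finally show ?thesis .
    qed
  qed (use wc in auto)
  then obtain n u where n: "n \<ge> 1" and u: "u \<in> monic_forms K z n" "\<forall>j<m. u \<otimes> w j = \<zero>" by blast
  have uc: "u \<in> carrier R" by (rule monic_forms_carrier[OF K z u(1)])
  have "M \<subseteq> {c \<in> carrier R. u \<otimes> c \<in> {\<zero>}}"
    unfolding gen by (rule genideal_minimal[OF ideal_colon[OF zeroideal uc]]) (use u(2) wc in auto)
  then have "u \<otimes> y = \<zero>" using y(1) by blast
  moreover have yc: "y \<in> carrier R" using y(1) by (rule M.Icarr)
  ultimately have "y \<otimes> u = \<zero>" using m_comm[OF yc uc] by simp
  then have u0: "u = \<zero>" using y(2) uc unfolding nonzerodivisor_def by blast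
  obtain e where e: "u = z [^] n \<oplus> e" "e \<in> integral_forms R K z {\<zero>} n"
    using u(1) by (rule monic_formsE)
  have "z [^] n \<oplus> e = \<zero>" unfolding e(1)[symmetric] by (rule u0)
  then have "\<ominus> e = z [^] n" using z E.Icarr[OF e(2)] by (intro minus_equality) simp_all
  then have "z [^] n = \<ominus> e" by (rule sym)
  then have "z [^] n \<in> integral_forms R K z {\<zero>} n" using e(2) by simp
  then show ?thesis unfolding integral_closure_iff[OF K] using n z by blast
qed

lemma ideal_pow_subset_integral_forms_carrier:
  assumes K: "ideal K R" and z: "z \<in> carrier R"
  shows "ideal_pow R K (int d) \<subseteq> integral_forms R K z (carrier R) d"
proof (cases d)
  case 0
  then show ?thesis by (simp add: ideal_pow_nonpos)
next
  case (Suc n)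
  then show ?thesis using ideal_pow_subset_integral_forms[OF K oneideal z] by blast
qed

lemma exists_stable_ideal:
  assumes K: "ideal K R" and k: "k \<in> K" "nonzerodivisor R k" and x: "x \<in> integral_closure R K"
  obtains M y where "ideal M R" "y \<in> M" "nonzerodivisor R y" "\<forall>v\<in>M. x \<otimes> v \<in> K \<cdot> M"
proof -
  interpret K: ideal K R by fact
  obtain n where xc: "x \<in> carrier R" and n: "n \<ge> 1" "x [^] n \<in> integral_forms R K x {\<zero>} n"
    using x unfolding integral_closure_iff[OF K] by blast
  let ?V = "integral_forms R K x (carrier R)"
  interpret V: ideal "?V l" R for l by (rule ideal_integral_forms[OF K oneideal xc])
  have KV: "ideal (K \<cdot> ?V l) R" for l
    by (rule ideal_prod_is_ideal[OF K V.is_ideal])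
  interpret KV: ideal "K \<cdot> ?V l" R for l by (rule KV)
  have xKV: "x \<otimes> v \<in> K \<cdot> ?V (Suc l)" if "v \<in> K \<cdot> ?V l" for v l
  proof -
    have "K \<cdot> ?V l \<subseteq> {c \<in> carrier R. x \<otimes> c \<in> K \<cdot> ?V (Suc l)}"
    proof (rule ideal_prod_least[OF ideal_colon[OF KV xc]])
      fix k v assume kv: "k \<in> K" "v \<in> ?V l"
      then have "x \<otimes> (k \<otimes> v) = k \<otimes> (x \<otimes> v)" using xc K.Icarr V.Icarr by (simp add: m_lcomm)
      moreover have "x \<otimes> v \<in> ?V (Suc l)" by (rule integral_forms_mult_left[OF K oneideal xc kv(2)])
      ultimately have "x \<otimes> (k \<otimes> v) \<in> K \<cdot> ?V (Suc l)" using kv(1) ideal_prod.prod by metis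
      then show "k \<otimes> v \<in> {c \<in> carrier R. x \<otimes> c \<in> K \<cdot> ?V (Suc l)}"
        using kv K.Icarr V.Icarr by simp
    qed
    then show ?thesis using that by blast
  qed
  have KK: "x \<otimes> t \<in> K \<cdot> ?V (Suc l)" if "t \<in> ideal_pow R K (int (Suc l))" for t l
  proof -
    have "ideal_pow R K (int (Suc l)) \<subseteq> K \<cdot> ?V l"
      unfolding ideal_pow_Suc ideal_prod_commute[OF ideal_ideal_pow[OF K] K]
      by (rule ideal_prod_mono[OF order_refl ideal_pow_subset_integral_forms_carrier[OF K xc]])
    then show ?thesis using xKV that by blast
  qed
  have xV: "\<exists>s\<in>carrier R. \<exists>t\<in>K \<cdot> ?V l. x \<otimes> v = x [^] Suc l \<otimes> s \<oplus> t" if "v \<in> ?V l" for v l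
    using that
  proof (induction l arbitrary: v)
    case 0
    then show ?case using xc KV.zero_closed[of 0] by (intro bexI[of _ v] bexI[of _ \<zero>]) auto
  next
    case (Suc l)
    obtain v' t where v: "v' \<in> ?V l" "t \<in> ideal_pow R K (int (Suc l))" "v = x \<otimes> v' \<oplus> t"
      using Suc.prems unfolding integral_forms.simps mem_coset_add by blast
    obtain s t' where s: "s \<in> carrier R" "t' \<in> K \<cdot> ?V l" "x \<otimes> v' = x [^] Suc l \<otimes> s \<oplus> t'"
      using Suc.IH[OF v(1)] by blast
    have tc: "t \<in> carrier R" "t' \<in> carrier R"
      using v(2) s(2) ideal.Icarr[OF ideal_ideal_pow[OF K]] KV.Icarr by auto
    have "x \<otimes> v = x \<otimes> (x [^] Suc l \<otimes> s) \<oplus> (x \<otimes> t' \<oplus> x \<otimes> t)"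
      unfolding v(3) s(3) using xc s(1) tc by (simp add: r_distr a_assoc)
    also have "x \<otimes> (x [^] Suc l \<otimes> s) = x [^] Suc (Suc l) \<otimes> s" using xc s(1) by (simp add: m_ac)
    finally show ?case using s(1) xKV[OF s(2)] KK[OF v(2)] KV.a_closed by blast
  qed
  have EV: "integral_forms R K x {\<zero>} (Suc l) \<subseteq> K \<cdot> ?V l" for l
  proof (induction l)
    case 0
    have "e \<in> K \<cdot> carrier R" if "e \<in> integral_forms R K x {\<zero>} (Suc 0)" for e
    proof -
      have "e \<in> K" using that xc K.Icarr ideal_pow_one[OF K] by (auto simp: mem_coset_add)
      then show ?thesis using ideal_prod.prod[of e K \<one> "carrier R" R] K.Icarr by simp
    qed
    then show ?case by (auto simp del: integral_forms.simps(2))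
  next
    case (Suc l)
    show ?case
    proof
      fix e assume "e \<in> integral_forms R K x {\<zero>} (Suc (Suc l))"
      then obtain f t where f: "f \<in> integral_forms R K x {\<zero>} (Suc l)"
        "t \<in> ideal_pow R K (int (Suc (Suc l)))" "e = x \<otimes> f \<oplus> t"
        unfolding integral_forms.simps(2)[of R K x _ "Suc l"] mem_coset_add by blast
      have "ideal_pow R K (int (Suc (Suc l))) \<subseteq> K \<cdot> ?V (Suc l)"
        unfolding ideal_pow_Suc[of _ _ "Suc l"] ideal_prod_commute[OF ideal_ideal_pow[OF K] K]
        by (rule ideal_prod_mono[OF order_refl ideal_pow_subset_integral_forms_carrier[OF K xc]])
      moreover have "x \<otimes> f \<in> K \<cdot> ?V (Suc l)" using xKV f(1) Suc by blast
      ultimately show "e \<in> K \<cdot> ?V (Suc l)" unfolding f(3) using f(2) KV.a_closed by blast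
    qed
  qed
  obtain l where l: "n = Suc l" using n(1) by (cases n) auto
  show ?thesis
  proof (rule that[of "?V l" "k [^] l"])
    show "ideal (?V l) R" by (rule V.is_ideal)
    show "k [^] l \<in> ?V l" using ideal_pow_pow[OF K k(1), of l] ideal_pow_subset_integral_forms_carrier[OF K xc] by blast
    show "nonzerodivisor R (k [^] l)" by (rule nonzerodivisor_pow[OF k(2)])
    show "\<forall>v\<in>?V l. x \<otimes> v \<in> K \<cdot> ?V l"
    proof
      fix v assume "v \<in> ?V l"
      then obtain s t where s: "s \<in> carrier R" "t \<in> K \<cdot> ?V l" "x \<otimes> v = x [^] Suc l \<otimes> s \<oplus> t"
        using xV by blast
      have "x [^] Suc l \<in> K \<cdot> ?V l" using n(2) EV unfolding l by blast
      then have "x [^] Suc l \<otimes> s \<in> K \<cdot> ?V l" using s(1) by (rule KV.I_r_closed)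
      then show "x \<otimes> v \<in> K \<cdot> ?V l" unfolding s(3) using s(2) by (rule KV.a_closed)
    qed
  qed
qed

theorem ideal_integral_closure:
  assumes K: "ideal K R" and k: "k \<in> K" "nonzerodivisor R k"
  shows "ideal (integral_closure R K) R"
proof -
  interpret K: ideal K R by fact
  have mult: "c \<otimes> x \<in> integral_closure R K" if c: "c \<in> carrier R" and x: "x \<in> integral_closure R K" for c x
  proof -
    have xc: "x \<in> carrier R" using x integral_closure_subset_carrier by blast
    obtain M y where M: "ideal M R" "y \<in> M" "nonzerodivisor R y" "\<forall>v\<in>M. x \<otimes> v \<in> K \<cdot> M"
      by (rule exists_stable_ideal[OF K k x])
    interpret KM: ideal "K \<cdot> M" R by (rule ideal_prod_is_ideal[OF K M(1)])
    show ?thesis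
    proof (rule integral_of_ideal_mult[OF K M(1) _ M(2,3)])
      fix v assume v: "v \<in> M"
      then have "c \<otimes> x \<otimes> v = c \<otimes> (x \<otimes> v)" using c xc ideal.Icarr[OF M(1)] by (simp add: m_assoc)
      then show "c \<otimes> x \<otimes> v \<in> K \<cdot> M" using KM.I_l_closed[OF M(4)[rule_format, OF v] c] by simp
    qed (use c xc in simp)
  qed
  have add: "x \<oplus> y \<in> integral_closure R K"
    if x: "x \<in> integral_closure R K" and y: "y \<in> integral_closure R K" for x y
  proof -
    have c: "x \<in> carrier R" "y \<in> carrier R" using x y integral_closure_subset_carrier by auto
    obtain M x' where M: "ideal M R" "x' \<in> M" "nonzerodivisor R x'" "\<forall>v\<in>M. x \<otimes> v \<in> K \<cdot> M"
      by (rule exists_stable_ideal[OF K k x])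
    obtain N y' where N: "ideal N R" "y' \<in> N" "nonzerodivisor R y'" "\<forall>v\<in>N. y \<otimes> v \<in> K \<cdot> N"
      by (rule exists_stable_ideal[OF K k y])
    have MN: "ideal (M \<cdot> N) R" by (rule ideal_prod_is_ideal[OF M(1) N(1)])
    have KMN: "ideal (K \<cdot> (M \<cdot> N)) R" by (rule ideal_prod_is_ideal[OF K MN])
    have eq: "K \<cdot> (M \<cdot> N) = (K \<cdot> M) \<cdot> N" "K \<cdot> (M \<cdot> N) = (K \<cdot> N) \<cdot> M"
      using ideal_prod_assoc[OF K M(1) N(1)] ideal_prod_assoc[OF K N(1) M(1)]
        ideal_prod_commute[OF M(1) N(1)] by simp_all
    have sub: "M \<cdot> N \<subseteq> {v \<in> carrier R. (x \<oplus> y) \<otimes> v \<in> K \<cdot> (M \<cdot> N)}"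
    proof (rule ideal_prod_least[OF ideal_colon[OF KMN]])
      fix m n assume mn: "m \<in> M" "n \<in> N"
      have mc: "m \<in> carrier R" "n \<in> carrier R"
        using mn ideal.Icarr[OF M(1)] ideal.Icarr[OF N(1)] by auto
      have "(x \<oplus> y) \<otimes> (m \<otimes> n) = (x \<otimes> m) \<otimes> n \<oplus> (y \<otimes> n) \<otimes> m" using c mc by algebra
      moreover have "(x \<otimes> m) \<otimes> n \<in> K \<cdot> (M \<cdot> N)"
        unfolding eq(1) by (rule ideal_prod.prod[OF M(4)[rule_format, OF mn(1)] mn(2)])
      moreover have "(y \<otimes> n) \<otimes> m \<in> K \<cdot> (M \<cdot> N)"
        unfolding eq(2) by (rule ideal_prod.prod[OF N(4)[rule_format, OF mn(2)] mn(1)])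
      ultimately have "(x \<oplus> y) \<otimes> (m \<otimes> n) \<in> K \<cdot> (M \<cdot> N)"
        using ideal_prod.sum by metis
      then show "m \<otimes> n \<in> {v \<in> carrier R. (x \<oplus> y) \<otimes> v \<in> K \<cdot> (M \<cdot> N)}" using mc by simp
    qed (use c in simp)
    show ?thesis
    proof (rule integral_of_ideal_mult[OF K MN _ ideal_prod.prod[OF M(2) N(2)] nonzerodivisor_mult[OF M(3) N(3)]])
      show "(x \<oplus> y) \<otimes> v \<in> K \<cdot> (M \<cdot> N)" if "v \<in> M \<cdot> N" for v using sub that by blast
    qed (use c in simp)
  qed
  show ?thesis
  proof (rule idealI[OF ring_axioms])
    show "subgroup (integral_closure R K) (add_monoid R)"
    proof (rule add.subgroupI)
      show "integral_closure R K \<noteq> {}" using subset_integral_closure[OF K] k by blast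
      fix x assume x: "x \<in> integral_closure R K"
      then have "\<ominus> x = (\<ominus> \<one>) \<otimes> x" using integral_closure_subset_carrier[of K] by (auto simp: l_minus)
      then show "\<ominus> x \<in> integral_closure R K" using mult[of "\<ominus> \<one>" x] x by simp
    qed (use integral_closure_subset_carrier add in auto)
    fix x c assume x: "x \<in> integral_closure R K" and c: "c \<in> carrier R"
    show "c \<otimes> x \<in> integral_closure R K" by (rule mult[OF c x])
    have "x \<otimes> c = c \<otimes> x" using x c integral_closure_subset_carrier[of K] m_comm by blast
    then show "x \<otimes> c \<in> integral_closure R K" using mult[OF c x] by simp
  qed
qed

end

section \<open>Filtrations with a good joint reduction\<close>

definition pair_ideal :: "('a, 'b) ring_scheme \<Rightarrow> 'a \<Rightarrow> 'a \<Rightarrow> 'a set" where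
  "pair_ideal R a b = (a <#\<^bsub>R\<^esub> carrier R) <+>\<^bsub>R\<^esub> (b <#\<^bsub>R\<^esub> carrier R)"

context cring
begin

lemma mem_l_coset: "x \<in> a <# S \<longleftrightarrow> (\<exists>s\<in>S. x = a \<otimes> s)"
  by (auto simp: l_coset_def)

lemma mem_coset_add_coset:
  "x \<in> (a <# S) <+>\<^bsub>R\<^esub> (b <# T) \<longleftrightarrow> (\<exists>s\<in>S. \<exists>t\<in>T. x = a \<otimes> s \<oplus> b \<otimes> t)"
  by (auto simp: l_coset_def set_add_def')

lemma mem_pair_ideal: "x \<in> pair_ideal R a b \<longleftrightarrow> (\<exists>s\<in>carrier R. \<exists>t\<in>carrier R. x = a \<otimes> s \<oplus> b \<otimes> t)"
  by (simp add: pair_ideal_def mem_coset_add_coset)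

lemma ideal_coset_add_coset:
  assumes "ideal S R" "ideal T R" "a \<in> carrier R" "b \<in> carrier R"
  shows "ideal ((a <# S) <+>\<^bsub>R\<^esub> (b <# T)) R"
  by (intro add_ideals ideal_l_coset assms)

lemma ideal_pair_ideal: "a \<in> carrier R \<Longrightarrow> b \<in> carrier R \<Longrightarrow> ideal (pair_ideal R a b) R"
  unfolding pair_ideal_def by (intro ideal_coset_add_coset oneideal)

lemma pair_ideal_commute:
  assumes "a \<in> carrier R" "b \<in> carrier R"
  shows "pair_ideal R a b = pair_ideal R b a"
  unfolding pair_ideal_def
  by (rule set_add_comm) (auto simp: l_coset_def assms)

lemma ideal_subset_carrier: "ideal N R \<Longrightarrow> N \<subseteq> carrier R"
  by (rule subsetI) (rule ideal.Icarr)

lemma ideal_length_pair_ideal_mult: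
  assumes c: "a \<in> carrier R" "a' \<in> carrier R" "b \<in> carrier R"
    and syz: "trivial_syzygies R a b"
  shows "ideal_length R (pair_ideal R (a \<otimes> a') b) (carrier R) =
    ideal_length R (pair_ideal R a b) (carrier R) + ideal_length R (pair_ideal R a' b) (carrier R)"
proof -
  let ?K = "pair_ideal R (a \<otimes> a') b"
  have K: "ideal ?K R" "ideal (pair_ideal R a b) R" "ideal (pair_ideal R a' b) R"
    using c by (simp_all add: ideal_pair_ideal)
  have sub: "?K \<subseteq> pair_ideal R a b"
  proof
    fix x assume "x \<in> ?K"
    then obtain s t where "s \<in> carrier R" "t \<in> carrier R" "x = a \<otimes> a' \<otimes> s \<oplus> b \<otimes> t"
      unfolding mem_pair_ideal by blast
    then show "x \<in> pair_ideal R a b"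
      unfolding mem_pair_ideal using c by (intro bexI[of _ "a' \<otimes> s"] bexI[of _ t]) (auto simp: m_assoc)
  qed
  have eq: "(a <# carrier R) <+>\<^bsub>R\<^esub> ?K = pair_ideal R a b"
  proof
    have "a <# carrier R \<subseteq> pair_ideal R a b"
      unfolding pair_ideal_def
      by (rule subset_set_add) (auto intro!: ideal_l_coset oneideal c)
    then show "(a <# carrier R) <+>\<^bsub>R\<^esub> ?K \<subseteq> pair_ideal R a b"
      by (rule set_add_least[OF K(2) _ sub])
    show "pair_ideal R a b \<subseteq> (a <# carrier R) <+>\<^bsub>R\<^esub> ?K"
    proof
      fix x assume "x \<in> pair_ideal R a b"
      then obtain s t where s: "s \<in> carrier R" "t \<in> carrier R" "x = a \<otimes> s \<oplus> b \<otimes> t"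
        unfolding mem_pair_ideal by blast
      have "b \<otimes> t \<in> ?K"
        unfolding mem_pair_ideal using c s by (intro bexI[of _ \<zero>] bexI[of _ t]) auto
      then show "x \<in> (a <# carrier R) <+>\<^bsub>R\<^esub> ?K" unfolding mem_coset_add using s by blast
    qed
  qed
  have "ideal_length R ?K ((a <# carrier R) <+>\<^bsub>R\<^esub> ?K) = ideal_length R (pair_ideal R a' b) (carrier R)"
  proof (rule ideal_length_mult[OF oneideal K(1) c(1) K(3)])
    show "pair_ideal R a' b \<subseteq> carrier R" by (rule ideal_subset_carrier[OF K(3)])
    fix q assume q: "q \<in> carrier R"
    show "a \<otimes> q \<in> ?K \<longleftrightarrow> q \<in> pair_ideal R a' b"
    proof
      assume "a \<otimes> q \<in> ?K"
      then obtain s t where s: "s \<in> carrier R" "t \<in> carrier R" "a \<otimes> q = a \<otimes> a' \<otimes> s \<oplus> b \<otimes> t"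
        unfolding mem_pair_ideal by blast
      have "(q \<ominus> a' \<otimes> s) \<otimes> a = a \<otimes> q \<ominus> a \<otimes> a' \<otimes> s" using c q s(1) by algebra
      also have "\<dots> = t \<otimes> b" unfolding s(3) using c s(1,2) by algebra
      finally have e: "(q \<ominus> a' \<otimes> s) \<otimes> a = t \<otimes> b" .
      have "q \<ominus> a' \<otimes> s \<in> carrier R" using c q s(1) by simp
      then obtain w where w: "w \<in> carrier R" "q \<ominus> a' \<otimes> s = w \<otimes> b"
        using trivial_syzygiesE[OF syz _ s(2) e] by metis
      have "q = a' \<otimes> s \<oplus> (q \<ominus> a' \<otimes> s)" using c q s(1) by algebra
      also have "\<dots> = a' \<otimes> s \<oplus> b \<otimes> w" using w c by (simp add: m_comm)
      finally show "q \<in> pair_ideal R a' b" unfolding mem_pair_ideal using s(1) w(1) by blast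
    next
      assume "q \<in> pair_ideal R a' b"
      then obtain s t where s: "s \<in> carrier R" "t \<in> carrier R" "q = a' \<otimes> s \<oplus> b \<otimes> t"
        unfolding mem_pair_ideal by blast
      have "a \<otimes> q = a \<otimes> a' \<otimes> s \<oplus> b \<otimes> (a \<otimes> t)" unfolding s(3) using c s(1,2) by algebra
      then show "a \<otimes> q \<in> ?K" unfolding mem_pair_ideal using s c by blast
    qed
  qed
  then show ?thesis
    using ideal_length_add[OF K(1,2) oneideal sub ideal_subset_carrier[OF K(2)]]
    unfolding eq by (simp add: add.commute)
qed

lemma ideal_length_pair_ideal_pow:
  fixes m n :: nat
  assumes c: "a \<in> carrier R" "b \<in> carrier R" and syz: "trivial_syzygies R a b"
  shows "ideal_length R (pair_ideal R (a [^] m) (b [^] n)) (carrier R) =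
    enat (m * n) * ideal_length R (pair_ideal R a b) (carrier R)"
proof -
  have *: "ideal_length R (pair_ideal R (a [^] m) b) (carrier R) =
      enat m * ideal_length R (pair_ideal R a b) (carrier R)"
    if "a \<in> carrier R" "b \<in> carrier R" "trivial_syzygies R a b" for a b and m :: nat
  proof (induction m)
    case 0
    have "pair_ideal R \<one> b = carrier R"
    proof
      show "pair_ideal R \<one> b \<subseteq> carrier R" by (rule ideal_subset_carrier[OF ideal_pair_ideal]) (use that in auto)
      show "carrier R \<subseteq> pair_ideal R \<one> b"
      proof
        fix x assume x: "x \<in> carrier R"
        then have "x = \<one> \<otimes> x \<oplus> b \<otimes> \<zero>" using that by simp
        then show "x \<in> pair_ideal R \<one> b" unfolding mem_pair_ideal using x by blast
      qed
    qed
    then show ?case by (simp add: ideal_length_self flip: zero_enat_def)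
  next
    case (Suc m)
    have "trivial_syzygies R (a [^] m) b"
      using trivial_syzygies_pow[OF that, of m 1] that by simp
    then have "ideal_length R (pair_ideal R (a [^] m \<otimes> a) b) (carrier R) =
        enat m * ideal_length R (pair_ideal R a b) (carrier R) + ideal_length R (pair_ideal R a b) (carrier R)"
      using ideal_length_pair_ideal_mult[of "a [^] m" a b] that Suc by simp
    also have "\<dots> = (enat m + 1) * ideal_length R (pair_ideal R a b) (carrier R)"
      by (simp add: distrib_right)
    also have "enat m + 1 = enat (Suc m)" by (simp add: one_enat_def)
    finally show ?case by simp
  qed
  have "trivial_syzygies R (a [^] m) (b [^] (1::nat))" by (rule trivial_syzygies_pow[OF c syz])
  then have "trivial_syzygies R (a [^] m) b" using c by simp
  then have "trivial_syzygies R b (a [^] m)" by (rule trivial_syzygies_sym)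
  then have "ideal_length R (pair_ideal R (b [^] n) (a [^] m)) (carrier R) =
      enat n * ideal_length R (pair_ideal R b (a [^] m)) (carrier R)"
    using c by (intro *) auto
  also have "pair_ideal R b (a [^] m) = pair_ideal R (a [^] m) b"
    using c by (simp add: pair_ideal_commute)
  also have "ideal_length R (pair_ideal R (a [^] m) b) (carrier R) =
      enat m * ideal_length R (pair_ideal R a b) (carrier R)" by (rule *[OF c syz])
  also have "enat n * (enat m * ideal_length R (pair_ideal R a b) (carrier R)) =
      enat (m * n) * ideal_length R (pair_ideal R a b) (carrier R)"
    by (simp flip: mult.assoc) (simp add: mult.commute)
  finally show ?thesis using c by (simp add: pair_ideal_commute)
qed

lemma ideal_length_koszul:
  assumes c: "a \<in> carrier R" "b \<in> carrier R" and syz: "trivial_syzygies R a b"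
    and F: "ideal F0 R" "ideal F1 R" "ideal F2 R"
    and aF: "\<And>w. w \<in> carrier R \<Longrightarrow> a \<otimes> w \<in> F2 \<longleftrightarrow> w \<in> F0"
    and bF: "\<And>w. w \<in> F0 \<Longrightarrow> b \<otimes> w \<in> F1"
  shows "ideal_length R ((a <# F1) <+>\<^bsub>R\<^esub> (b <# F2)) (carrier R) + ideal_length R F0 (carrier R) =
    ideal_length R (pair_ideal R a b) (carrier R) + ideal_length R F1 (carrier R) + ideal_length R F2 (carrier R)"
proof -
  interpret F0: ideal F0 R by fact
  interpret F1: ideal F1 R by fact
  interpret F2: ideal F2 R by fact
  let ?K = "(a <# F1) <+>\<^bsub>R\<^esub> (b <# F2)"
  let ?K1 = "(a <# carrier R) <+>\<^bsub>R\<^esub> ?K"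
  let ?K2 = "(b <# carrier R) <+>\<^bsub>R\<^esub> ?K1"
  let ?C = "(a <# carrier R) <+>\<^bsub>R\<^esub> F2"
  have aR: "ideal (a <# carrier R) R" "ideal (b <# carrier R) R"
    using c by (simp_all add: ideal_l_coset oneideal)
  have K: "ideal ?K R" by (rule ideal_coset_add_coset[OF F(2,3) c])
  have K1: "ideal ?K1 R" by (rule add_ideals[OF aR(1) K])
  have K2: "ideal ?K2 R" by (rule add_ideals[OF aR(2) K1])
  have C: "ideal ?C R" by (rule add_ideals[OF aR(1) F(3)])
  have sub: "?K \<subseteq> ?K1" "?K1 \<subseteq> ?K2" "F2 \<subseteq> ?C"
    by (rule subset_set_add[OF aR(1) K] subset_set_add[OF aR(2) K1] subset_set_add[OF aR(1) F(3)])+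
  have K1_iff: "x \<in> ?K1 \<longleftrightarrow> (\<exists>s\<in>carrier R. \<exists>t\<in>F2. x = a \<otimes> s \<oplus> b \<otimes> t)" for x
  proof
    assume "x \<in> ?K1"
    then obtain s y where s: "s \<in> carrier R" "y \<in> ?K" "x = a \<otimes> s \<oplus> y"
      unfolding mem_coset_add[of x a] by blast
    obtain u t where u: "u \<in> F1" "t \<in> F2" "y = a \<otimes> u \<oplus> b \<otimes> t"
      using s(2) unfolding mem_coset_add_coset by blast
    have uc: "u \<in> carrier R" "t \<in> carrier R" using u F1.Icarr F2.Icarr by auto
    have "x = a \<otimes> (s \<oplus> u) \<oplus> b \<otimes> t"
      unfolding s(3) u(3) using c s(1) uc by algebra
    then show "\<exists>s\<in>carrier R. \<exists>t\<in>F2. x = a \<otimes> s \<oplus> b \<otimes> t"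
      using s(1) uc(1) u(2) by (intro bexI[of _ "s \<oplus> u"] bexI[of _ t]) auto
  next
    assume "\<exists>s\<in>carrier R. \<exists>t\<in>F2. x = a \<otimes> s \<oplus> b \<otimes> t"
    then obtain s t where s: "s \<in> carrier R" "t \<in> F2" "x = a \<otimes> s \<oplus> b \<otimes> t" by blast
    have "b \<otimes> t \<in> ?K"
      unfolding mem_coset_add_coset using s(2) c F2.Icarr by (intro bexI[of _ \<zero>] bexI[of _ t]) auto
    then show "x \<in> ?K1" unfolding mem_coset_add[of x a] using s by blast
  qed
  have K2_eq: "?K2 = pair_ideal R a b"
  proof
    have *: "a <# carrier R \<subseteq> pair_ideal R a b" "b <# carrier R \<subseteq> pair_ideal R a b"
      unfolding pair_ideal_def by (rule subset_set_add[OF aR])+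
    have "?K1 \<subseteq> pair_ideal R a b"
    proof
      fix x assume "x \<in> ?K1"
      then show "x \<in> pair_ideal R a b" unfolding K1_iff mem_pair_ideal using F2.Icarr by blast
    qed
    then show "?K2 \<subseteq> pair_ideal R a b" by (rule set_add_least[OF ideal_pair_ideal[OF c] *(2)])
    have "a <# carrier R \<subseteq> ?K2" "b <# carrier R \<subseteq> ?K2"
      using subset_set_add[OF aR(1) K] subset_set_add[OF aR(2) K1] by auto
    then show "pair_ideal R a b \<subseteq> ?K2" unfolding pair_ideal_def by (rule set_add_least[OF K2])
  qed
  have l1: "ideal_length R ?K ?K1 = ideal_length R F1 (carrier R)"
  proof (rule ideal_length_mult[OF oneideal K c(1) F(2)])
    show "F1 \<subseteq> carrier R" by (rule ideal_subset_carrier[OF F(2)])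
    fix q assume q: "q \<in> carrier R"
    show "a \<otimes> q \<in> ?K \<longleftrightarrow> q \<in> F1"
    proof
      assume "a \<otimes> q \<in> ?K"
      then obtain u t where u: "u \<in> F1" "t \<in> F2" "a \<otimes> q = a \<otimes> u \<oplus> b \<otimes> t"
        unfolding mem_coset_add_coset by blast
      have uc: "u \<in> carrier R" "t \<in> carrier R" using u F1.Icarr F2.Icarr by auto
      have "(q \<ominus> u) \<otimes> a = a \<otimes> q \<ominus> a \<otimes> u" using c q uc by algebra
      also have "\<dots> = t \<otimes> b" unfolding u(3) using c uc by algebra
      finally have e: "(q \<ominus> u) \<otimes> a = t \<otimes> b" .
      have "q \<ominus> u \<in> carrier R" using q uc by simp
      then obtain w where w: "w \<in> carrier R" "q \<ominus> u = w \<otimes> b" "t = w \<otimes> a"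
        using trivial_syzygiesE[OF syz _ uc(2) e] by metis
      have "a \<otimes> w \<in> F2" using u(2) w c m_comm by metis
      then have "w \<in> F0" using aF w(1) by simp
      then have "b \<otimes> w \<in> F1" by (rule bF)
      then have "u \<oplus> w \<otimes> b \<in> F1" using u(1) w(1) c m_comm[of w b] by simp
      moreover have "q = u \<oplus> (q \<ominus> u)" using q uc by algebra
      ultimately show "q \<in> F1" using w(2) by simp
    next
      assume "q \<in> F1"
      then show "a \<otimes> q \<in> ?K"
        unfolding mem_coset_add_coset using c F1.Icarr by (intro bexI[of _ q] bexI[of _ \<zero>]) auto
    qed
  qed
  have l2: "ideal_length R ?K1 ?K2 = ideal_length R ?C (carrier R)"
  proof (rule ideal_length_mult[OF oneideal K1 c(2) C])
    show "?C \<subseteq> carrier R" by (rule ideal_subset_carrier[OF C])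
    fix q assume q: "q \<in> carrier R"
    show "b \<otimes> q \<in> ?K1 \<longleftrightarrow> q \<in> ?C"
    proof
      assume "b \<otimes> q \<in> ?K1"
      then obtain s t where s: "s \<in> carrier R" "t \<in> F2" "b \<otimes> q = a \<otimes> s \<oplus> b \<otimes> t"
        unfolding K1_iff by blast
      have tc: "t \<in> carrier R" using s F2.Icarr by simp
      have "s \<otimes> a = b \<otimes> q \<ominus> b \<otimes> t" unfolding s(3) using c s(1) tc by algebra
      also have "\<dots> = (q \<ominus> t) \<otimes> b" using c q tc by algebra
      finally have e: "s \<otimes> a = (q \<ominus> t) \<otimes> b" .
      have "q \<ominus> t \<in> carrier R" using q tc by simp
      then obtain w where w: "w \<in> carrier R" "q \<ominus> t = w \<otimes> a"
        using trivial_syzygiesE[OF syz s(1) _ e] by metis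
      have "q = (q \<ominus> t) \<oplus> t" using q tc by algebra
      also have "\<dots> = a \<otimes> w \<oplus> t" using w c by (simp add: m_comm)
      finally show "q \<in> ?C" unfolding mem_coset_add using w(1) s(2) by blast
    next
      assume "q \<in> ?C"
      then obtain s t where s: "s \<in> carrier R" "t \<in> F2" "q = a \<otimes> s \<oplus> t" unfolding mem_coset_add by blast
      have "b \<otimes> q = a \<otimes> (b \<otimes> s) \<oplus> b \<otimes> t"
        unfolding s(3) using c s(1) F2.Icarr[OF s(2)] by algebra
      then show "b \<otimes> q \<in> ?K1" unfolding K1_iff using s c by blast
    qed
  qed
  have l3: "ideal_length R F2 ?C = ideal_length R F0 (carrier R)"
    by (rule ideal_length_mult[OF oneideal F(3) c(1) F(1) ideal_subset_carrier[OF F(1)] aF])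
  have "ideal_length R ?K (carrier R) = ideal_length R ?K ?K1 + ideal_length R ?K1 (carrier R)"
    by (rule ideal_length_add[OF K K1 oneideal sub(1) ideal_subset_carrier[OF K1]])
  also have "ideal_length R ?K1 (carrier R) = ideal_length R ?K1 ?K2 + ideal_length R ?K2 (carrier R)"
    by (rule ideal_length_add[OF K1 K2 oneideal sub(2) ideal_subset_carrier[OF K2]])
  finally have "ideal_length R ?K (carrier R) =
      ideal_length R F1 (carrier R) + (ideal_length R ?C (carrier R) + ideal_length R (pair_ideal R a b) (carrier R))"
    unfolding l1 l2[unfolded K2_eq] K2_eq .
  moreover have "ideal_length R F2 (carrier R) = ideal_length R F0 (carrier R) + ideal_length R ?C (carrier R)"
    unfolding l3[symmetric]
    by (rule ideal_length_add[OF F(3) C oneideal sub(3) ideal_subset_carrier[OF C]])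
  ultimately show ?thesis by (simp add: ac_simps)
qed

end

locale joint_filtration = cring R for R (structure) +
  fixes F :: "int \<Rightarrow> int \<Rightarrow> 'a set" and a b :: 'a
  assumes one_neq_zero: "\<one> \<noteq> \<zero>"
    and ideal_F: "ideal (F r s) R"
    and F_nonpos: "r \<le> 0 \<Longrightarrow> s \<le> 0 \<Longrightarrow> F r s = carrier R"
    and F_left: "r \<le> 0 \<Longrightarrow> F r s = F 0 s" and F_right: "s \<le> 0 \<Longrightarrow> F r s = F r 0"
    and F_finite: "ideal_length R (F r s) (carrier R) \<noteq> \<infinity>"
    and nzd_a: "nonzerodivisor R a" and nzd_b: "nonzerodivisor R b"
    and syz: "trivial_syzygies R a b"
    and joint: "\<exists>N. \<forall>r\<ge>N. \<forall>s\<ge>N. F r s = (a <# F (r - 1) s) <+>\<^bsub>R\<^esub> (b <# F r (s - 1))"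
    and good_a: "r > 0 \<Longrightarrow> PIdl a \<inter> F r s = a <# F (r - 1) s"
    and good_b: "s > 0 \<Longrightarrow> PIdl b \<inter> F r s = b <# F r (s - 1)"
begin

lemma ab_carrier [simp]: "a \<in> carrier R" "b \<in> carrier R"
  by (rule nzd_a[unfolded nonzerodivisor_def, THEN conjunct1] nzd_b[unfolded nonzerodivisor_def, THEN conjunct1])+

lemma F_carrier: "f \<in> F r s \<Longrightarrow> f \<in> carrier R"
  using ideal.Icarr[OF ideal_F] .

lemma a_mult_F_iff:
  assumes "r > 0" "w \<in> carrier R"
  shows "a \<otimes> w \<in> F r s \<longleftrightarrow> w \<in> F (r - 1) s"
proof
  assume "a \<otimes> w \<in> F r s"
  moreover have "a \<otimes> w \<in> PIdl a"
    unfolding cgenideal_def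
    by (intro CollectI exI[of _ w] conjI assms(2) m_comm[OF ab_carrier(1) assms(2)])
  ultimately have "a \<otimes> w \<in> a <# F (r - 1) s" unfolding good_a[OF assms(1), symmetric] by blast
  then obtain v where "v \<in> F (r - 1) s" "a \<otimes> w = a \<otimes> v" unfolding mem_l_coset by blast
  then show "w \<in> F (r - 1) s"
    using nonzerodivisor_cancel[OF nzd_a assms(2) F_carrier] by metis
next
  assume "w \<in> F (r - 1) s"
  then have "a \<otimes> w \<in> a <# F (r - 1) s" unfolding mem_l_coset by blast
  then show "a \<otimes> w \<in> F r s" unfolding good_a[OF assms(1), symmetric] by blast
qed

lemma b_mult_F_iff:
  assumes "s > 0" "w \<in> carrier R"
  shows "b \<otimes> w \<in> F r s \<longleftrightarrow> w \<in> F r (s - 1)"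
proof
  assume "b \<otimes> w \<in> F r s"
  moreover have "b \<otimes> w \<in> PIdl b"
    unfolding cgenideal_def
    by (intro CollectI exI[of _ w] conjI assms(2) m_comm[OF ab_carrier(2) assms(2)])
  ultimately have "b \<otimes> w \<in> b <# F r (s - 1)" unfolding good_b[OF assms(1), symmetric] by blast
  then obtain v where "v \<in> F r (s - 1)" "b \<otimes> w = b \<otimes> v" unfolding mem_l_coset by blast
  then show "w \<in> F r (s - 1)"
    using nonzerodivisor_cancel[OF nzd_b assms(2) F_carrier] by metis
next
  assume "w \<in> F r (s - 1)"
  then have "b \<otimes> w \<in> b <# F r (s - 1)" unfolding mem_l_coset by blast
  then show "b \<otimes> w \<in> F r s" unfolding good_b[OF assms(1), symmetric] by blast
qed

lemma a_pow_F_iff: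
  assumes "r \<ge> 0" "w \<in> carrier R"
  shows "a [^] k \<otimes> w \<in> F (r + int k) s \<longleftrightarrow> w \<in> F r s"
proof (induction k)
  case 0
  then show ?case using assms by simp
next
  case (Suc k)
  have "a [^] Suc k \<otimes> w = a \<otimes> (a [^] k \<otimes> w)" using assms by (simp add: m_ac)
  then show ?case
    using a_mult_F_iff[of "r + int (Suc k)" "a [^] k \<otimes> w" s] Suc assms by simp
qed

lemma b_pow_F_iff:
  assumes "s \<ge> 0" "w \<in> carrier R"
  shows "b [^] k \<otimes> w \<in> F r (s + int k) \<longleftrightarrow> w \<in> F r s"
proof (induction k)
  case 0
  then show ?case using assms by simp
next
  case (Suc k)
  have "b [^] Suc k \<otimes> w = b \<otimes> (b [^] k \<otimes> w)" using assms by (simp add: m_ac)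
  then show ?case
    using b_mult_F_iff[of "s + int (Suc k)" "b [^] k \<otimes> w" r] Suc assms by simp
qed

lemma a_mult_F:
  assumes "w \<in> F r s"
  shows "a \<otimes> w \<in> F (r + 1) s"
proof (cases "r \<ge> 0")
  case True
  then show ?thesis using a_mult_F_iff[of "r + 1" w s] assms F_carrier by simp
next
  case False
  then have "F (r + 1) s = F r s" using F_left[of r s] F_left[of "r + 1" s] by simp
  then show ?thesis using ideal.I_l_closed[OF ideal_F assms] by simp
qed

lemma b_mult_F:
  assumes "w \<in> F r s"
  shows "b \<otimes> w \<in> F r (s + 1)"
proof (cases "s \<ge> 0")
  case True
  then show ?thesis using b_mult_F_iff[of "s + 1" w r] assms F_carrier by simp
next
  case False
  then have "F r (s + 1) = F r s" using F_right[of s r] F_right[of "s + 1" r] by simp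
  then show ?thesis using ideal.I_l_closed[OF ideal_F assms] by simp
qed

definition colength :: "int \<Rightarrow> int \<Rightarrow> int" where
  "colength r s = int (the_enat (ideal_length R (F r s) (carrier R)))"

definition mult_ab :: int where
  "mult_ab = int (the_enat (ideal_length R (pair_ideal R a b) (carrier R)))"

definition koszul_boundaries :: "int \<Rightarrow> int \<Rightarrow> nat \<Rightarrow> 'a set" where
  "koszul_boundaries r s k = (a [^] k <# F r (s + int k)) <+>\<^bsub>R\<^esub> (b [^] k <# F (r + int k) s)"

lemma ideal_koszul_boundaries: "ideal (koszul_boundaries r s k) R"
  unfolding koszul_boundaries_def by (intro ideal_coset_add_coset ideal_F) auto

lemma koszul_boundaries_subset:
  assumes "r \<ge> 0" "s \<ge> 0"
  shows "koszul_boundaries r s k \<subseteq> F (r + int k) (s + int k)"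
  unfolding koszul_boundaries_def
proof (rule set_add_least[OF ideal_F])
  show "a [^] k <# F r (s + int k) \<subseteq> F (r + int k) (s + int k)"
  proof
    fix x assume "x \<in> a [^] k <# F r (s + int k)"
    then obtain w where w: "w \<in> F r (s + int k)" "x = a [^] k \<otimes> w" unfolding mem_l_coset by blast
    then show "x \<in> F (r + int k) (s + int k)" using a_pow_F_iff[OF assms(1) F_carrier[OF w(1)]] by simp
  qed
  show "b [^] k <# F (r + int k) s \<subseteq> F (r + int k) (s + int k)"
  proof
    fix x assume "x \<in> b [^] k <# F (r + int k) s"
    then obtain w where w: "w \<in> F (r + int k) s" "x = b [^] k \<otimes> w" unfolding mem_l_coset by blast
    then show "x \<in> F (r + int k) (s + int k)" using b_pow_F_iff[OF assms(2) F_carrier[OF w(1)]] by simp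
  qed
qed

lemma pair_ideal_finite: "ideal_length R (pair_ideal R a b) (carrier R) \<noteq> \<infinity>"
proof -
  obtain N where N: "\<forall>r\<ge>N. \<forall>s\<ge>N. F r s = (a <# F (r - 1) s) <+>\<^bsub>R\<^esub> (b <# F r (s - 1))"
    using joint by blast
  have sub: "F N N \<subseteq> pair_ideal R a b"
  proof
    fix x assume "x \<in> F N N"
    then have "x \<in> (a <# F (N - 1) N) <+>\<^bsub>R\<^esub> (b <# F N (N - 1))" using N by auto
    then show "x \<in> pair_ideal R a b"
      unfolding mem_coset_add_coset mem_pair_ideal using F_carrier by blast
  qed
  have "ideal_length R (F N N) (carrier R) =
      ideal_length R (F N N) (pair_ideal R a b) + ideal_length R (pair_ideal R a b) (carrier R)"
    by (intro ideal_length_add ideal_F ideal_pair_ideal oneideal sub ideal_subset_carrier) auto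
  then show ?thesis using F_finite[of N N] by (metis plus_eq_infty_iff_enat)
qed

lemma koszul_length:
  assumes "r \<ge> 0" "s \<ge> 0"
  shows "ideal_length R (koszul_boundaries r s k) (F (r + int k) (s + int k)) \<noteq> \<infinity>"
    and "int (the_enat (ideal_length R (koszul_boundaries r s k) (F (r + int k) (s + int k)))) =
      int k * int k * mult_ab + colength r (s + int k) + colength (r + int k) s
        - colength r s - colength (r + int k) (s + int k)"
proof -
  let ?l = "\<lambda>K. ideal_length R K (carrier R)"
  let ?K = "koszul_boundaries r s k"
  let ?N = "F (r + int k) (s + int k)"
  have e: "?l ?K + ?l (F r s) = ?l (pair_ideal R (a [^] k) (b [^] k)) + ?l (F r (s + int k)) + ?l (F (r + int k) s)"
    unfolding koszul_boundaries_def
  proof (rule ideal_length_koszul)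
    show "trivial_syzygies R (a [^] k) (b [^] k)" by (rule trivial_syzygies_pow[OF ab_carrier syz])
    show "a [^] k \<otimes> w \<in> F (r + int k) s \<longleftrightarrow> w \<in> F r s" if "w \<in> carrier R" for w
      by (rule a_pow_F_iff[OF assms(1) that])
    show "b [^] k \<otimes> w \<in> F r (s + int k)" if "w \<in> F r s" for w
      using b_pow_F_iff[OF assms(2) F_carrier[OF that]] that by simp
  qed (simp_all add: ideal_F)
  have p: "?l (pair_ideal R (a [^] k) (b [^] k)) = enat (k * k) * ?l (pair_ideal R a b)"
    by (intro ideal_length_pair_ideal_pow syz) auto
  have K: "?l ?K = ideal_length R ?K ?N + ?l ?N"
    by (intro ideal_length_add ideal_koszul_boundaries ideal_F oneideal koszul_boundaries_subset
        ideal_subset_carrier assms)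
  obtain c where c: "?l (pair_ideal R a b) = enat c" using pair_ideal_finite by auto
  obtain l0 where l0: "?l (F r s) = enat l0" using F_finite[of r s] by auto
  obtain l1 where l1: "?l (F r (s + int k)) = enat l1" using F_finite[of r "s + int k"] by auto
  obtain l2 where l2: "?l (F (r + int k) s) = enat l2" using F_finite[of "r + int k" s] by auto
  obtain l3 where l3: "?l ?N = enat l3" using F_finite[of "r + int k" "s + int k"] by auto
  have e': "ideal_length R ?K ?N + enat l3 + enat l0 = enat (k * k * c + l1 + l2)"
    using e unfolding K p c l0 l1 l2 l3 by simp
  then obtain x where x: "ideal_length R ?K ?N = enat x" by (cases "ideal_length R ?K ?N") auto
  then show "ideal_length R ?K ?N \<noteq> \<infinity>" by simp
  have "x + l3 + l0 = k * k * c + l1 + l2" using e' unfolding x by simp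
  then have "int x + int l3 + int l0 = int k * int k * int c + int l1 + int l2"
    by (metis of_nat_add of_nat_mult)
  then show "int (the_enat (ideal_length R ?K ?N)) =
      int k * int k * mult_ab + colength r (s + int k) + colength (r + int k) s
        - colength r s - colength (r + int k) (s + int k)"
    unfolding colength_def mult_ab_def x c l0 l1 l2 l3 by simp
qed

lemma colength_mixed_difference:
  "\<exists>N\<ge>0. \<forall>r\<ge>N. \<forall>s\<ge>N. colength (r + 1) (s + 1) = mult_ab + colength r (s + 1) + colength (r + 1) s - colength r s"
proof -
  obtain N where N: "\<forall>r\<ge>N. \<forall>s\<ge>N. F r s = (a <# F (r - 1) s) <+>\<^bsub>R\<^esub> (b <# F r (s - 1))"
    using joint by blast
  have "colength (r + 1) (s + 1) = mult_ab + colength r (s + 1) + colength (r + 1) s - colength r s"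
    if "r \<ge> max N 0" "s \<ge> max N 0" for r s
  proof -
    have "koszul_boundaries r s 1 = F (r + int 1) (s + int 1)"
      using N[rule_format, of "r + 1" "s + 1"] that by (simp add: koszul_boundaries_def)
    then show ?thesis
      using koszul_length(2)[of r s 1] that by (simp add: ideal_length_self zero_enat_def)
  qed
  then show ?thesis by (intro exI[of _ "max N 0"]) auto
qed

end

lemma mixed_difference_sum:
  fixes l :: "nat \<Rightarrow> nat \<Rightarrow> int"
  assumes "\<And>m n. m \<ge> N \<Longrightarrow> n \<ge> N \<Longrightarrow> l (Suc m) (Suc n) = c + l m (Suc n) + l (Suc m) n - l m n"
  shows "l (N + i) (N + j) = l (N + i) N + l N (N + j) - l N N + c * int i * int j"
proof (induction i)
  case 0
  then show ?case by simp
next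
  case (Suc i)
  have step: "l (N + Suc i) (N + j) - l (N + i) (N + j) = l (N + Suc i) N - l (N + i) N + c * int j" for j
  proof (induction j)
    case 0
    then show ?case by simp
  next
    case (Suc j)
    then show ?case using assms[of "N + i" "N + j"] by (simp add: algebra_simps)
  qed
  show ?case using Suc step[of j] by (simp add: algebra_simps)
qed

lemma int_choose_two: "2 * int ((n + 2) choose 2) = (int n + 2) * (int n + 1)"
proof (induction n)
  case 0
  then show ?case by (simp add: numeral_2_eq_2)
next
  case (Suc n)
  have "(Suc n + 2) choose 2 = (n + 2) + ((n + 2) choose 2)"
    using binomial_Suc_Suc[of "n + 2" 1] by (simp only: Suc_1 choose_one add_Suc)
  then have "int ((Suc n + 2) choose 2) = int ((n + 2) choose 2) + (int n + 2)" by simp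
  then show ?case using Suc by (simp add: algebra_simps)
qed

lemma quadratic_constant_zero:
  fixes x u v w :: int
  assumes "u * (x * x) + v * x + w = 0" "u * ((x + 1) * (x + 1)) + v * (x + 1) + w = 0"
    "u * ((x + 2) * (x + 2)) + v * (x + 2) + w = 0"
  shows "w = 0"
proof -
  have "2 * u = (u * ((x + 2) * (x + 2)) + v * (x + 2) + w)
      - 2 * (u * ((x + 1) * (x + 1)) + v * (x + 1) + w) + (u * (x * x) + v * x + w)"
    by (simp add: algebra_simps)
  then have "u = 0" using assms by simp
  then have "v = 0" using assms by (simp add: algebra_simps)
  then show ?thesis using \<open>u = 0\<close> assms by simp
qed

lemma eventual_koszul_length:
  fixes l :: "nat \<Rightarrow> nat \<Rightarrow> int" and c e :: int and g h :: "nat \<Rightarrow> int" and eI eJ eIJ :: "nat \<Rightarrow> int"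
  assumes mixed: "\<exists>N. \<forall>m\<ge>N. \<forall>n\<ge>N. l (Suc m) (Suc n) = c + l m (Suc n) + l (Suc m) n - l m n"
    and g: "\<forall>r. \<exists>N. \<forall>s\<ge>N. l r s - l 0 s = e * int r * int s + g r"
    and h: "\<forall>s. \<exists>N. \<forall>r\<ge>N. l r s - l r 0 = e * int r * int s + h s"
    and eI: "\<exists>N. \<forall>n\<ge>N. l (n + 1) 0 = eI 0 * int ((n + 2) choose 2) - eI 1 * int ((n + 1) choose 1) + eI 2"
    and eJ: "\<exists>N. \<forall>n\<ge>N. l 0 (n + 1) = eJ 0 * int ((n + 2) choose 2) - eJ 1 * int ((n + 1) choose 1) + eJ 2"
    and eIJ: "\<exists>N. \<forall>n\<ge>N. l (n + 1) (n + 1) =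
      eIJ 0 * int ((n + 2) choose 2) - eIJ 1 * int ((n + 1) choose 1) + eIJ 2"
  shows "\<exists>k0. \<forall>k\<ge>k0. int k * int k * c + l r (s + k) + l (r + k) s - l r s - l (r + k) (s + k) =
    (eI 2 + eJ 2 - eIJ 2) + g r + h s + int r * int s * e - l r s"
proof -
  obtain N where N: "\<And>m n. m \<ge> N \<Longrightarrow> n \<ge> N \<Longrightarrow> l (Suc m) (Suc n) = c + l m (Suc n) + l (Suc m) n - l m n"
    using mixed by blast
  note sum = mixed_difference_sum[of N l c, OF N]
  obtain G0 where G0: "\<forall>s\<ge>G0. l N s - l 0 s = e * int N * int s + g N" using g by blast
  obtain G1 where G1: "\<forall>s\<ge>G1. l (Suc N) s - l 0 s = e * int (Suc N) * int s + g (Suc N)" using g by blast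
  obtain H0 where H0: "\<forall>r\<ge>H0. l r N - l r 0 = e * int r * int N + h N" using h by blast
  have ce: "c = e"
  proof -
    define j where "j = G0 + G1"
    have "l (Suc N) (N + i) - l N (N + i) = l (Suc N) N - l N N + c * int i" for i
      using sum[of 1 i] by simp
    moreover have "l (Suc N) (N + i) - l N (N + i) = e * int (N + i) + g (Suc N) - g N" if "i \<ge> j" for i
      using G0[rule_format, of "N + i"] G1[rule_format, of "N + i"] that
      by (simp add: j_def algebra_simps)
    ultimately have "l (Suc N) N - l N N + c * int i = e * int (N + i) + g (Suc N) - g N" if "i \<ge> j" for i
      using that by metis
    from this[of j] this[of "Suc j"] show ?thesis by (simp add: algebra_simps)
  qed
  define \<kappa> where "\<kappa> = h N + g N - l N N + e * int N * int N"
  have split: "l m n = l m 0 + l 0 n + e * int m * int n + \<kappa>" if "m \<ge> N + H0" "n \<ge> N + G0" for m n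
  proof -
    have "N \<le> m" "N \<le> n" using that by auto
    then obtain i j where ij: "m = N + i" "n = N + j" using le_Suc_ex by blast
    have "l m N = l m 0 + e * int m * int N + h N" using H0[rule_format, of m] that by simp
    moreover have "l N n = l 0 n + e * int N * int n + g N" using G0[rule_format, of n] that by simp
    moreover have "l m n = l m N + l N n - l N N + e * int i * int j" using sum[of i j] ij ce by simp
    moreover have "int i = int m - int N" "int j = int n - int N" using ij by simp_all
    ultimately show ?thesis by (simp add: \<kappa>_def algebra_simps)
  qed
  have \<kappa>: "\<kappa> = eIJ 2 - eI 2 - eJ 2"
  proof -
    obtain A where A: "\<forall>n\<ge>A. l (n + 1) 0 = eI 0 * int ((n + 2) choose 2) - eI 1 * int ((n + 1) choose 1) + eI 2"
      using eI by blast
    obtain B where B: "\<forall>n\<ge>B. l 0 (n + 1) = eJ 0 * int ((n + 2) choose 2) - eJ 1 * int ((n + 1) choose 1) + eJ 2"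
      using eJ by blast
    obtain C where C: "\<forall>n\<ge>C. l (n + 1) (n + 1) =
        eIJ 0 * int ((n + 2) choose 2) - eIJ 1 * int ((n + 1) choose 1) + eIJ 2"
      using eIJ by blast
    define M where "M = A + B + C + N + H0 + G0"
    define u where "u = eIJ 0 - eI 0 - eJ 0 - 2 * e"
    define v where "v = (eIJ 0 - eI 0 - eJ 0) - 2 * (eIJ 1 - eI 1 - eJ 1)"
    define w where "w = 2 * (eIJ 2 - eI 2 - eJ 2 - \<kappa>)"
    have q: "u * (int (n + 1) * int (n + 1)) + v * int (n + 1) + w = 0" if "n \<ge> M" for n
    proof -
      have "eIJ 0 * int ((n + 2) choose 2) - eIJ 1 * int ((n + 1) choose 1) + eIJ 2 =
          eI 0 * int ((n + 2) choose 2) - eI 1 * int ((n + 1) choose 1) + eI 2 +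
          (eJ 0 * int ((n + 2) choose 2) - eJ 1 * int ((n + 1) choose 1) + eJ 2) +
          e * int (n + 1) * int (n + 1) + \<kappa>"
        using A[rule_format, of n] B[rule_format, of n] C[rule_format, of n] split[of "n + 1" "n + 1"] that
        by (simp add: M_def)
      then have "(eIJ 0 - eI 0 - eJ 0) * (2 * int ((n + 2) choose 2)) =
          2 * (eIJ 1 - eI 1 - eJ 1) * int (n + 1) - 2 * (eIJ 2 - eI 2 - eJ 2) +
          2 * (e * int (n + 1) * int (n + 1) + \<kappa>)"
        by (simp add: algebra_simps)
      then show ?thesis unfolding int_choose_two u_def v_def w_def by (simp add: algebra_simps)
    qed
    have "w = 0"
      using q[of M] q[of "M + 1"] q[of "M + 2"]
      by (intro quadratic_constant_zero[of u "int (M + 1)" v w]) (simp_all add: algebra_simps)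
    then show ?thesis by (simp add: w_def)
  qed
  obtain G where G: "\<forall>s\<ge>G. l r s - l 0 s = e * int r * int s + g r" using g by blast
  obtain H where H: "\<forall>r\<ge>H. l r s - l r 0 = e * int r * int s + h s" using h by blast
  show ?thesis
  proof (intro exI allI impI)
    fix k assume k: "k \<ge> N + H0 + G0 + G + H"
    have "l r (s + k) = l 0 (s + k) + e * int r * int (s + k) + g r"
      using G[rule_format, of "s + k"] k by simp
    moreover have "l (r + k) s = l (r + k) 0 + e * int (r + k) * int s + h s"
      using H[rule_format, of "r + k"] k by simp
    moreover have "l (r + k) (s + k) = l (r + k) 0 + l 0 (s + k) + e * int (r + k) * int (s + k) + \<kappa>"
      by (rule split) (use k in auto)
    ultimately show "int k * int k * c + l r (s + k) + l (r + k) s - l r s - l (r + k) (s + k) =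
        (eI 2 + eJ 2 - eIJ 2) + g r + h s + int r * int s * e - l r s"
      unfolding \<kappa> ce by (simp add: algebra_simps)
  qed
qed

section \<open>Localization at monomials\<close>

lemma (in abelian_group) diff_eq_zero_iff:
  assumes "x \<in> carrier G" "y \<in> carrier G"
  shows "x \<ominus> y = \<zero> \<longleftrightarrow> x = y"
proof
  assume "x \<ominus> y = \<zero>"
  then have "\<ominus> (\<ominus> y) = x" using assms by (intro minus_equality) (simp_all add: a_minus_def)
  then show "x = y" using assms by simp
qed (use assms in \<open>simp add: a_minus_def r_neg\<close>)

lemma UN_pair_const:
  assumes "p \<in> F" and "\<And>x y. (x, y) \<in> F \<Longrightarrow> P x y = C"
  shows "(\<Union>(x, y)\<in>F. P x y) = C"
proof -
  have "(\<Union>(x, y)\<in>F. P x y) = (\<Union>p\<in>F. C)"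
  proof (rule SUP_cong[OF refl])
    fix p assume "p \<in> F"
    then show "(case p of (x, y) \<Rightarrow> P x y) = C" using assms(2) by (cases p) simp
  qed
  then show ?thesis using assms(1) by auto
qed

text \<open>Localization at \<open>S\<close> only involves the action of \<open>S\<close> on the additive group of \<open>A\<close>, so it is not
  necessary to know that the extended Rees ring is a ring.\<close>

locale regular_mult = abelian_group A for A (structure) +
  fixes S
  assumes one_S: "\<one> \<in> S"
    and S_closed: "s \<in> S \<Longrightarrow> t \<in> S \<Longrightarrow> s \<otimes> t \<in> S"
    and S_comm: "s \<in> S \<Longrightarrow> t \<in> S \<Longrightarrow> s \<otimes> t = t \<otimes> s"
    and act_closed [simp]: "s \<in> S \<Longrightarrow> f \<in> carrier A \<Longrightarrow> s \<otimes> f \<in> carrier A"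
    and act_add: "s \<in> S \<Longrightarrow> f \<in> carrier A \<Longrightarrow> g \<in> carrier A \<Longrightarrow> s \<otimes> (f \<oplus> g) = s \<otimes> f \<oplus> s \<otimes> g"
    and act_assoc: "s \<in> S \<Longrightarrow> t \<in> S \<Longrightarrow> f \<in> carrier A \<Longrightarrow> s \<otimes> t \<otimes> f = s \<otimes> (t \<otimes> f)"
    and one_act: "f \<in> carrier A \<Longrightarrow> \<one> \<otimes> f = f"
    and act_cancel: "s \<in> S \<Longrightarrow> f \<in> carrier A \<Longrightarrow> g \<in> carrier A \<Longrightarrow> s \<otimes> f = s \<otimes> g \<Longrightarrow> f = g"
begin

lemma act_lcomm:
  assumes "s \<in> S" "t \<in> S" "f \<in> carrier A"
  shows "s \<otimes> (t \<otimes> f) = t \<otimes> (s \<otimes> f)"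
  using assms act_assoc[of s t f] act_assoc[of t s f] S_comm[of s t] by simp

lemma act_zero:
  assumes "s \<in> S"
  shows "s \<otimes> \<zero> = \<zero>"
proof -
  have "s \<otimes> \<zero> \<oplus> s \<otimes> \<zero> = s \<otimes> \<zero>" using act_add[of s \<zero> \<zero>] assms by simp
  then show ?thesis using add.l_cancel_one'[of "s \<otimes> \<zero>" "s \<otimes> \<zero>"] assms by simp
qed

lemma frac_eq:
  assumes "f \<in> carrier A" "s \<in> S"
  shows "frac A S f s = {(g, t). g \<in> carrier A \<and> t \<in> S \<and> t \<otimes> f = s \<otimes> g}"
proof -
  have "(\<exists>u\<in>S. u \<otimes> (t \<otimes> f \<ominus> s \<otimes> g) = \<zero>) \<longleftrightarrow> t \<otimes> f = s \<otimes> g" if "g \<in> carrier A" "t \<in> S" for g t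
  proof
    assume "\<exists>u\<in>S. u \<otimes> (t \<otimes> f \<ominus> s \<otimes> g) = \<zero>"
    then obtain u where u: "u \<in> S" "u \<otimes> (t \<otimes> f \<ominus> s \<otimes> g) = \<zero>" by blast
    have "t \<otimes> f \<ominus> s \<otimes> g = \<zero>"
      by (rule act_cancel[OF u(1)]) (use u that assms act_zero in auto)
    then show "t \<otimes> f = s \<otimes> g" using that assms by (simp add: diff_eq_zero_iff)
  next
    assume "t \<otimes> f = s \<otimes> g"
    then have "t \<otimes> f \<ominus> s \<otimes> g = \<zero>" using that assms by (simp add: diff_eq_zero_iff)
    then show "\<exists>u\<in>S. u \<otimes> (t \<otimes> f \<ominus> s \<otimes> g) = \<zero>" using one_S act_zero by auto
  qed
  then show ?thesis unfolding frac_def by auto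
qed

lemma frac_self: "f \<in> carrier A \<Longrightarrow> s \<in> S \<Longrightarrow> (f, s) \<in> frac A S f s"
  by (simp add: frac_eq)

lemma frac_eq_iff:
  assumes "f \<in> carrier A" "s \<in> S" "g \<in> carrier A" "t \<in> S"
  shows "frac A S f s = frac A S g t \<longleftrightarrow> t \<otimes> f = s \<otimes> g"
proof
  assume "frac A S f s = frac A S g t"
  then have "(g, t) \<in> frac A S f s" using frac_self assms by simp
  then show "t \<otimes> f = s \<otimes> g" using assms by (simp add: frac_eq)
next
  have *: "u \<otimes> g = t \<otimes> h"
    if "t \<otimes> f = s \<otimes> g" "u \<otimes> f = s \<otimes> h" "f \<in> carrier A" "s \<in> S" "g \<in> carrier A" "t \<in> S"
      "h \<in> carrier A" "u \<in> S" for f g h s t u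
  proof (rule act_cancel[OF that(4)])
    have "s \<otimes> (u \<otimes> g) = u \<otimes> (t \<otimes> f)" unfolding that(1) by (rule act_lcomm[OF that(4,8,5)])
    also have "\<dots> = t \<otimes> (s \<otimes> h)" unfolding that(2)[symmetric] by (rule act_lcomm[OF that(8,6,3)])
    also have "\<dots> = s \<otimes> (t \<otimes> h)" by (rule act_lcomm[OF that(6,4,7)])
    finally show "s \<otimes> (u \<otimes> g) = s \<otimes> (t \<otimes> h)" .
  qed (use that in auto)
  assume eq: "t \<otimes> f = s \<otimes> g"
  have "u \<otimes> f = s \<otimes> h \<longleftrightarrow> u \<otimes> g = t \<otimes> h" if "h \<in> carrier A" "u \<in> S" for h u
    using *[OF eq] *[OF eq[symmetric]] that assms by blast
  then show "frac A S f s = frac A S g t" using assms by (auto simp: frac_eq)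
qed

lemma carrier_localization: "carrier (localization A S) = {frac A S f s | f s. f \<in> carrier A \<and> s \<in> S}"
  by (simp add: localization_def)

lemma frac_closed: "f \<in> carrier A \<Longrightarrow> s \<in> S \<Longrightarrow> frac A S f s \<in> carrier (localization A S)"
  unfolding carrier_localization by blast

lemma localization_add:
  assumes "f \<in> carrier A" "s \<in> S" "g \<in> carrier A" "t \<in> S"
  shows "frac A S f s \<oplus>\<^bsub>localization A S\<^esub> frac A S g t = frac A S (t \<otimes> f \<oplus> s \<otimes> g) (s \<otimes> t)"
proof -
  have *: "frac A S (t' \<otimes> f' \<oplus> s' \<otimes> g') (s' \<otimes> t') = frac A S (t \<otimes> f \<oplus> s \<otimes> g) (s \<otimes> t)"
    if "(f', s') \<in> frac A S f s" "(g', t') \<in> frac A S g t" for f' s' g' t'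
  proof -
    have c: "f' \<in> carrier A" "s' \<in> S" "g' \<in> carrier A" "t' \<in> S" and
      eq: "s' \<otimes> f = s \<otimes> f'" "t' \<otimes> g = t \<otimes> g'"
      using that assms by (auto simp: frac_eq)
    have "(s \<otimes> t) \<otimes> (t' \<otimes> f' \<oplus> s' \<otimes> g') = t \<otimes> (t' \<otimes> (s \<otimes> f')) \<oplus> s \<otimes> (s' \<otimes> (t \<otimes> g'))"
      using c assms act_lcomm[of s t "t' \<otimes> f'"] act_lcomm[of s t' f'] act_lcomm[of t s' g']
      by (simp add: act_assoc act_add)
    also have "\<dots> = t \<otimes> (t' \<otimes> (s' \<otimes> f)) \<oplus> s \<otimes> (s' \<otimes> (t' \<otimes> g))" by (simp only: eq)
    also have "\<dots> = (s' \<otimes> t') \<otimes> (t \<otimes> f \<oplus> s \<otimes> g)"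
      using c assms act_lcomm[of t t' "s' \<otimes> f"] act_lcomm[of t s' f] act_lcomm[of t' s' "t \<otimes> f"]
        act_lcomm[of s s' "t' \<otimes> g"] act_lcomm[of s t' g]
      by (simp add: act_assoc act_add)
    finally show ?thesis
      using c assms by (subst frac_eq_iff) (auto simp: S_closed)
  qed
  have "(\<Union>(f', s')\<in>frac A S f s. \<Union>(g', t')\<in>frac A S g t. frac A S (t' \<otimes> f' \<oplus> s' \<otimes> g') (s' \<otimes> t')) =
      frac A S (t \<otimes> f \<oplus> s \<otimes> g) (s \<otimes> t)"
    by (rule UN_pair_const[OF frac_self[OF assms(1,2)] UN_pair_const[OF frac_self[OF assms(3,4)] *]])
  then show ?thesis by (simp add: localization_def)
qed

lemma localization_zero: "\<zero>\<^bsub>localization A S\<^esub> = frac A S \<zero> \<one>"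
  by (simp add: localization_def)

lemma frac_zero: "s \<in> S \<Longrightarrow> frac A S \<zero> s = \<zero>\<^bsub>localization A S\<^esub>"
  unfolding localization_zero using one_S act_zero by (simp add: frac_eq_iff)

lemma frac_expand:
  assumes "f \<in> carrier A" "s \<in> S" "t \<in> S"
  shows "frac A S (t \<otimes> f) (t \<otimes> s) = frac A S f s"
  using assms act_lcomm[of s t f] by (simp add: frac_eq_iff S_closed act_assoc)

lemma localization_add_same:
  assumes "f \<in> carrier A" "s \<in> S" "g \<in> carrier A"
  shows "frac A S f s \<oplus>\<^bsub>localization A S\<^esub> frac A S g s = frac A S (f \<oplus> g) s"
  using assms frac_expand[of "f \<oplus> g" s s] by (simp add: localization_add act_add)

lemma localization_smult:
  assumes "f \<in> carrier A" "s \<in> S"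
    and c: "\<And>g. g \<in> carrier A \<Longrightarrow> c \<otimes> g \<in> carrier A"
      "\<And>g t. g \<in> carrier A \<Longrightarrow> t \<in> S \<Longrightarrow> c \<otimes> (t \<otimes> g) = t \<otimes> (c \<otimes> g)"
  shows "c \<odot>\<^bsub>localization A S\<^esub> frac A S f s = frac A S (c \<otimes> f) s"
proof -
  have *: "frac A S (c \<otimes> f') s' = frac A S (c \<otimes> f) s" if "(f', s') \<in> frac A S f s" for f' s'
  proof -
    have f': "f' \<in> carrier A" "s' \<in> S" "s' \<otimes> f = s \<otimes> f'" using that assms by (auto simp: frac_eq)
    have "s \<otimes> (c \<otimes> f') = c \<otimes> (s \<otimes> f')" using c(2) f' assms by simp
    also have "\<dots> = s' \<otimes> (c \<otimes> f)" using c(2) f' assms by (simp flip: f'(3))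
    finally show ?thesis using f' c(1) assms by (subst frac_eq_iff) auto
  qed
  have "(\<Union>(f', s')\<in>frac A S f s. frac A S (c \<otimes> f') s') = frac A S (c \<otimes> f) s"
    by (rule UN_pair_const[OF frac_self[OF assms(1,2)] *])
  then show ?thesis by (simp add: localization_def)
qed

lemma abelian_group_localization: "abelian_group (localization A S)"
proof (rule abelian_groupI)
  let ?L = "localization A S"
  show "\<zero>\<^bsub>?L\<^esub> \<in> carrier ?L" unfolding localization_zero by (intro frac_closed zero_closed one_S)
  fix x assume "x \<in> carrier ?L"
  then obtain f s where x: "x = frac A S f s" "f \<in> carrier A" "s \<in> S"
    unfolding carrier_localization by blast
  show "\<zero>\<^bsub>?L\<^esub> \<oplus>\<^bsub>?L\<^esub> x = x"
    using localization_add_same[of \<zero> s f] x by (simp add: frac_zero)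
  show "\<exists>y\<in>carrier ?L. y \<oplus>\<^bsub>?L\<^esub> x = \<zero>\<^bsub>?L\<^esub>"
    using localization_add_same[of "\<ominus> f" s f] x frac_closed[of "\<ominus> f" s]
    by (intro bexI[of _ "frac A S (\<ominus> f) s"]) (simp_all add: frac_zero l_neg)
  fix y assume "y \<in> carrier ?L"
  then obtain g t where y: "y = frac A S g t" "g \<in> carrier A" "t \<in> S"
    unfolding carrier_localization by blast
  show "x \<oplus>\<^bsub>?L\<^esub> y \<in> carrier ?L"
    using x y by (simp add: localization_add frac_closed S_closed)
  show "x \<oplus>\<^bsub>?L\<^esub> y = y \<oplus>\<^bsub>?L\<^esub> x"
    using x y S_comm[of s t] by (simp add: localization_add a_comm)
  fix z assume "z \<in> carrier ?L"
  then obtain h u where z: "z = frac A S h u" "h \<in> carrier A" "u \<in> S"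
    unfolding carrier_localization by blast
  have st: "s \<otimes> t \<in> S" "t \<otimes> u \<in> S" "s \<otimes> t \<otimes> u \<in> S" using x y z by (auto intro: S_closed)
  define v where "v = s \<otimes> t \<otimes> u"
  have v: "v \<in> S" using st(3) by (simp add: v_def)
  have xv: "x = frac A S (t \<otimes> (u \<otimes> f)) v" "y = frac A S (s \<otimes> (u \<otimes> g)) v" "z = frac A S (s \<otimes> (t \<otimes> h)) v"
    unfolding x(1) y(1) z(1) v_def
    using x y z st act_lcomm[of s t "u \<otimes> f"] act_lcomm[of s u f]
      act_lcomm[of t s "u \<otimes> g"] act_lcomm[of t u g] act_lcomm[of u s "t \<otimes> h"] act_lcomm[of u t h]
    by (simp_all add: frac_eq_iff act_assoc)
  have c: "t \<otimes> (u \<otimes> f) \<in> carrier A" "s \<otimes> (u \<otimes> g) \<in> carrier A" "s \<otimes> (t \<otimes> h) \<in> carrier A"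
    using x y z by auto
  show "(x \<oplus>\<^bsub>?L\<^esub> y) \<oplus>\<^bsub>?L\<^esub> z = x \<oplus>\<^bsub>?L\<^esub> (y \<oplus>\<^bsub>?L\<^esub> z)"
    unfolding xv using c v by (simp add: localization_add_same a_assoc)
qed

lemma localization_neg:
  assumes "f \<in> carrier A" "s \<in> S"
  shows "\<ominus>\<^bsub>localization A S\<^esub> frac A S f s = frac A S (\<ominus> f) s"
proof -
  interpret L: abelian_group "localization A S" by (rule abelian_group_localization)
  have "frac A S (\<ominus> f) s \<oplus>\<^bsub>localization A S\<^esub> frac A S f s = \<zero>\<^bsub>localization A S\<^esub>"
    using localization_add_same[of "\<ominus> f" s f] assms by (simp add: frac_zero l_neg)
  then show ?thesis using assms frac_closed by (intro L.minus_equality) auto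
qed

lemma loc_map_frac:
  assumes sub: "T \<subseteq> S" and one: "\<one> \<in> T" and f: "f \<in> carrier A" "s \<in> T"
    and closed: "\<And>s t. s \<in> T \<Longrightarrow> t \<in> T \<Longrightarrow> s \<otimes> t \<in> T"
  shows "loc_map A S (frac A T f s) = frac A S f s"
proof -
  interpret T: regular_mult A T
    using sub one closed by unfold_locales
      (auto simp: S_comm act_add act_assoc one_act subset_iff intro: act_cancel)
  have *: "frac A S f' s' = frac A S f s" if "(f', s') \<in> frac A T f s" for f' s'
    using that f sub by (subst frac_eq_iff) (auto simp: T.frac_eq)
  show ?thesis
    unfolding loc_map_def by (rule UN_pair_const[OF T.frac_self[OF f] *])
qed

end

section \<open>The Cech complex of the extended Rees ring\<close>

lemma foldD_singleton:
  assumes "e \<in> D" "f x e \<in> D"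
  shows "foldD D f e {x} = f x e"
  unfolding foldD_def
proof (rule the_equality)
  show "({x}, f x e) \<in> foldSetD D f e" using assms by (intro foldSetD.insertI foldSetD.emptyI) auto
  fix z assume "({x}, z) \<in> foldSetD D f e"
  then show "z = f x e"
  proof (cases rule: foldSetD.cases)
    case (insertI x' A y)
    then have "x' = x" "A = {}" by auto
    then show ?thesis using insertI by (auto elim: empty_foldSetDE)
  qed simp
qed

lemma foldD_pair:
  assumes "x \<noteq> y" "e \<in> D" "f x e \<in> D" "f y e \<in> D" "f x (f y e) \<in> D" "f y (f x e) = f x (f y e)"
  shows "foldD D f e {x, y} = f x (f y e)"
  unfolding foldD_def
proof (rule the_equality)
  have single: "z = f u e" if "({u}, z) \<in> foldSetD D f e" for u z
    using that
  proof (cases rule: foldSetD.cases)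
    case (insertI x' A y)
    then have "x' = u" "A = {}" by auto
    then show ?thesis using insertI by (auto elim: empty_foldSetDE)
  qed simp
  show "({x, y}, f x (f y e)) \<in> foldSetD D f e"
    using assms by (intro foldSetD.insertI foldSetD.emptyI) auto
  fix z assume "({x, y}, z) \<in> foldSetD D f e"
  then show "z = f x (f y e)"
  proof (cases rule: foldSetD.cases)
    case (insertI u A v)
    have eq: "{x, y} = insert u A" and "u \<notin> A" by (fact insertI)+
    have "u \<in> {x, y}" unfolding eq by (rule insertI1)
    moreover have "A = {x, y} - {u}" unfolding eq using \<open>u \<notin> A\<close> by simp
    ultimately have "(u = x \<and> A = {y}) \<or> (u = y \<and> A = {x})" using assms(1) by auto
    then show ?thesis
    proof
      assume u: "u = x \<and> A = {y}"
      then have "({y}, v) \<in> foldSetD D f e" using insertI(5) by (elim conjE) (simp only:)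
      then have "v = f y e" by (rule single)
      then show ?thesis using insertI(2) u by simp
    next
      assume u: "u = y \<and> A = {x}"
      then have "({x}, v) \<in> foldSetD D f e" using insertI(5) by (elim conjE) (simp only:)
      then have "v = f x e" by (rule single)
      then show ?thesis using insertI(2) u assms(6) by simp
    qed
  qed simp
qed

context joint_filtration
begin

abbreviation Rees where "Rees \<equiv> ext_rees R F"

definition mon :: "nat \<Rightarrow> nat \<Rightarrow> int \<times> int \<Rightarrow> 'a" where
  "mon i j = laurent_monom R (a [^] i \<otimes> b [^] j) (int i, int j)"

definition mons :: "(int \<times> int \<Rightarrow> 'a) set" where
  "mons = {mon i j | i j. True}"

definition gens :: "(int \<times> int \<Rightarrow> 'a) list" where
  "gens = [laurent_monom R a (1, 0), laurent_monom R b (0, 1)]"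

lemma Rees_carrier: "f \<in> carrier Rees \<longleftrightarrow> finite {p. f p \<noteq> \<zero>} \<and> (\<forall>r s. f (r, s) \<in> F r s)"
  by (simp add: ext_rees_def)

lemma Rees_add: "f \<oplus>\<^bsub>Rees\<^esub> g = (\<lambda>p. f p \<oplus> g p)"
  by (simp add: ext_rees_def)

lemma Rees_zero: "\<zero>\<^bsub>Rees\<^esub> = (\<lambda>p. \<zero>)"
  by (simp add: ext_rees_def)

lemma Rees_mem: "f \<in> carrier Rees \<Longrightarrow> f (r, s) \<in> F r s"
  by (simp add: Rees_carrier)

lemma Rees_val: "f \<in> carrier Rees \<Longrightarrow> f p \<in> carrier R"
  using Rees_mem[of f "fst p" "snd p"] F_carrier by simp

lemma zero_F: "\<zero> \<in> F r s"
  using additive_subgroup.zero_closed[OF ideal.axioms(1)[OF ideal_F]] .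

lemma abelian_group_Rees: "abelian_group Rees"
proof (rule abelian_groupI)
  fix f g h assume f: "f \<in> carrier Rees" and g: "g \<in> carrier Rees" and h: "h \<in> carrier Rees"
  have "{p. f p \<oplus> g p \<noteq> \<zero>} \<subseteq> {p. f p \<noteq> \<zero>} \<union> {p. g p \<noteq> \<zero>}" by auto
  then have "finite {p. f p \<oplus> g p \<noteq> \<zero>}"
    using f g by (auto simp: Rees_carrier intro: finite_subset)
  moreover have "f (r, s) \<oplus> g (r, s) \<in> F r s" for r s
    using additive_subgroup.a_closed[OF ideal.axioms(1)[OF ideal_F]] Rees_mem f g by simp
  ultimately show "f \<oplus>\<^bsub>Rees\<^esub> g \<in> carrier Rees" by (simp add: Rees_carrier Rees_add)
  show "f \<oplus>\<^bsub>Rees\<^esub> g \<oplus>\<^bsub>Rees\<^esub> h = f \<oplus>\<^bsub>Rees\<^esub> (g \<oplus>\<^bsub>Rees\<^esub> h)"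
    using Rees_val f g h by (simp add: Rees_add a_assoc)
  show "f \<oplus>\<^bsub>Rees\<^esub> g = g \<oplus>\<^bsub>Rees\<^esub> f"
    using Rees_val f g by (simp add: Rees_add a_comm)
next
  show "\<zero>\<^bsub>Rees\<^esub> \<in> carrier Rees" by (simp add: Rees_carrier Rees_zero zero_F)
next
  fix f assume f: "f \<in> carrier Rees"
  show "\<zero>\<^bsub>Rees\<^esub> \<oplus>\<^bsub>Rees\<^esub> f = f" using Rees_val f by (simp add: Rees_add Rees_zero)
  have "{p. \<ominus> f p \<noteq> \<zero>} \<subseteq> {p. f p \<noteq> \<zero>}" by auto
  then have "finite {p. \<ominus> f p \<noteq> \<zero>}" using f by (auto simp: Rees_carrier intro: finite_subset)
  moreover have "\<ominus> f (r, s) \<in> F r s" for r s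
    using additive_subgroup.a_inv_closed[OF ideal.axioms(1)[OF ideal_F]] Rees_mem f by simp
  ultimately have "(\<lambda>p. \<ominus> f p) \<in> carrier Rees" by (simp add: Rees_carrier)
  moreover have "(\<lambda>p. \<ominus> f p) \<oplus>\<^bsub>Rees\<^esub> f = \<zero>\<^bsub>Rees\<^esub>"
    using Rees_val f by (simp add: Rees_add Rees_zero l_neg)
  ultimately show "\<exists>g\<in>carrier Rees. g \<oplus>\<^bsub>Rees\<^esub> f = \<zero>\<^bsub>Rees\<^esub>" by blast
qed

lemma laurent_mult:
  assumes "c \<in> carrier R" "\<And>p. f p \<in> carrier R"
  shows "laurent_monom R c d \<otimes>\<^bsub>Rees\<^esub> f = (\<lambda>p. c \<otimes> f (p - d))"
proof
  fix p
  let ?g = "\<lambda>q. laurent_monom R c d q \<otimes> f (p - q)"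
  have eq: "(laurent_monom R c d \<otimes>\<^bsub>Rees\<^esub> f) p = (\<Oplus>q\<in>{q. laurent_monom R c d q \<noteq> \<zero>}. ?g q)"
    by (simp add: ext_rees_def)
  show "(laurent_monom R c d \<otimes>\<^bsub>Rees\<^esub> f) p = c \<otimes> f (p - d)"
  proof (cases "c = \<zero>")
    case True
    then have "{q. laurent_monom R c d q \<noteq> \<zero>} = {}" by (auto simp: laurent_monom_def)
    then have "(laurent_monom R c d \<otimes>\<^bsub>Rees\<^esub> f) p = (\<Oplus>q\<in>{}. ?g q)" unfolding eq by (rule arg_cong)
    then show ?thesis using True assms by simp
  next
    case False
    then have "{q. laurent_monom R c d q \<noteq> \<zero>} = {d}" by (auto simp: laurent_monom_def)
    then have "(laurent_monom R c d \<otimes>\<^bsub>Rees\<^esub> f) p = (\<Oplus>q\<in>{d}. ?g q)" unfolding eq by (rule arg_cong)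
    also have "\<dots> = ?g d \<oplus> (\<Oplus>q\<in>{}. ?g q)"
      using assms by (intro finsum_insert) (auto simp: laurent_monom_def)
    finally show ?thesis using assms by (simp add: laurent_monom_def)
  qed
qed

lemma laurent_carrier:
  assumes "f \<in> F r s"
  shows "laurent_monom R f (r, s) \<in> carrier Rees"
proof -
  have "finite {p. laurent_monom R f (r, s) p \<noteq> \<zero>}"
    by (rule finite_subset[of _ "{(r, s)}"]) (auto simp: laurent_monom_def)
  then show ?thesis using assms zero_F by (auto simp: Rees_carrier laurent_monom_def)
qed

lemma ab_pow_F:
  assumes "f \<in> F r s"
  shows "a [^] i \<otimes> b [^] j \<otimes> f \<in> F (r + int i) (s + int j)"
proof -
  have "b [^] j \<otimes> f \<in> F r (s + int j)"
  proof (induction j)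
    case 0
    then show ?case using assms F_carrier by simp
  next
    case (Suc j)
    have "b [^] Suc j \<otimes> f = b \<otimes> (b [^] j \<otimes> f)" using assms F_carrier by (simp add: m_ac)
    then show ?case using b_mult_F[OF Suc] by (simp add: algebra_simps)
  qed
  then have *: "a [^] i \<otimes> (b [^] j \<otimes> f) \<in> F (r + int i) (s + int j)"
  proof (induction i)
    case 0
    then show ?case using F_carrier by simp
  next
    case (Suc i)
    have "a [^] Suc i \<otimes> (b [^] j \<otimes> f) = a \<otimes> (a [^] i \<otimes> (b [^] j \<otimes> f))"
      using assms F_carrier by (simp add: m_ac)
    then show ?case using a_mult_F[OF Suc.IH[OF Suc.prems]] by (simp add: algebra_simps)
  qed
  then show ?thesis using assms F_carrier by (simp add: m_assoc)
qed

lemma mon_coeff: "a [^] (i::nat) \<otimes> b [^] (j::nat) \<in> carrier R"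
  by simp

lemma mon_mult_apply:
  assumes "f \<in> carrier Rees"
  shows "mon i j \<otimes>\<^bsub>Rees\<^esub> f = (\<lambda>p. a [^] i \<otimes> b [^] j \<otimes> f (p - (int i, int j)))"
  unfolding mon_def by (rule laurent_mult[OF mon_coeff]) (rule Rees_val[OF assms])

lemma mon_carrier: "mon i j \<in> carrier Rees"
proof -
  have "a [^] i \<otimes> b [^] j \<otimes> \<one> \<in> F (0 + int i) (0 + int j)"
    by (rule ab_pow_F) (simp add: F_nonpos)
  then show ?thesis unfolding mon_def by (intro laurent_carrier) simp
qed

lemma mon_mon: "mon i j \<otimes>\<^bsub>Rees\<^esub> mon k l = mon (i + k) (j + l)"
proof
  fix p
  have "a [^] i \<otimes> b [^] j \<otimes> (a [^] k \<otimes> b [^] l) = (a [^] i \<otimes> a [^] k) \<otimes> (b [^] j \<otimes> b [^] l)"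
    by (simp add: m_ac)
  then have *: "a [^] i \<otimes> b [^] j \<otimes> (a [^] k \<otimes> b [^] l) = a [^] (i + k) \<otimes> b [^] (j + l)"
    by (simp add: nat_pow_mult)
  have "p - (int i, int j) = (int k, int l) \<longleftrightarrow> p = (int (i + k), int (j + l))"
    by (cases p) auto
  then show "(mon i j \<otimes>\<^bsub>Rees\<^esub> mon k l) p = mon (i + k) (j + l) p"
    unfolding mon_mult_apply[OF mon_carrier] using * by (auto simp: mon_def laurent_monom_def)
qed

lemma Rees_one: "\<one>\<^bsub>Rees\<^esub> = mon 0 0"
  by (simp add: ext_rees_def mon_def)

lemma mon_closed:
  assumes f: "f \<in> carrier Rees"
  shows "mon i j \<otimes>\<^bsub>Rees\<^esub> f \<in> carrier Rees"
proof -
  have "{p. a [^] i \<otimes> b [^] j \<otimes> f (p - (int i, int j)) \<noteq> \<zero>} \<subseteq>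
      (\<lambda>q. q + (int i, int j)) ` {q. f q \<noteq> \<zero>}"
  proof
    fix p assume "p \<in> {p. a [^] i \<otimes> b [^] j \<otimes> f (p - (int i, int j)) \<noteq> \<zero>}"
    then have "f (p - (int i, int j)) \<noteq> \<zero>" by auto
    then show "p \<in> (\<lambda>q. q + (int i, int j)) ` {q. f q \<noteq> \<zero>}"
      by (intro image_eqI[of _ _ "p - (int i, int j)"]) auto
  qed
  moreover have "finite {q. f q \<noteq> \<zero>}" using f by (simp add: Rees_carrier)
  ultimately have "finite {p. a [^] i \<otimes> b [^] j \<otimes> f (p - (int i, int j)) \<noteq> \<zero>}"
    by (meson finite_imageI finite_subset)
  moreover have "a [^] i \<otimes> b [^] j \<otimes> f ((r, s) - (int i, int j)) \<in> F r s" for r s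
    using ab_pow_F[OF Rees_mem[OF f, of "r - int i" "s - int j"], of i j] by simp
  ultimately show ?thesis unfolding mon_mult_apply[OF f] Rees_carrier by simp
qed

lemma nonzerodivisor_ab_pow: "nonzerodivisor R (a [^] (i::nat) \<otimes> b [^] (j::nat))"
  by (intro nonzerodivisor_mult nonzerodivisor_pow nzd_a nzd_b)

lemma mon_in_mons: "mon i j \<in> mons"
  by (auto simp: mons_def)

lemma regular_mult_Rees: "regular_mult Rees mons"
proof (intro regular_mult.intro[OF abelian_group_Rees] regular_mult_axioms.intro)
  show "\<one>\<^bsub>Rees\<^esub> \<in> mons" by (simp add: Rees_one mon_in_mons)
  fix s t assume "s \<in> mons" "t \<in> mons"
  then obtain i j k l where st: "s = mon i j" "t = mon k l" unfolding mons_def by blast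
  show "s \<otimes>\<^bsub>Rees\<^esub> t \<in> mons" unfolding st mon_mon by (rule mon_in_mons)
  show "s \<otimes>\<^bsub>Rees\<^esub> t = t \<otimes>\<^bsub>Rees\<^esub> s" unfolding st mon_mon by (simp add: add.commute)
next
  fix s t f assume "s \<in> mons" "t \<in> mons" and f: "f \<in> carrier Rees"
  then obtain i j k l where st: "s = mon i j" "t = mon k l" unfolding mons_def by blast
  have *: "a [^] (i + k) \<otimes> b [^] (j + l) \<otimes> x = a [^] i \<otimes> b [^] j \<otimes> (a [^] k \<otimes> b [^] l \<otimes> x)"
    if "x \<in> carrier R" for x
    using that by (simp add: nat_pow_mult[symmetric] m_ac)
  have pe: "p - (int i, int j) - (int k, int l) = p - (int (i + k), int (j + l))" for p
    by (cases p) simp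
  show "s \<otimes>\<^bsub>Rees\<^esub> t \<otimes>\<^bsub>Rees\<^esub> f = s \<otimes>\<^bsub>Rees\<^esub> (t \<otimes>\<^bsub>Rees\<^esub> f)"
    unfolding st mon_mon mon_mult_apply[OF f] mon_mult_apply[OF mon_closed[OF f], unfolded mon_mult_apply[OF f]]
    by (simp only: pe *[OF Rees_val[OF f]])
next
  fix s f assume "s \<in> mons" and f: "f \<in> carrier Rees"
  then obtain i j where s: "s = mon i j" unfolding mons_def by blast
  show "s \<otimes>\<^bsub>Rees\<^esub> f \<in> carrier Rees" unfolding s by (rule mon_closed[OF f])
next
  fix s f g assume "s \<in> mons" and f: "f \<in> carrier Rees" and g: "g \<in> carrier Rees"
  then obtain i j where s: "s = mon i j" unfolding mons_def by blast
  interpret A: abelian_group Rees by (rule abelian_group_Rees)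
  have fg: "f \<oplus>\<^bsub>Rees\<^esub> g \<in> carrier Rees" using f g by simp
  show "s \<otimes>\<^bsub>Rees\<^esub> (f \<oplus>\<^bsub>Rees\<^esub> g) = s \<otimes>\<^bsub>Rees\<^esub> f \<oplus>\<^bsub>Rees\<^esub> s \<otimes>\<^bsub>Rees\<^esub> g"
    unfolding s mon_mult_apply[OF f] mon_mult_apply[OF g] mon_mult_apply[OF fg]
    unfolding Rees_add using Rees_val[OF f] Rees_val[OF g] by (simp add: r_distr)
  assume eq: "s \<otimes>\<^bsub>Rees\<^esub> f = s \<otimes>\<^bsub>Rees\<^esub> g"
  show "f = g"
  proof
    fix p
    have "a [^] i \<otimes> b [^] j \<otimes> f p = a [^] i \<otimes> b [^] j \<otimes> g p"
      using fun_cong[OF eq, of "p + (int i, int j)"]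
      unfolding s mon_mult_apply[OF f] mon_mult_apply[OF g] by simp
    then show "f p = g p"
      by (rule nonzerodivisor_cancel[OF nonzerodivisor_ab_pow Rees_val[OF f] Rees_val[OF g]])
  qed
next
  fix f assume f: "f \<in> carrier Rees"
  have "p - (0, 0) = p" for p :: "int \<times> int" by (cases p) simp
  then show "\<one>\<^bsub>Rees\<^esub> \<otimes>\<^bsub>Rees\<^esub> f = f"
    unfolding Rees_one mon_mult_apply[OF f] using Rees_val[OF f] by simp
qed

lemma gens_pow: "(gens ! 0) [^]\<^bsub>Rees\<^esub> (n::nat) = mon n 0" "(gens ! 1) [^]\<^bsub>Rees\<^esub> (n::nat) = mon 0 n"
proof -
  have g: "gens ! 0 = mon 1 0" "gens ! 1 = mon 0 1" by (simp_all add: gens_def mon_def)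
  show "(gens ! 0) [^]\<^bsub>Rees\<^esub> (n::nat) = mon n 0"
    unfolding g by (induction n) (simp_all add: nat_pow_def Rees_one mon_mon)
  show "(gens ! 1) [^]\<^bsub>Rees\<^esub> (n::nat) = mon 0 n"
    unfolding g by (induction n) (simp_all add: nat_pow_def Rees_one mon_mon)
qed

lemma monomials_0: "monomials Rees gens {0} = {mon i 0 | i. True}"
proof -
  have "(\<Otimes>\<^bsub>Rees\<^esub>j\<in>{0}. (gens ! j) [^]\<^bsub>Rees\<^esub> (k j)) = mon (k 0) 0" for k :: "nat \<Rightarrow> nat"
    unfolding finprod_def using foldD_singleton[of "\<one>\<^bsub>Rees\<^esub>" "carrier Rees"
        "monoid.mult Rees \<circ> (\<lambda>j. (gens ! j) [^]\<^bsub>Rees\<^esub> (k j))" 0]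
    by (simp add: gens_pow[simplified] Rees_one mon_mon mon_carrier)
  moreover have "\<exists>k::nat \<Rightarrow> nat. mon i 0 = mon (k 0) 0" for i by (rule exI[of _ "\<lambda>_. i"]) simp
  ultimately show ?thesis unfolding monomials_def by auto
qed

lemma monomials_1: "monomials Rees gens {1} = {mon 0 j | j. True}"
proof -
  have "(\<Otimes>\<^bsub>Rees\<^esub>j\<in>{1}. (gens ! j) [^]\<^bsub>Rees\<^esub> (k j)) = mon 0 (k 1)" for k :: "nat \<Rightarrow> nat"
    unfolding finprod_def using foldD_singleton[of "\<one>\<^bsub>Rees\<^esub>" "carrier Rees"
        "monoid.mult Rees \<circ> (\<lambda>j. (gens ! j) [^]\<^bsub>Rees\<^esub> (k j))" 1]
    by (simp add: gens_pow[simplified] Rees_one mon_mon mon_carrier)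
  moreover have "\<exists>k::nat \<Rightarrow> nat. mon 0 i = mon 0 (k 1)" for i by (rule exI[of _ "\<lambda>_. i"]) simp
  ultimately show ?thesis unfolding monomials_def by auto
qed

lemma monomials_01: "monomials Rees gens {0, 1} = mons"
proof -
  have "(\<Otimes>\<^bsub>Rees\<^esub>j\<in>{0, 1}. (gens ! j) [^]\<^bsub>Rees\<^esub> (k j)) = mon (k 0) (k 1)" for k :: "nat \<Rightarrow> nat"
    unfolding finprod_def using foldD_pair[of 0 1 "\<one>\<^bsub>Rees\<^esub>" "carrier Rees"
        "monoid.mult Rees \<circ> (\<lambda>j. (gens ! j) [^]\<^bsub>Rees\<^esub> (k j))"]
    by (simp add: gens_pow[simplified] Rees_one mon_mon mon_carrier)
  moreover have "\<exists>k::nat \<Rightarrow> nat. mon i j = mon (k 0) (k 1)" for i j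
    by (rule exI[of _ "\<lambda>n. if n = 0 then i else j"]) simp
  ultimately show ?thesis unfolding monomials_def mons_def by auto
qed

end

context joint_filtration
begin

lemma mem_koszul_boundaries:
  "f \<in> koszul_boundaries r s k \<longleftrightarrow>
    (\<exists>u\<in>F r (s + int k). \<exists>v\<in>F (r + int k) s. f = a [^] k \<otimes> u \<oplus> b [^] k \<otimes> v)"
  unfolding koszul_boundaries_def mem_coset_add_coset ..

lemma koszul_boundaries_descend:
  assumes rs: "r \<ge> 0" "s \<ge> 0" and f: "f \<in> carrier R"
    and U: "U \<in> F r (s + int k + int n)" and V: "V \<in> F (r + int k + int n) s"
    and eq: "a [^] n \<otimes> b [^] n \<otimes> f = a [^] (k + n) \<otimes> U \<oplus> b [^] (k + n) \<otimes> V"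
  shows "f \<in> koszul_boundaries r s k"
proof -
  have UV: "U \<in> carrier R" "V \<in> carrier R" using U V F_carrier by auto
  define an bn ak bk where "an = a [^] n" and "bn = b [^] n" and "ak = a [^] k" and "bk = b [^] k"
  have c: "an \<in> carrier R" "bn \<in> carrier R" "ak \<in> carrier R" "bk \<in> carrier R"
    by (simp_all add: an_def bn_def ak_def bk_def)
  have p: "a [^] (k + n) = ak \<otimes> an" "b [^] (k + n) = bk \<otimes> bn"
    by (simp_all add: an_def bn_def ak_def bk_def nat_pow_mult)
  have e1: "an \<otimes> bn \<otimes> f = ak \<otimes> an \<otimes> U \<oplus> bk \<otimes> bn \<otimes> V"
    using eq unfolding p an_def[symmetric] bn_def[symmetric] .
  define d where "d = bn \<otimes> f \<ominus> ak \<otimes> U"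
  have dc: "d \<in> carrier R" using c f UV by (simp add: d_def)
  have "d \<otimes> an = an \<otimes> bn \<otimes> f \<ominus> ak \<otimes> an \<otimes> U" unfolding d_def using c f UV by algebra
  also have "\<dots> = V \<otimes> (bk \<otimes> bn)" unfolding e1 using c UV by algebra
  finally have "d \<otimes> a [^] n = V \<otimes> b [^] (k + n)" unfolding p an_def[symmetric] .
  then obtain w where w: "w \<in> carrier R" "d = w \<otimes> b [^] (k + n)" "V = w \<otimes> a [^] n"
    using trivial_syzygiesE[OF trivial_syzygies_pow[OF ab_carrier syz] dc UV(2)] by metis
  have "V = a [^] n \<otimes> w" using w(1,3) by (simp add: m_comm)
  then have wF: "w \<in> F (r + int k) s" using a_pow_F_iff[of "r + int k" w n s] V rs w(1) by simp
  have "(f \<ominus> bk \<otimes> w) \<otimes> bn = d \<ominus> w \<otimes> (bk \<otimes> bn) \<oplus> U \<otimes> ak"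
    unfolding d_def using c f UV w(1) by algebra
  also have "\<dots> = U \<otimes> ak" unfolding w(2) p using c UV w(1) by algebra
  finally have e2: "U \<otimes> a [^] k = (f \<ominus> bk \<otimes> w) \<otimes> b [^] n" unfolding ak_def bn_def by (rule sym)
  have fc: "f \<ominus> bk \<otimes> w \<in> carrier R" using c f w(1) by simp
  obtain t where t: "t \<in> carrier R" "U = t \<otimes> b [^] n" "f \<ominus> bk \<otimes> w = t \<otimes> a [^] k"
    using trivial_syzygiesE[OF trivial_syzygies_pow[OF ab_carrier syz] UV(1) fc e2] by metis
  have "U = b [^] n \<otimes> t" using t(1,2) by (simp add: m_comm)
  then have tF: "t \<in> F r (s + int k)" using b_pow_F_iff[of "s + int k" t n r] U rs t(1) by simp
  have "f = (f \<ominus> bk \<otimes> w) \<oplus> bk \<otimes> w" using c f w(1) by algebra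
  also have "\<dots> = a [^] k \<otimes> t \<oplus> b [^] k \<otimes> w" unfolding t(3) using t(1) by (simp add: bk_def m_comm)
  finally show ?thesis unfolding mem_koszul_boundaries using tF wF by blast
qed

lemma koszul_boundaries_mult:
  assumes "f \<in> koszul_boundaries r s k"
  shows "a [^] n \<otimes> b [^] n \<otimes> f \<in> koszul_boundaries r s (k + n)"
proof -
  obtain u v where uv: "u \<in> F r (s + int k)" "v \<in> F (r + int k) s" "f = a [^] k \<otimes> u \<oplus> b [^] k \<otimes> v"
    using assms unfolding mem_koszul_boundaries by blast
  have c: "u \<in> carrier R" "v \<in> carrier R" using uv F_carrier by auto
  have "a [^] n \<otimes> b [^] n \<otimes> f = a [^] (k + n) \<otimes> (b [^] n \<otimes> u) \<oplus> b [^] (k + n) \<otimes> (a [^] n \<otimes> v)"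
    unfolding uv(3) using c by (simp add: nat_pow_mult[symmetric] r_distr m_ac)
  moreover have "b [^] n \<otimes> u \<in> F r (s + int (k + n))"
    using ab_pow_F[OF uv(1), of 0 n] c by (simp add: add.assoc)
  moreover have "a [^] n \<otimes> v \<in> F (r + int (k + n)) s"
    using ab_pow_F[OF uv(2), of n 0] c by (simp add: add.assoc)
  ultimately show ?thesis unfolding mem_koszul_boundaries by blast
qed

lemma koszul_boundaries_mult_iff:
  assumes rs: "r \<ge> 0" "s \<ge> 0" and f: "f \<in> carrier R"
  shows "a [^] n \<otimes> b [^] n \<otimes> f \<in> koszul_boundaries r s (k + n) \<longleftrightarrow> f \<in> koszul_boundaries r s k"
proof
  assume "a [^] n \<otimes> b [^] n \<otimes> f \<in> koszul_boundaries r s (k + n)"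
  then obtain U V where "U \<in> F r (s + int (k + n))" "V \<in> F (r + int (k + n)) s"
    "a [^] n \<otimes> b [^] n \<otimes> f = a [^] (k + n) \<otimes> U \<oplus> b [^] (k + n) \<otimes> V"
    unfolding mem_koszul_boundaries by blast
  then show "f \<in> koszul_boundaries r s k"
    by (intro koszul_boundaries_descend[OF rs f]) (simp_all add: add.assoc)
qed (rule koszul_boundaries_mult)

text \<open>The transition maps of the direct system computing local cohomology are injective, so a
  constant length makes them bijective.\<close>

lemma koszul_stable:
  assumes rs: "r \<ge> 0" "s \<ge> 0"
    and len: "ideal_length R (koszul_boundaries r s k) (F (r + int k) (s + int k)) = l"
      "ideal_length R (koszul_boundaries r s (k + n)) (F (r + int (k + n)) (s + int (k + n))) = l" "l \<noteq> \<infinity>"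
    and f: "f \<in> F (r + int (k + n)) (s + int (k + n))"
  shows "\<exists>g\<in>F (r + int k) (s + int k). \<exists>d\<in>koszul_boundaries r s (k + n). f = a [^] n \<otimes> b [^] n \<otimes> g \<oplus> d"
proof -
  let ?c = "a [^] n \<otimes> b [^] n"
  let ?K = "koszul_boundaries r s (k + n)"
  let ?F = "F (r + int k) (s + int k)" and ?G = "F (r + int (k + n)) (s + int (k + n))"
  let ?P = "(?c <# ?F) <+>\<^bsub>R\<^esub> ?K"
  have cF: "ideal (?c <# ?F) R" by (intro ideal_l_coset ideal_F) simp
  have P: "ideal ?P R" by (intro add_ideals cF ideal_koszul_boundaries)
  have KP: "?K \<subseteq> ?P" by (rule subset_set_add(2)[OF cF ideal_koszul_boundaries])
  have "?c <# ?F \<subseteq> ?G"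
  proof
    fix x assume "x \<in> ?c <# ?F"
    then obtain g where "g \<in> ?F" "x = ?c \<otimes> g" unfolding mem_l_coset by blast
    then show "x \<in> ?G" using ab_pow_F[of g "r + int k" "s + int k" n n] by (simp add: add.assoc)
  qed
  then have PG: "?P \<subseteq> ?G"
    by (rule set_add_least[OF ideal_F]) (rule koszul_boundaries_subset[OF rs])
  have "ideal_length R ?K ?P = ideal_length R (koszul_boundaries r s k) ?F"
    by (rule ideal_length_mult[OF ideal_F ideal_koszul_boundaries _ ideal_koszul_boundaries
          koszul_boundaries_subset[OF rs]]) (use koszul_boundaries_mult_iff[OF rs] F_carrier in simp_all)
  then have "l = l + ideal_length R ?P ?G"
    using ideal_length_add[OF ideal_koszul_boundaries P ideal_F KP PG] len by simp
  then have "ideal_length R ?P ?G = 0" 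
  proof -
    obtain m where m: "l = enat m" using len(3) by (cases l) auto
    have "enat m = enat m + ideal_length R ?P ?G" by (fact \<open>l = l + ideal_length R ?P ?G\<close>[unfolded m])
    then show ?thesis
      by (cases "ideal_length R ?P ?G") (simp_all add: enat_0_iff)
  qed
  then have "?P = ?G" by (rule ideal_length_zero_imp_eq[OF P ideal_F PG])
  then have "f \<in> ?P" using f by simp
  then show ?thesis unfolding mem_coset_add .
qed

lemma mons_iff: "s \<in> mons \<longleftrightarrow> (\<exists>i j. s = mon i j)"
  by (simp add: mons_def)

definition fr :: "(int \<times> int \<Rightarrow> 'a) \<Rightarrow> nat \<Rightarrow> nat \<Rightarrow> ((int \<times> int \<Rightarrow> 'a) \<times> (int \<times> int \<Rightarrow> 'a)) set" where
  "fr f i j = frac Rees mons f (mon i j)"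

abbreviation Loc where "Loc \<equiv> localization Rees mons"

lemma abelian_group_Loc: "abelian_group Loc"
  by (rule regular_mult.abelian_group_localization[OF regular_mult_Rees])

lemma carrier_Loc: "carrier Loc = {fr f i j | f i j. f \<in> carrier Rees}"
  unfolding regular_mult.carrier_localization[OF regular_mult_Rees] fr_def mons_iff by blast

lemma fr_closed: "f \<in> carrier Rees \<Longrightarrow> fr f i j \<in> carrier Loc"
  unfolding carrier_Loc by blast

lemma fr_add:
  assumes "f \<in> carrier Rees" "g \<in> carrier Rees"
  shows "fr f i j \<oplus>\<^bsub>Loc\<^esub> fr g k l =
    fr (mon k l \<otimes>\<^bsub>Rees\<^esub> f \<oplus>\<^bsub>Rees\<^esub> mon i j \<otimes>\<^bsub>Rees\<^esub> g) (i + k) (j + l)"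
  unfolding fr_def mon_mon[symmetric]
  by (rule regular_mult.localization_add[OF regular_mult_Rees assms(1) mon_in_mons assms(2) mon_in_mons])

lemma fr_eq_iff:
  assumes "f \<in> carrier Rees" "g \<in> carrier Rees"
  shows "fr f i j = fr g k l \<longleftrightarrow> mon k l \<otimes>\<^bsub>Rees\<^esub> f = mon i j \<otimes>\<^bsub>Rees\<^esub> g"
  unfolding fr_def
  by (rule regular_mult.frac_eq_iff[OF regular_mult_Rees assms(1) mon_in_mons assms(2) mon_in_mons])

lemma fr_neg: "f \<in> carrier Rees \<Longrightarrow> \<ominus>\<^bsub>Loc\<^esub> fr f i j = fr (\<ominus>\<^bsub>Rees\<^esub> f) i j"
  unfolding fr_def by (rule regular_mult.localization_neg[OF regular_mult_Rees _ mon_in_mons])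

definition single :: "'c \<Rightarrow> nat set \<Rightarrow> 'c" where
  "single y = (\<lambda>T\<in>{{0, 1}}. y)"

lemma single_apply [simp]: "single y {0, 1} = y" "single y {0, Suc 0} = y"
  by (simp_all add: single_def)

lemma single_inject: "single y = single z \<longleftrightarrow> y = z"
  by (metis single_apply(1))

lemma length_gens: "length gens = 2"
  by (simp add: gens_def)

lemma cech_index_1: "cech_index gens 1 = {{0}, {1}}"
proof -
  have *: "T \<subseteq> {0..<2} \<and> card T = 1 \<longleftrightarrow> T = {0} \<or> T = {1}" for T :: "nat set"
  proof
    assume T: "T \<subseteq> {0..<2} \<and> card T = 1"
    then obtain x where x: "T = {x}" using card_1_singletonE by blast
    then have "x = 0 \<or> x = 1" using T by auto
    then show "T = {0} \<or> T = {1}" using x by auto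
  qed auto
  show ?thesis
    unfolding cech_index_def length_gens
    by (rule Set.set_eqI) (simp only: mem_Collect_eq * insert_iff empty_iff simp_thms)
qed

lemma cech_index_2: "cech_index gens 2 = {{0, 1}}"
proof -
  have *: "T \<subseteq> {0..<2} \<and> card T = 2 \<longleftrightarrow> T = {0, 1}" for T :: "nat set"
  proof
    assume T: "T \<subseteq> {0..<2} \<and> card T = 2"
    then have "T = {0..<2}" by (intro card_subset_eq) auto
    then show "T = {0, 1}" by auto
  qed auto
  show ?thesis
    unfolding cech_index_def length_gens
    by (rule Set.set_eqI) (simp only: mem_Collect_eq * insert_iff empty_iff simp_thms)
qed

lemma cech_index_3: "cech_index gens (Suc 2) = {}"
proof -
  have *: "\<not> (T \<subseteq> {0..<2} \<and> card T = Suc 2)" for T :: "nat set"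
  proof
    assume T: "T \<subseteq> {0..<2} \<and> card T = Suc 2"
    then have "card T \<le> card {0..<2::nat}" by (intro card_mono) auto
    then show False using T by simp
  qed
  show ?thesis unfolding cech_index_def length_gens using * by simp
qed

abbreviation C2 where "C2 \<equiv> cech_cochains Rees gens 2"

lemma carrier_C2: "carrier C2 = single ` carrier Loc"
proof -
  have "carrier C2 = (\<Pi>\<^sub>E T\<in>{{0, 1}}. carrier (cech_loc Rees gens T))"
    by (simp add: cech_cochains_def cech_index_2)
  also have "\<dots> = (\<Union>y\<in>carrier (cech_loc Rees gens {0, 1}). {\<lambda>T\<in>{{0, 1}}. y})"
    by (rule PiE_over_singleton_iff)
  also have "\<dots> = single ` carrier Loc" unfolding monomials_01 single_def by blast
  finally show ?thesis .
qed

lemma C2_add: "single y \<oplus>\<^bsub>C2\<^esub> single z = single (y \<oplus>\<^bsub>Loc\<^esub> z)"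
  unfolding cech_cochains_def cech_index_2
  by (auto simp: single_def fun_eq_iff monomials_01[simplified] restrict_def)

lemma C2_zero: "\<zero>\<^bsub>C2\<^esub> = single \<zero>\<^bsub>Loc\<^esub>"
  unfolding cech_cochains_def cech_index_2
  by (auto simp: single_def fun_eq_iff monomials_01[simplified] restrict_def)

lemma C2_smult: "c \<odot>\<^bsub>C2\<^esub> single y = single (c \<odot>\<^bsub>Loc\<^esub> y)"
  unfolding cech_cochains_def cech_index_2
  by (auto simp: single_def fun_eq_iff monomials_01[simplified] restrict_def)

lemma abelian_group_C2: "abelian_group C2"
proof -
  interpret L: abelian_group Loc by (rule abelian_group_Loc)
  show ?thesis
  proof (rule abelian_groupI)
    fix x assume "x \<in> carrier C2"
    then obtain u where u: "x = single u" "u \<in> carrier Loc" unfolding carrier_C2 by blast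
    show "\<zero>\<^bsub>C2\<^esub> \<oplus>\<^bsub>C2\<^esub> x = x" unfolding C2_zero u(1) C2_add using u(2) by simp
    show "\<exists>y\<in>carrier C2. y \<oplus>\<^bsub>C2\<^esub> x = \<zero>\<^bsub>C2\<^esub>"
      unfolding C2_zero u(1) carrier_C2 using u(2)
      by (intro bexI[of _ "single (\<ominus>\<^bsub>Loc\<^esub> u)"]) (simp_all add: C2_add L.l_neg)
    fix y assume "y \<in> carrier C2"
    then obtain v where v: "y = single v" "v \<in> carrier Loc" unfolding carrier_C2 by blast
    show "x \<oplus>\<^bsub>C2\<^esub> y \<in> carrier C2" unfolding u(1) v(1) C2_add carrier_C2 using u(2) v(2) by simp
    show "x \<oplus>\<^bsub>C2\<^esub> y = y \<oplus>\<^bsub>C2\<^esub> x" unfolding u(1) v(1) C2_add using u(2) v(2) by (simp add: L.a_comm)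
    fix z assume "z \<in> carrier C2"
    then obtain w where w: "z = single w" "w \<in> carrier Loc" unfolding carrier_C2 by blast
    show "x \<oplus>\<^bsub>C2\<^esub> y \<oplus>\<^bsub>C2\<^esub> z = x \<oplus>\<^bsub>C2\<^esub> (y \<oplus>\<^bsub>C2\<^esub> z)"
      unfolding u(1) v(1) w(1) C2_add using u(2) v(2) w(2) by (simp add: L.a_assoc)
  next
    show "\<zero>\<^bsub>C2\<^esub> \<in> carrier C2" unfolding C2_zero carrier_C2 by simp
  qed
qed

lemma cocycles_C2: "cech_cocycles Rees gens 2 = carrier C2"
  by (simp add: cech_cocycles_def cech_d_def cech_cochains_def cech_index_3[simplified] restrict_def)

definition boundary_fracs where
  "boundary_fracs = {fr f 0 j \<oplus>\<^bsub>Loc\<^esub> fr g i 0 | f g i j. f \<in> carrier Rees \<and> g \<in> carrier Rees}"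

lemma loc_map_0:
  assumes "f \<in> carrier Rees"
  shows "loc_map Rees mons (frac Rees (monomials Rees gens {0}) f (mon i 0)) = fr f i 0"
  unfolding fr_def
proof (rule regular_mult.loc_map_frac[OF regular_mult_Rees])
  show "s \<otimes>\<^bsub>Rees\<^esub> t \<in> monomials Rees gens {0}"
    if "s \<in> monomials Rees gens {0}" "t \<in> monomials Rees gens {0}" for s t
    using that unfolding monomials_0 by (auto simp: mon_mon)
qed (auto simp: monomials_0 mons_def Rees_one assms)

lemma loc_map_1:
  assumes "f \<in> carrier Rees"
  shows "loc_map Rees mons (frac Rees (monomials Rees gens {1}) f (mon 0 j)) = fr f 0 j"
  unfolding fr_def
proof (rule regular_mult.loc_map_frac[OF regular_mult_Rees])
  show "s \<otimes>\<^bsub>Rees\<^esub> t \<in> monomials Rees gens {1}"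
    if "s \<in> monomials Rees gens {1}" "t \<in> monomials Rees gens {1}" for s t
    using that unfolding monomials_1 by (auto simp: mon_mon)
qed (auto simp: monomials_1[simplified] mons_def Rees_one assms)

lemma cech_d_1:
  assumes f: "f \<in> carrier Rees" "\<alpha> {1} = frac Rees (monomials Rees gens {1}) f (mon 0 j)"
    and g: "g \<in> carrier Rees" "\<alpha> {0} = frac Rees (monomials Rees gens {0}) g (mon i 0)"
  shows "cech_d Rees gens 1 \<alpha> = single (fr f 0 j \<oplus>\<^bsub>Loc\<^esub> fr (\<ominus>\<^bsub>Rees\<^esub> g) i 0)"
proof -
  interpret L: abelian_group Loc by (rule abelian_group_Loc)
  let ?t = "\<lambda>T j. let y = loc_map Rees (monomials Rees gens T) (\<alpha> (T - {j})) in
    if even (card {i \<in> T. i < j}) then y else \<ominus>\<^bsub>cech_loc Rees gens T\<^esub> y"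
  have d: "{0, 1} - {0} = {1::nat}" "{0, 1} - {1} = {0::nat}" by auto
  have s: "{i \<in> {0, 1}. i < (0::nat)} = {}" "{i \<in> {0, 1}. i < (1::nat)} = {0}" by auto
  have t0: "?t {0, 1} 0 = fr f 0 j"
    unfolding d s monomials_01 f(2) loc_map_1[OF f(1)] by simp
  have t1: "?t {0, 1} 1 = fr (\<ominus>\<^bsub>Rees\<^esub> g) i 0"
    unfolding d s monomials_01 g(2) loc_map_0[OF g(1)] fr_neg[OF g(1), symmetric] by simp
  have gm: "\<ominus>\<^bsub>Rees\<^esub> g \<in> carrier Rees"
    by (rule abelian_group.a_inv_closed[OF abelian_group_Rees g(1)])
  have "finsum Loc (?t {0, 1}) (insert 0 {1}) = ?t {0, 1} 0 \<oplus>\<^bsub>Loc\<^esub> finsum Loc (?t {0, 1}) (insert 1 {})"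
    unfolding t0[symmetric]
    by (rule L.finsum_insert) (use t0 t1 fr_closed[OF f(1)] fr_closed[OF gm] in \<open>simp_all del: One_nat_def\<close>)
  also have "finsum Loc (?t {0, 1}) (insert 1 {}) = ?t {0, 1} 1 \<oplus>\<^bsub>Loc\<^esub> finsum Loc (?t {0, 1}) {}"
    by (rule L.finsum_insert) (use t1 fr_closed[OF gm] in \<open>simp_all del: One_nat_def\<close>)
  also have "\<dots> = fr (\<ominus>\<^bsub>Rees\<^esub> g) i 0" unfolding t1 L.finsum_empty using fr_closed[OF gm] by simp
  finally have fin: "finsum Loc (?t {0, 1}) {0, 1} = fr f 0 j \<oplus>\<^bsub>Loc\<^esub> fr (\<ominus>\<^bsub>Rees\<^esub> g) i 0"
    unfolding t0 .
  have "cech_d Rees gens 1 \<alpha> = (\<lambda>T\<in>{{0, 1}}. finsum (cech_loc Rees gens T) (?t T) T)"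
    unfolding cech_d_def Suc_1 cech_index_2 ..
  also have "\<dots> = single (finsum (cech_loc Rees gens {0, 1}) (?t {0, 1}) {0, 1})"
    unfolding single_def by (rule restrict_ext) (simp only: singleton_iff)
  also have "\<dots> = single (finsum Loc (?t {0, 1}) {0, 1})" by (simp only: monomials_01)
  finally show ?thesis unfolding fin .
qed

lemma coboundaries_C2: "cech_coboundaries Rees gens 2 = single ` boundary_fracs"
proof -
  interpret A: abelian_group Rees by (rule abelian_group_Rees)
  have "cech_coboundaries Rees gens 2 = cech_d Rees gens 1 ` carrier (cech_cochains Rees gens 1)"
    by (simp add: cech_coboundaries_def numeral_2_eq_2)
  also have "\<dots> = single ` boundary_fracs"
  proof
    show "cech_d Rees gens 1 ` carrier (cech_cochains Rees gens 1) \<subseteq> single ` boundary_fracs"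
    proof
      fix y assume "y \<in> cech_d Rees gens 1 ` carrier (cech_cochains Rees gens 1)"
      then obtain \<alpha> where \<alpha>: "y = cech_d Rees gens 1 \<alpha>" "\<alpha> \<in> carrier (cech_cochains Rees gens 1)" by blast
      have "\<alpha> \<in> (\<Pi>\<^sub>E T\<in>{{0}, {1}}. carrier (cech_loc Rees gens T))"
        using \<alpha>(2) unfolding cech_cochains_def cech_index_1 by simp
      then have "\<alpha> {0} \<in> carrier (cech_loc Rees gens {0})" "\<alpha> {1} \<in> carrier (cech_loc Rees gens {1})"
        by (auto simp del: One_nat_def)
      then have "(\<exists>g s. \<alpha> {0} = frac Rees (monomials Rees gens {0}) g s \<and> g \<in> carrier Rees \<and> s \<in> monomials Rees gens {0})"
        "(\<exists>f s. \<alpha> {1} = frac Rees (monomials Rees gens {1}) f s \<and> f \<in> carrier Rees \<and> s \<in> monomials Rees gens {1})"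
        unfolding localization_def by simp_all
      then obtain f g i j where "f \<in> carrier Rees" "\<alpha> {1} = frac Rees (monomials Rees gens {1}) f (mon 0 j)"
        and g: "g \<in> carrier Rees" "\<alpha> {0} = frac Rees (monomials Rees gens {0}) g (mon i 0)"
        unfolding monomials_0 monomials_1 by blast
      from cech_d_1[OF this] have "y = single (fr f 0 j \<oplus>\<^bsub>Loc\<^esub> fr (\<ominus>\<^bsub>Rees\<^esub> g) i 0)" unfolding \<alpha>(1) .
      then show "y \<in> single ` boundary_fracs"
        unfolding boundary_fracs_def using \<open>f \<in> carrier Rees\<close> A.a_inv_closed[OF g(1)] by blast
    qed
    show "single ` boundary_fracs \<subseteq> cech_d Rees gens 1 ` carrier (cech_cochains Rees gens 1)"
    proof
      fix y assume "y \<in> single ` boundary_fracs"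
      then obtain f g i j where y: "y = single (fr f 0 j \<oplus>\<^bsub>Loc\<^esub> fr g i 0)"
        and f: "f \<in> carrier Rees" and g: "g \<in> carrier Rees" unfolding boundary_fracs_def by blast
      define \<alpha> where "\<alpha> = (\<lambda>T\<in>{{0}, {1::nat}}. if T = {1} then frac Rees (monomials Rees gens {1}) f (mon 0 j)
        else frac Rees (monomials Rees gens {0}) (\<ominus>\<^bsub>Rees\<^esub> g) (mon i 0))"
      have \<alpha>01: "\<alpha> {1} = frac Rees (monomials Rees gens {1}) f (mon 0 j)"
        "\<alpha> {0} = frac Rees (monomials Rees gens {0}) (\<ominus>\<^bsub>Rees\<^esub> g) (mon i 0)"
        by (simp_all add: \<alpha>_def)
      have gm: "\<ominus>\<^bsub>Rees\<^esub> g \<in> carrier Rees" using g by simp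
      have m: "mon 0 j \<in> monomials Rees gens {1}" "mon i 0 \<in> monomials Rees gens {0}"
        unfolding monomials_0 monomials_1 by blast+
      have "\<alpha> {1} \<in> carrier (cech_loc Rees gens {1})" "\<alpha> {0} \<in> carrier (cech_loc Rees gens {0})"
        unfolding \<alpha>01 localization_def using f gm m by auto
      then have "\<alpha> \<in> carrier (cech_cochains Rees gens 1)"
        unfolding cech_cochains_def cech_index_1 by (auto simp: \<alpha>_def simp del: One_nat_def)
      moreover have "cech_d Rees gens 1 \<alpha> = y"
        using cech_d_1[OF f \<alpha>01(1) gm \<alpha>01(2)] g unfolding y by simp
      ultimately show "y \<in> cech_d Rees gens 1 ` carrier (cech_cochains Rees gens 1)" by blast
    qed
  qed
  finally show ?thesis .
qed

text \<open>\<open>psi r s k\<close> is the map from \<open>F (r+k) (s+k)\<close> to the fractions of degree \<open>(r, s)\<close> that divides by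
  \<open>(at\<^sub>1)\<^sup>k(bt\<^sub>2)\<^sup>k\<close>.\<close>

definition psi :: "int \<Rightarrow> int \<Rightarrow> nat \<Rightarrow> 'a \<Rightarrow> ((int \<times> int \<Rightarrow> 'a) \<times> (int \<times> int \<Rightarrow> 'a)) set" where
  "psi r s k f = fr (laurent_monom R f (r + int k, s + int k)) k k"

lemma laurent_add: "laurent_monom R (f \<oplus> g) d = laurent_monom R f d \<oplus>\<^bsub>Rees\<^esub> laurent_monom R g d"
  by (auto simp: laurent_monom_def Rees_add)

lemma mon_laurent:
  assumes "f \<in> carrier R"
  shows "mon i j \<otimes>\<^bsub>Rees\<^esub> laurent_monom R f (p, q) =
    laurent_monom R (a [^] i \<otimes> b [^] j \<otimes> f) (p + int i, q + int j)"
proof -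
  have "mon i j \<otimes>\<^bsub>Rees\<^esub> laurent_monom R f (p, q) =
      (\<lambda>x. a [^] i \<otimes> b [^] j \<otimes> laurent_monom R f (p, q) (x - (int i, int j)))"
    unfolding mon_def by (rule laurent_mult[OF mon_coeff]) (simp add: laurent_monom_def assms)
  moreover have "x - (int i, int j) = (p, q) \<longleftrightarrow> x = (p + int i, q + int j)" for x by (cases x) auto
  ultimately show ?thesis by (auto simp: laurent_monom_def)
qed

lemma psi_closed: "f \<in> F (r + int k) (s + int k) \<Longrightarrow> psi r s k f \<in> carrier Loc"
  unfolding psi_def by (rule fr_closed[OF laurent_carrier])

lemma psi_add:
  assumes "f \<in> F (r + int k) (s + int k)" "g \<in> F (r + int k) (s + int k)"
  shows "psi r s k (f \<oplus> g) = psi r s k f \<oplus>\<^bsub>Loc\<^esub> psi r s k g"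
  unfolding psi_def laurent_add fr_def
  by (rule regular_mult.localization_add_same[OF regular_mult_Rees laurent_carrier[OF assms(1)]
        mon_in_mons laurent_carrier[OF assms(2)], symmetric])

lemma fr_expand:
  assumes "f \<in> carrier Rees"
  shows "fr (mon k l \<otimes>\<^bsub>Rees\<^esub> f) (k + i) (l + j) = fr f i j"
  unfolding fr_def mon_mon[symmetric]
  by (rule regular_mult.frac_expand[OF regular_mult_Rees assms mon_in_mons mon_in_mons])

lemma psi_transition:
  assumes "f \<in> F (r + int k) (s + int k)"
  shows "psi r s (k + n) (a [^] n \<otimes> b [^] n \<otimes> f) = psi r s k f"
  using fr_expand[OF laurent_carrier[OF assms], of n n k k] F_carrier[OF assms]
  unfolding psi_def by (simp add: mon_laurent ac_simps)

lemma const_mult: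
  assumes "c \<in> carrier R" "f \<in> carrier Rees"
  shows "laurent_monom R c (0, 0) \<otimes>\<^bsub>Rees\<^esub> f = (\<lambda>p. c \<otimes> f p)"
proof -
  have "p - (0, 0) = p" for p :: "int \<times> int" by (cases p) simp
  then show ?thesis using laurent_mult[OF assms(1) Rees_val[OF assms(2)], of "(0, 0)"] by simp
qed

lemma const_closed:
  assumes "c \<in> carrier R" "f \<in> carrier Rees"
  shows "laurent_monom R c (0, 0) \<otimes>\<^bsub>Rees\<^esub> f \<in> carrier Rees"
proof -
  have "{p. c \<otimes> f p \<noteq> \<zero>} \<subseteq> {p. f p \<noteq> \<zero>}" using assms(1) by auto
  then have "finite {p. c \<otimes> f p \<noteq> \<zero>}" using assms(2) by (auto simp: Rees_carrier intro: finite_subset)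
  moreover have "c \<otimes> f (r, s) \<in> F r s" for r s
    using ideal.I_l_closed[OF ideal_F Rees_mem[OF assms(2)] assms(1)] .
  ultimately show ?thesis unfolding const_mult[OF assms] Rees_carrier by simp
qed

lemma const_add:
  assumes "c \<in> carrier R" "f \<in> carrier Rees" "g \<in> carrier Rees"
  shows "laurent_monom R c (0, 0) \<otimes>\<^bsub>Rees\<^esub> (f \<oplus>\<^bsub>Rees\<^esub> g) =
    laurent_monom R c (0, 0) \<otimes>\<^bsub>Rees\<^esub> f \<oplus>\<^bsub>Rees\<^esub> laurent_monom R c (0, 0) \<otimes>\<^bsub>Rees\<^esub> g"
proof -
  have fg: "f \<oplus>\<^bsub>Rees\<^esub> g \<in> carrier Rees"
    using assms(2,3) by (rule abelian_groupE(1)[OF abelian_group_Rees])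
  show ?thesis
    unfolding const_mult[OF assms(1) fg] const_mult[OF assms(1,2)] const_mult[OF assms(1,3)]
    unfolding Rees_add using Rees_val[OF assms(2)] Rees_val[OF assms(3)] assms(1) by (simp add: r_distr)
qed

lemma const_mon:
  assumes c: "c \<in> carrier R" and f: "f \<in> carrier Rees"
  shows "laurent_monom R c (0, 0) \<otimes>\<^bsub>Rees\<^esub> (mon i j \<otimes>\<^bsub>Rees\<^esub> f) =
    mon i j \<otimes>\<^bsub>Rees\<^esub> (laurent_monom R c (0, 0) \<otimes>\<^bsub>Rees\<^esub> f)"
proof -
  have "c \<otimes> (a [^] i \<otimes> b [^] j \<otimes> x) = a [^] i \<otimes> b [^] j \<otimes> (c \<otimes> x)" if "x \<in> carrier R" for x
    using that c by (intro m_lcomm) auto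
  note * = this[OF Rees_val[OF f]]
  show ?thesis
    unfolding const_mult[OF c mon_closed[OF f]] mon_mult_apply[OF const_closed[OF c f]]
    unfolding const_mult[OF c f] mon_mult_apply[OF f] by (simp only: *)
qed

lemma fr_smult:
  assumes c: "c \<in> carrier R" and f: "f \<in> carrier Rees"
  shows "laurent_monom R c (0, 0) \<odot>\<^bsub>Loc\<^esub> fr f i j = fr (laurent_monom R c (0, 0) \<otimes>\<^bsub>Rees\<^esub> f) i j"
  unfolding fr_def
proof (rule regular_mult.localization_smult[OF regular_mult_Rees f mon_in_mons])
  show "laurent_monom R c (0, 0) \<otimes>\<^bsub>Rees\<^esub> g \<in> carrier Rees" if "g \<in> carrier Rees" for g
    by (rule const_closed[OF c that])
  show "laurent_monom R c (0, 0) \<otimes>\<^bsub>Rees\<^esub> (t \<otimes>\<^bsub>Rees\<^esub> g) = t \<otimes>\<^bsub>Rees\<^esub> (laurent_monom R c (0, 0) \<otimes>\<^bsub>Rees\<^esub> g)"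
    if g: "g \<in> carrier Rees" and "t \<in> mons" for g t
    using \<open>t \<in> mons\<close> const_mon[OF c g] unfolding mons_iff by blast
qed

lemma Loc_smult_add:
  assumes c: "c \<in> carrier R" and f: "f \<in> carrier Rees" and g: "g \<in> carrier Rees"
  shows "laurent_monom R c (0, 0) \<odot>\<^bsub>Loc\<^esub> (fr f i j \<oplus>\<^bsub>Loc\<^esub> fr g k l) =
    fr (laurent_monom R c (0, 0) \<otimes>\<^bsub>Rees\<^esub> f) i j \<oplus>\<^bsub>Loc\<^esub> fr (laurent_monom R c (0, 0) \<otimes>\<^bsub>Rees\<^esub> g) k l"
proof -
  have fg: "mon k l \<otimes>\<^bsub>Rees\<^esub> f \<oplus>\<^bsub>Rees\<^esub> mon i j \<otimes>\<^bsub>Rees\<^esub> g \<in> carrier Rees"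
    by (rule abelian_groupE(1)[OF abelian_group_Rees mon_closed[OF f] mon_closed[OF g]])
  show ?thesis
    unfolding fr_add[OF f g] fr_smult[OF c fg] fr_add[OF const_closed[OF c f] const_closed[OF c g]]
      const_add[OF c mon_closed[OF f] mon_closed[OF g]] const_mon[OF c f] const_mon[OF c g] ..
qed

lemma psi_smult:
  assumes c: "c \<in> carrier R" and f: "f \<in> F (r + int k) (s + int k)"
  shows "psi r s k (c \<otimes> f) = laurent_monom R c (0, 0) \<odot>\<^bsub>Loc\<^esub> psi r s k f"
proof -
  have "laurent_monom R (c \<otimes> f) d = (\<lambda>p. c \<otimes> laurent_monom R f d p)" for d
    using c by (auto simp: laurent_monom_def)
  then show ?thesis
    unfolding psi_def fr_smult[OF c laurent_carrier[OF f]] const_mult[OF c laurent_carrier[OF f]] by simp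
qed

lemma psi_mem_boundary_fracs:
  assumes rs: "r \<ge> 0" "s \<ge> 0" and f: "f \<in> F (r + int k) (s + int k)"
  shows "psi r s k f \<in> boundary_fracs \<longleftrightarrow> f \<in> koszul_boundaries r s k"
proof
  assume "f \<in> koszul_boundaries r s k"
  then obtain u v where uv: "u \<in> F r (s + int k)" "v \<in> F (r + int k) s" "f = a [^] k \<otimes> u \<oplus> b [^] k \<otimes> v"
    unfolding mem_koszul_boundaries by blast
  have c: "u \<in> carrier R" "v \<in> carrier R" using uv F_carrier by auto
  have "fr (laurent_monom R u (r, s + int k)) 0 k \<oplus>\<^bsub>Loc\<^esub> fr (laurent_monom R v (r + int k, s)) k 0 = psi r s k f"
    unfolding fr_add[OF laurent_carrier[OF uv(1)] laurent_carrier[OF uv(2)]] psi_def uv(3) laurent_add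
    using c by (simp add: mon_laurent)
  then show "psi r s k f \<in> boundary_fracs"
    unfolding boundary_fracs_def using laurent_carrier[OF uv(1)] laurent_carrier[OF uv(2)] by blast
next
  assume "psi r s k f \<in> boundary_fracs"
  then obtain g h i j where gh: "g \<in> carrier Rees" "h \<in> carrier Rees"
    and eq: "psi r s k f = fr g 0 j \<oplus>\<^bsub>Loc\<^esub> fr h i 0"
    unfolding boundary_fracs_def by blast
  let ?q = "mon i 0 \<otimes>\<^bsub>Rees\<^esub> g \<oplus>\<^bsub>Rees\<^esub> mon 0 j \<otimes>\<^bsub>Rees\<^esub> h"
  have q: "?q \<in> carrier Rees"
    by (rule abelian_groupE(1)[OF abelian_group_Rees mon_closed[OF gh(1)] mon_closed[OF gh(2)]])
  have fc: "f \<in> carrier R" using f F_carrier by blast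
  define u v where "u = g (r, s + int j)" and "v = h (r + int i, s)"
  have uF: "u \<in> F r (s + int j)" and vF: "v \<in> F (r + int i) s"
    using Rees_mem gh by (auto simp: u_def v_def)
  have uv: "u \<in> carrier R" "v \<in> carrier R" using uF vF F_carrier by auto
  have "fr (laurent_monom R f (r + int k, s + int k)) k k = fr ?q i j"
    using eq unfolding psi_def fr_add[OF gh] by simp
  then have "mon i j \<otimes>\<^bsub>Rees\<^esub> laurent_monom R f (r + int k, s + int k) = mon k k \<otimes>\<^bsub>Rees\<^esub> ?q"
    unfolding fr_eq_iff[OF laurent_carrier[OF f] q] .
  then have "(mon i j \<otimes>\<^bsub>Rees\<^esub> laurent_monom R f (r + int k, s + int k)) (r + int k + int i, s + int k + int j) =
      (mon k k \<otimes>\<^bsub>Rees\<^esub> ?q) (r + int k + int i, s + int k + int j)" by simp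
  then have e: "a [^] i \<otimes> b [^] j \<otimes> f = a [^] k \<otimes> b [^] k \<otimes> (a [^] i \<otimes> u \<oplus> b [^] j \<otimes> v)"
    unfolding mon_laurent[OF fc] mon_mult_apply[OF q]
    unfolding Rees_add mon_mult_apply[OF gh(1)] mon_mult_apply[OF gh(2)]
    by (simp add: laurent_monom_def u_def v_def algebra_simps)
  have "a [^] (i + j) \<otimes> b [^] (i + j) \<otimes> f = (a [^] j \<otimes> b [^] i) \<otimes> (a [^] i \<otimes> b [^] j \<otimes> f)"
    using fc by (simp add: nat_pow_mult[symmetric] m_ac)
  also have "\<dots> = a [^] (k + (i + j)) \<otimes> (b [^] (i + k) \<otimes> u) \<oplus> b [^] (k + (i + j)) \<otimes> (a [^] (j + k) \<otimes> v)"
    unfolding e using uv by (simp add: nat_pow_mult[symmetric] m_ac r_distr)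
  finally have e2: "a [^] (i + j) \<otimes> b [^] (i + j) \<otimes> f =
      a [^] (k + (i + j)) \<otimes> (b [^] (i + k) \<otimes> u) \<oplus> b [^] (k + (i + j)) \<otimes> (a [^] (j + k) \<otimes> v)" .
  have "b [^] (i + k) \<otimes> u \<in> F r (s + int k + int (i + j))"
    using ab_pow_F[OF uF, of 0 "i + k"] uv by (simp add: algebra_simps)
  moreover have "a [^] (j + k) \<otimes> v \<in> F (r + int k + int (i + j)) s"
    using ab_pow_F[OF vF, of "j + k" 0] uv by (simp add: algebra_simps)
  ultimately show "f \<in> koszul_boundaries r s k"
    by (rule koszul_boundaries_descend[OF rs fc _ _ e2])
qed

lemma boundary_fracs_subset: "boundary_fracs \<subseteq> carrier Loc"
proof
  fix y assume "y \<in> boundary_fracs"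
  then obtain f g i j where "f \<in> carrier Rees" "g \<in> carrier Rees" "y = fr f 0 j \<oplus>\<^bsub>Loc\<^esub> fr g i 0"
    unfolding boundary_fracs_def by blast
  then show "y \<in> carrier Loc" using abelian_groupE(1)[OF abelian_group_Loc fr_closed fr_closed] by blast
qed

lemma additive_subgroup_boundaries: "additive_subgroup (single ` boundary_fracs) C2"
proof -
  interpret L: abelian_group Loc by (rule abelian_group_Loc)
  interpret A: abelian_group Rees by (rule abelian_group_Rees)
  interpret C: abelian_group C2 by (rule abelian_group_C2)
  have neg: "\<ominus>\<^bsub>C2\<^esub> single y = single (\<ominus>\<^bsub>Loc\<^esub> y)" if "y \<in> carrier Loc" for y
    using that by (intro C.minus_equality) (simp_all add: C2_add C2_zero carrier_C2 L.l_neg)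
  show ?thesis
  proof (intro additive_subgroup.intro C.add.subgroupI)
    show "single ` boundary_fracs \<subseteq> carrier C2" unfolding carrier_C2 using boundary_fracs_subset by blast
    have "fr \<zero>\<^bsub>Rees\<^esub> 0 0 \<oplus>\<^bsub>Loc\<^esub> fr \<zero>\<^bsub>Rees\<^esub> 0 0 \<in> boundary_fracs"
      unfolding boundary_fracs_def using A.zero_closed by blast
    then show "single ` boundary_fracs \<noteq> {}" by blast
  next
    fix x assume "x \<in> single ` boundary_fracs"
    then obtain f g i j where f: "f \<in> carrier Rees" and g: "g \<in> carrier Rees"
      and x: "x = single (fr f 0 j \<oplus>\<^bsub>Loc\<^esub> fr g i 0)" unfolding boundary_fracs_def by blast
    have "\<ominus>\<^bsub>C2\<^esub> x = single (fr (\<ominus>\<^bsub>Rees\<^esub> f) 0 j \<oplus>\<^bsub>Loc\<^esub> fr (\<ominus>\<^bsub>Rees\<^esub> g) i 0)"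
      unfolding x using fr_closed[OF f] fr_closed[OF g] fr_neg[OF f] fr_neg[OF g]
      by (simp add: neg L.minus_add)
    then show "\<ominus>\<^bsub>C2\<^esub> x \<in> single ` boundary_fracs"
      unfolding boundary_fracs_def using A.a_inv_closed[OF f] A.a_inv_closed[OF g] by blast
    fix y assume "y \<in> single ` boundary_fracs"
    then obtain f' g' i' j' where f': "f' \<in> carrier Rees" and g': "g' \<in> carrier Rees"
      and y: "y = single (fr f' 0 j' \<oplus>\<^bsub>Loc\<^esub> fr g' i' 0)" unfolding boundary_fracs_def by blast
    have "(fr f 0 j \<oplus>\<^bsub>Loc\<^esub> fr g i 0) \<oplus>\<^bsub>Loc\<^esub> (fr f' 0 j' \<oplus>\<^bsub>Loc\<^esub> fr g' i' 0) =
        (fr f 0 j \<oplus>\<^bsub>Loc\<^esub> fr f' 0 j') \<oplus>\<^bsub>Loc\<^esub> (fr g i 0 \<oplus>\<^bsub>Loc\<^esub> fr g' i' 0)"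
      using fr_closed[OF f] fr_closed[OF g] fr_closed[OF f'] fr_closed[OF g'] by (simp add: L.add.m_ac)
    then have "x \<oplus>\<^bsub>C2\<^esub> y = single (fr (mon 0 j' \<otimes>\<^bsub>Rees\<^esub> f \<oplus>\<^bsub>Rees\<^esub> mon 0 j \<otimes>\<^bsub>Rees\<^esub> f') 0 (j + j') \<oplus>\<^bsub>Loc\<^esub>
        fr (mon i' 0 \<otimes>\<^bsub>Rees\<^esub> g \<oplus>\<^bsub>Rees\<^esub> mon i 0 \<otimes>\<^bsub>Rees\<^esub> g') (i + i') 0)"
      unfolding x y C2_add by (simp add: fr_add[OF f f'] fr_add[OF g g'])
    moreover have "mon 0 j' \<otimes>\<^bsub>Rees\<^esub> f \<oplus>\<^bsub>Rees\<^esub> mon 0 j \<otimes>\<^bsub>Rees\<^esub> f' \<in> carrier Rees"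
      "mon i' 0 \<otimes>\<^bsub>Rees\<^esub> g \<oplus>\<^bsub>Rees\<^esub> mon i 0 \<otimes>\<^bsub>Rees\<^esub> g' \<in> carrier Rees"
      using mon_closed f g f' g' by (simp_all add: A.a_closed)
    ultimately show "x \<oplus>\<^bsub>C2\<^esub> y \<in> single ` boundary_fracs" unfolding boundary_fracs_def by blast
  qed
qed

lemma ext_rees_comp_iff:
  "f \<in> ext_rees_comp R F (p, q) \<longleftrightarrow> (\<exists>c\<in>F p q. f = laurent_monom R c (p, q))"
proof
  assume f: "f \<in> ext_rees_comp R F (p, q)"
  then have "f = laurent_monom R (f (p, q)) (p, q)" by (auto simp: ext_rees_comp_def laurent_monom_def)
  moreover have "f (p, q) \<in> F p q" using f Rees_mem unfolding ext_rees_comp_def by blast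
  ultimately show "\<exists>c\<in>F p q. f = laurent_monom R c (p, q)" by blast
next
  assume "\<exists>c\<in>F p q. f = laurent_monom R c (p, q)"
  then show "f \<in> ext_rees_comp R F (p, q)"
    using laurent_carrier by (auto simp: ext_rees_comp_def laurent_monom_def)
qed

lemma mon_degree:
  assumes "mon i j \<in> ext_rees_comp R F e"
  shows "e = (int i, int j)"
proof (rule ccontr)
  assume "e \<noteq> (int i, int j)"
  then have "mon i j (int i, int j) = \<zero>" using assms by (auto simp: ext_rees_comp_def)
  then have "a [^] i \<otimes> b [^] j = \<zero>" by (simp add: mon_def laurent_monom_def)
  then have "a [^] i \<otimes> b [^] j \<otimes> \<one> = \<zero>" by simp
  then have "\<one> = \<zero>" using nonzerodivisor_ab_pow[of i j] one_closed unfolding nonzerodivisor_def by blast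
  then show False using one_neq_zero by simp
qed

lemma homogeneous_fracs:
  "frac_comp Rees (ext_rees_comp R F) mons (r, s) =
    {fr (laurent_monom R c (r + int i, s + int j)) i j | c i j. c \<in> F (r + int i) (s + int j)}"
proof
  show "frac_comp Rees (ext_rees_comp R F) mons (r, s) \<subseteq>
    {fr (laurent_monom R c (r + int i, s + int j)) i j | c i j. c \<in> F (r + int i) (s + int j)}"
  proof
    fix y assume "y \<in> frac_comp Rees (ext_rees_comp R F) mons (r, s)"
    then obtain f t e where y: "y = frac Rees mons f t" "t \<in> mons" "t \<in> ext_rees_comp R F e"
      "f \<in> ext_rees_comp R F ((r, s) + e)" unfolding frac_comp_def by blast
    obtain i j where t: "t = mon i j" using y(2) unfolding mons_iff by blast
    have e: "e = (int i, int j)" using y(3) unfolding t by (rule mon_degree)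
    have "f \<in> ext_rees_comp R F (r + int i, s + int j)" using y(4) unfolding e by simp
    then obtain c where "c \<in> F (r + int i) (s + int j)" "f = laurent_monom R c (r + int i, s + int j)"
      unfolding ext_rees_comp_iff by blast
    then show "y \<in> {fr (laurent_monom R c (r + int i, s + int j)) i j | c i j. c \<in> F (r + int i) (s + int j)}"
      unfolding y(1) t fr_def by blast
  qed
  show "{fr (laurent_monom R c (r + int i, s + int j)) i j | c i j. c \<in> F (r + int i) (s + int j)} \<subseteq>
    frac_comp Rees (ext_rees_comp R F) mons (r, s)"
  proof
    fix y assume "y \<in> {fr (laurent_monom R c (r + int i, s + int j)) i j | c i j. c \<in> F (r + int i) (s + int j)}"
    then obtain c i j where c: "c \<in> F (r + int i) (s + int j)"
      "y = fr (laurent_monom R c (r + int i, s + int j)) i j" by blast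
    have "a [^] i \<otimes> b [^] j \<otimes> \<one> \<in> F (0 + int i) (0 + int j)" by (rule ab_pow_F) (simp add: F_nonpos)
    then have "mon i j \<in> ext_rees_comp R F (int i, int j)" unfolding ext_rees_comp_iff mon_def by auto
    moreover have "laurent_monom R c (r + int i, s + int j) \<in> ext_rees_comp R F ((r, s) + (int i, int j))"
      using c(1) ext_rees_comp_iff by auto
    ultimately show "y \<in> frac_comp Rees (ext_rees_comp R F) mons (r, s)"
      unfolding frac_comp_def c(2) fr_def using mon_in_mons by blast
  qed
qed

theorem local_cohomology_length:
  assumes rs: "r \<ge> 0" "s \<ge> 0"
    and len: "\<And>k. k \<ge> k0 \<Longrightarrow> ideal_length R (koszul_boundaries r s k) (F (r + int k) (s + int k)) = l"
    and fin: "l \<noteq> \<infinity>"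
  shows "module_length R (restrict_scalars (\<lambda>c. laurent_monom R c (0, 0))
    (local_cohomology_comp Rees (ext_rees_comp R F) gens 2 (r, s))) = l"
proof -
  interpret L: abelian_group Loc by (rule abelian_group_Loc)
  interpret C: abelian_group C2 by (rule abelian_group_C2)
  let ?B = "single ` boundary_fracs"
  let ?N = "F (r + int k0) (s + int k0)"
  let ?H = "restrict_scalars (\<lambda>c. laurent_monom R c (0, 0))
    (local_cohomology_comp Rees (ext_rees_comp R F) gens 2 (r, s))"
  interpret B: additive_subgroup ?B C2 by (rule additive_subgroup_boundaries)
  have C2: "C2\<lparr>carrier := cech_cocycles Rees gens 2\<rparr> = C2" unfolding cocycles_C2 by simp
  have lc: "local_cohomology Rees gens 2 = quot_module C2 ?B"
    unfolding local_cohomology_def C2 coboundaries_C2 ..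
  have "carrier ?H = {?B +>\<^bsub>C2\<^esub> \<alpha> | \<alpha>. \<alpha> \<in> carrier C2 \<and>
      (\<forall>T\<in>{{0, 1}}. \<alpha> T \<in> frac_comp Rees (ext_rees_comp R F) (monomials Rees gens T) (r, s))}"
    by (simp add: restrict_scalars_def local_cohomology_comp_def cocycles_C2 coboundaries_C2 cech_index_2)
  also have "\<dots> = {?B +>\<^bsub>C2\<^esub> single y | y. y \<in> carrier Loc \<and>
      y \<in> frac_comp Rees (ext_rees_comp R F) mons (r, s)}"
    unfolding carrier_C2 by (auto simp: monomials_01[simplified])
  also have "\<dots> = (\<lambda>f. ?B +>\<^bsub>C2\<^esub> single (psi r s k0 f)) ` ?N"
  proof
    show "(\<lambda>f. ?B +>\<^bsub>C2\<^esub> single (psi r s k0 f)) ` ?N \<subseteq> {?B +>\<^bsub>C2\<^esub> single y | y. y \<in> carrier Loc \<and>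
        y \<in> frac_comp Rees (ext_rees_comp R F) mons (r, s)}"
      using psi_closed unfolding homogeneous_fracs psi_def by blast
    show "{?B +>\<^bsub>C2\<^esub> single y | y. y \<in> carrier Loc \<and> y \<in> frac_comp Rees (ext_rees_comp R F) mons (r, s)}
        \<subseteq> (\<lambda>f. ?B +>\<^bsub>C2\<^esub> single (psi r s k0 f)) ` ?N"
    proof
      fix U assume "U \<in> {?B +>\<^bsub>C2\<^esub> single y | y. y \<in> carrier Loc \<and>
        y \<in> frac_comp Rees (ext_rees_comp R F) mons (r, s)}"
      then obtain c i j where c: "c \<in> F (r + int i) (s + int j)"
        and U: "U = ?B +>\<^bsub>C2\<^esub> single (fr (laurent_monom R c (r + int i, s + int j)) i j)"
        unfolding homogeneous_fracs by blast
      define n where "n = k0 + (i + j)"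
      define f where "f = a [^] (k0 + j) \<otimes> b [^] (k0 + i) \<otimes> c"
      have f: "f \<in> F (r + int n) (s + int n)"
        using ab_pow_F[OF c, of "k0 + j" "k0 + i"] by (simp add: f_def n_def algebra_simps)
      have "fr (laurent_monom R c (r + int i, s + int j)) i j = psi r s n f"
        using fr_expand[OF laurent_carrier[OF c], of "k0 + j" "k0 + i" i j] F_carrier[OF c]
        unfolding psi_def f_def n_def by (simp add: mon_laurent algebra_simps)
      have "\<exists>g\<in>?N. \<exists>d\<in>koszul_boundaries r s n. f = a [^] (i + j) \<otimes> b [^] (i + j) \<otimes> g \<oplus> d"
        unfolding n_def
        by (rule koszul_stable[OF rs len[OF order_refl] len fin]) (use f in \<open>simp_all add: n_def\<close>)
      then obtain g d where g: "g \<in> ?N" and d: "d \<in> koszul_boundaries r s n"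
        and fgd: "f = a [^] (i + j) \<otimes> b [^] (i + j) \<otimes> g \<oplus> d" by blast
      have g': "a [^] (i + j) \<otimes> b [^] (i + j) \<otimes> g \<in> F (r + int n) (s + int n)"
        using ab_pow_F[OF g, of "i + j" "i + j"] by (simp add: n_def add.assoc)
      have d': "d \<in> F (r + int n) (s + int n)" using d koszul_boundaries_subset[OF rs] by blast
      have "psi r s n f = psi r s k0 g \<oplus>\<^bsub>Loc\<^esub> psi r s n d"
        unfolding fgd psi_add[OF g' d'] using psi_transition[OF g, of "i + j"] by (simp add: n_def)
      also have "\<dots> = psi r s n d \<oplus>\<^bsub>Loc\<^esub> psi r s k0 g"
        using psi_closed[OF g] psi_closed[OF d'] by (rule L.a_comm)
      finally have "single (psi r s n f) = single (psi r s n d) \<oplus>\<^bsub>C2\<^esub> single (psi r s k0 g)"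
        by (simp add: C2_add)
      moreover have "single (psi r s n d) \<in> ?B" using psi_mem_boundary_fracs[OF rs d'] d by blast
      ultimately have "single (psi r s n f) \<in> ?B +>\<^bsub>C2\<^esub> single (psi r s k0 g)"
        unfolding a_r_coset_def' by blast
      moreover have "single (psi r s k0 g) \<in> carrier C2" unfolding carrier_C2 using psi_closed[OF g] by blast
      ultimately have "?B +>\<^bsub>C2\<^esub> single (psi r s k0 g) = ?B +>\<^bsub>C2\<^esub> single (psi r s n f)"
        by (rule C.a_repr_independence[OF _ _ B.a_subgroup])
      then show "U \<in> (\<lambda>f. ?B +>\<^bsub>C2\<^esub> single (psi r s k0 f)) ` ?N"
        unfolding U \<open>fr (laurent_monom R c (r + int i, s + int j)) i j = psi r s n f\<close> using g by blast
    qed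
  qed
  finally have car: "carrier ?H = (\<lambda>f. ?B +>\<^bsub>C2\<^esub> single (psi r s k0 f)) ` ?N" .
  have "module_length R ?H = ideal_length R (koszul_boundaries r s k0) ?N"
  proof (rule quot_length_eq_ideal_length[OF ideal_F ideal_koszul_boundaries koszul_boundaries_subset[OF rs]
        abelian_group_C2 additive_subgroup_boundaries])
    show "carrier ?H = (\<lambda>f. ?B +>\<^bsub>C2\<^esub> single (psi r s k0 f)) ` ?N" by (rule car)
    show "single (psi r s k0 f) \<in> carrier C2" if "f \<in> ?N" for f
      unfolding carrier_C2 using psi_closed[OF that] by blast
    show "single (psi r s k0 (f \<oplus> g)) = single (psi r s k0 f) \<oplus>\<^bsub>C2\<^esub> single (psi r s k0 g)"
      if "f \<in> ?N" "g \<in> ?N" for f g unfolding psi_add[OF that] C2_add ..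
    show "single (psi r s k0 (c \<otimes> f)) = laurent_monom R c (0, 0) \<odot>\<^bsub>C2\<^esub> single (psi r s k0 f)"
      if "c \<in> carrier R" "f \<in> ?N" for c f unfolding psi_smult[OF that] C2_smult ..
    show "laurent_monom R c (0, 0) \<odot>\<^bsub>C2\<^esub> (u \<oplus>\<^bsub>C2\<^esub> v) =
        laurent_monom R c (0, 0) \<odot>\<^bsub>C2\<^esub> u \<oplus>\<^bsub>C2\<^esub> laurent_monom R c (0, 0) \<odot>\<^bsub>C2\<^esub> v"
      if c: "c \<in> carrier R" and uC: "u \<in> carrier C2" and vC: "v \<in> carrier C2" for c u v
    proof -
      obtain f i j where u: "u = single (fr f i j)" "f \<in> carrier Rees"
        using uC unfolding carrier_C2 carrier_Loc by blast
      obtain g k l where v: "v = single (fr g k l)" "g \<in> carrier Rees"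
        using vC unfolding carrier_C2 carrier_Loc by blast
      show ?thesis
        unfolding u(1) v(1) C2_add C2_smult Loc_smult_add[OF c u(2) v(2)] fr_smult[OF c u(2)] fr_smult[OF c v(2)] ..
    qed
    show "laurent_monom R c (0, 0) \<odot>\<^bsub>C2\<^esub> u \<in> ?B" if c: "c \<in> carrier R" and uB: "u \<in> ?B" for c u
    proof -
      obtain f g i j where f: "f \<in> carrier Rees" and g: "g \<in> carrier Rees"
        and u: "u = single (fr f 0 j \<oplus>\<^bsub>Loc\<^esub> fr g i 0)" using uB unfolding boundary_fracs_def by blast
      show ?thesis
        unfolding u C2_smult Loc_smult_add[OF c f g] boundary_fracs_def
        using const_closed[OF c f] const_closed[OF c g] by blast
    qed
    show "single (psi r s k0 f) \<in> ?B \<longleftrightarrow> f \<in> koszul_boundaries r s k0" if "f \<in> ?N" for f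
      unfolding psi_mem_boundary_fracs[OF rs that, symmetric] by (simp add: image_iff single_inject)
    show "add ?H = set_add C2" "\<zero>\<^bsub>?H\<^esub> = ?B"
      by (simp_all add: restrict_scalars_def local_cohomology_comp_def lc quot_module_def)
    show "c \<odot>\<^bsub>?H\<^esub> U = (\<Union>x\<in>U. ?B +>\<^bsub>C2\<^esub> (laurent_monom R c (0, 0) \<odot>\<^bsub>C2\<^esub> x))" for c U
      by (simp add: restrict_scalars_def local_cohomology_comp_def lc quot_module_def)
  qed
  also have "\<dots> = l" by (rule len) simp
  finally show ?thesis .
qed

end

section \<open>The length of the local cohomology\<close>

lemma (in cring) pow_mem_ideal_pow_prod:
  fixes m n :: nat
  assumes "ideal I R" "ideal J R" "x \<in> carrier R" "x [^] m \<in> I" "x [^] n \<in> J"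
  shows "x [^] (m * nat r + n * nat s) \<in> ideal_pow R I r \<cdot> ideal_pow R J s"
proof -
  have eq: "ideal_pow R K (int (nat t)) = ideal_pow R K t" for K t by (simp add: ideal_pow_def)
  have "(x [^] m) [^] nat r \<otimes> (x [^] n) [^] nat s \<in> ideal_pow R I r \<cdot> ideal_pow R J s"
    using ideal_pow_pow[OF assms(1,4), of "nat r"] ideal_pow_pow[OF assms(2,5), of "nat s"]
    unfolding eq by (rule ideal_prod.prod)
  then show ?thesis using assms(3) by (simp add: nat_pow_pow nat_pow_mult)
qed

context local_ring
begin

lemma noetherian_cring: "noetherian_cring R"
  by (intro noetherian_cring.intro noetherian_ring_axioms is_cring)

lemma primary_toD:
  assumes "primary_to R \<mm> I"
  shows "ideal I R" "I \<subseteq> \<mm>" "\<And>x. x \<in> \<mm> \<Longrightarrow> \<exists>n::nat. x [^] n \<in> I"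
proof -
  show I: "ideal I R" using assms unfolding primary_to_def primary_ideal_def by blast
  have rad: "radical R I = \<mm>" using assms unfolding primary_to_def by blast
  show "I \<subseteq> \<mm>"
  proof
    fix x assume x: "x \<in> I"
    then have xc: "x \<in> carrier R" by (rule ideal.Icarr[OF I])
    have "x [^] (1::nat) \<in> I" using x xc by simp
    then show "x \<in> \<mm>" unfolding rad[symmetric] radical_def using xc by blast
  qed
  show "\<exists>n::nat. x [^] n \<in> I" if "x \<in> \<mm>" for x using that unfolding rad[symmetric] radical_def by blast
qed

lemma joint_filtration_nfilt:
  assumes depth: "depth R \<mm> = 2" and I: "primary_to R \<mm> I" and J: "primary_to R \<mm> J"
    and good: "good_joint_reduction R I J a b"
  shows "joint_filtration R (nfilt R I J) a b"
proof -
  interpret N: noetherian_cring R by (rule noetherian_cring)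
  note ideals = primary_toD(1)[OF I] primary_toD(1)[OF J]
  have jr: "joint_reduction R I J a b" using good unfolding good_joint_reduction_def by blast
  then have ab: "a \<in> \<mm>" "b \<in> \<mm>" using primary_toD(2)[OF I] primary_toD(2)[OF J] unfolding joint_reduction_def by auto
  then have c: "a \<in> carrier R" "b \<in> carrier R" using max_subset by auto
  obtain x y where xy: "x \<in> \<mm>" "y \<in> \<mm>" and nzd: "\<And>z. z \<in> carrier R \<Longrightarrow> x \<otimes> z = \<zero> \<Longrightarrow> z = \<zero>"
    and syz: "trivial_syzygies R x y"
    using exists_regular_pair[OF depth] by blast
  have xyc: "x \<in> carrier R" "y \<in> carrier R" using xy max_subset by auto
  have x: "nonzerodivisor R x" unfolding nonzerodivisor_def using xyc(1) nzd by blast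
  have Kid: "ideal (ideal_pow R I r \<cdot> ideal_pow R J s) R" for r s
    by (intro ideal_prod_is_ideal ideal_ideal_pow ideals)
  have pow: "\<exists>n::nat. z [^] n \<in> ideal_pow R I r \<cdot> ideal_pow R J s" if z: "z \<in> \<mm>" for z r s
  proof -
    obtain m n :: nat where mn: "z [^] m \<in> I" "z [^] n \<in> J"
      using primary_toD(3)[OF I z] primary_toD(3)[OF J z] by blast
    have "z \<in> carrier R" using z max_subset by blast
    then show ?thesis using pow_mem_ideal_pow_prod[OF ideals _ mn] by blast
  qed
  have powF: "\<exists>n::nat. z [^] n \<in> nfilt R I J r s" if z: "z \<in> \<mm>" for z r s
    using pow[OF z, of r s] subset_integral_closure[OF Kid[of r s]] unfolding nfilt_def by blast
  have F: "ideal (nfilt R I J r s) R" for r s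
  proof -
    obtain n :: nat where "x [^] n \<in> ideal_pow R I r \<cdot> ideal_pow R J s" using pow[OF xy(1)] by blast
    then show ?thesis unfolding nfilt_def by (rule N.ideal_integral_closure[OF Kid _ nonzerodivisor_pow[OF x]])
  qed
  obtain M where M: "\<forall>r\<ge>M. \<forall>s\<ge>M. nfilt R I J r s =
      (a <# nfilt R I J (r - 1) s) <+>\<^bsub>R\<^esub> (b <# nfilt R I J r (s - 1))"
    using jr unfolding joint_reduction_def by blast
  have comb: "\<exists>n::nat. \<exists>p\<in>carrier R. \<exists>q\<in>carrier R. z [^] n = p \<otimes> a \<oplus> q \<otimes> b" if z: "z \<in> \<mm>" for z
  proof -
    obtain n :: nat where "z [^] n \<in> nfilt R I J M M" using powF[OF z] by blast
    then have "z [^] n \<in> (a <# nfilt R I J (M - 1) M) <+>\<^bsub>R\<^esub> (b <# nfilt R I J M (M - 1))"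
      using M by auto
    then obtain p q where pq: "p \<in> nfilt R I J (M - 1) M" "q \<in> nfilt R I J M (M - 1)"
      "z [^] n = a \<otimes> p \<oplus> b \<otimes> q" unfolding mem_coset_add_coset by blast
    have pqc: "p \<in> carrier R" "q \<in> carrier R" using pq(1,2) by (auto intro: ideal.Icarr[OF F])
    then have "z [^] n = p \<otimes> a \<oplus> q \<otimes> b" using pq(3) c m_comm by simp
    then show ?thesis using pqc by blast
  qed
  obtain m :: nat and p q where p: "p \<in> carrier R" "q \<in> carrier R" "x [^] m = p \<otimes> a \<oplus> q \<otimes> b"
    using comb[OF xy(1)] by blast
  obtain n :: nat and p' q' where p': "p' \<in> carrier R" "q' \<in> carrier R" "y [^] n = p' \<otimes> a \<oplus> q' \<otimes> b"
    using comb[OF xy(2)] by blast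
  have ab_syz: "trivial_syzygies R a b"
  proof (rule trivial_syzygies_of_regular[OF c p(1,2) p'(1,2) p(3) p'(3)])
    show "z = \<zero>" if "z \<in> carrier R" "x [^] m \<otimes> z = \<zero>" for z
      using nonzerodivisor_pow[OF x, of m] that unfolding nonzerodivisor_def by blast
  qed (rule trivial_syzygies_pow[OF xyc syz])
  have nzd_a: "nonzerodivisor R a"
    unfolding nonzerodivisor_def
    using c(1) nonzerodivisor_of_trivial_syzygies[OF c(1) ab(2) ab_syz] by blast
  have nzd_b: "nonzerodivisor R b"
    unfolding nonzerodivisor_def
    using c(2) nonzerodivisor_of_trivial_syzygies[OF c(2) ab(1) trivial_syzygies_sym[OF ab_syz]] by blast
  have R1: "integral_closure R (carrier R) = carrier R"
    using subset_integral_closure[OF oneideal] integral_closure_subset_carrier by blast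
  show ?thesis
  proof (intro joint_filtration.intro joint_filtration_axioms.intro is_cring)
    show "\<one> \<noteq> \<zero>"
      using one_notin_max additive_subgroup.zero_closed[OF ideal.axioms(1)[OF max_ideal]] by metis
    show "ideal (nfilt R I J r s) R" for r s by (rule F)
    show "nfilt R I J r s = carrier R" if "r \<le> 0" "s \<le> 0" for r s
      unfolding nfilt_def ideal_pow_nonpos[OF that(1)] ideal_pow_nonpos[OF that(2)] ideal_prod_one[OF oneideal]
      by (rule R1)
    show "nfilt R I J r s = nfilt R I J 0 s" if "r \<le> 0" for r s
      unfolding nfilt_def ideal_pow_nonpos[OF that] ideal_pow_nonpos[OF order_refl] ..
    show "nfilt R I J r s = nfilt R I J r 0" if "s \<le> 0" for r s
      unfolding nfilt_def ideal_pow_nonpos[OF that] ideal_pow_nonpos[OF order_refl] ..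
    show "ideal_length R (nfilt R I J r s) (carrier R) \<noteq> \<infinity>" for r s
      by (rule finite_colength[OF F powF])
    show "nonzerodivisor R a" "nonzerodivisor R b" "trivial_syzygies R a b" by fact+
    show "\<exists>N. \<forall>r\<ge>N. \<forall>s\<ge>N. nfilt R I J r s =
        (a <# nfilt R I J (r - 1) s) <+>\<^bsub>R\<^esub> (b <# nfilt R I J r (s - 1))"
      using M by blast
    show "PIdl a \<inter> nfilt R I J r s = a <# nfilt R I J (r - 1) s" if "r > 0" for r s
      using good that unfolding good_joint_reduction_def by blast
    show "PIdl b \<inter> nfilt R I J r s = b <# nfilt R I J r (s - 1)" if "s > 0" for r s
      using good that unfolding good_joint_reduction_def by blast
  qed
qed

end

lemma (in joint_filtration) eventual_length:
  fixes r s :: nat and e :: int and g h eI eJ eIJ :: "nat \<Rightarrow> int"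
  assumes g: "\<forall>r::nat. \<exists>N. \<forall>s::nat\<ge>N. colength (int r) (int s) - colength 0 (int s) = e * int r * int s + g r"
    and h: "\<forall>s::nat. \<exists>N. \<forall>r::nat\<ge>N. colength (int r) (int s) - colength (int r) 0 = e * int r * int s + h s"
    and eI: "\<exists>N. \<forall>n\<ge>N. colength (int (n + 1)) 0 =
      eI 0 * int ((n + 2) choose 2) - eI 1 * int ((n + 1) choose 1) + eI 2"
    and eJ: "\<exists>N. \<forall>n\<ge>N. colength 0 (int (n + 1)) =
      eJ 0 * int ((n + 2) choose 2) - eJ 1 * int ((n + 1) choose 1) + eJ 2"
    and eIJ: "\<exists>N. \<forall>n\<ge>N. colength (int (n + 1)) (int (n + 1)) =
      eIJ 0 * int ((n + 2) choose 2) - eIJ 1 * int ((n + 1) choose 1) + eIJ 2"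
  defines "H \<equiv> restrict_scalars (\<lambda>c. laurent_monom R c (0, 0))
    (local_cohomology_comp Rees (ext_rees_comp R F) gens 2 (int r, int s))"
  shows "module_length R H \<noteq> \<infinity>"
    and "int (the_enat (module_length R H)) =
      (eI 2 + eJ 2 - eIJ 2) + g r + h s + int r * int s * e - colength (int r) (int s)" (is "_ = ?v")
proof -
  let ?l = "\<lambda>m n. colength (int m) (int n)"
  have mixed: "\<exists>N. \<forall>m\<ge>N. \<forall>n\<ge>N. ?l (Suc m) (Suc n) = mult_ab + ?l m (Suc n) + ?l (Suc m) n - ?l m n"
  proof -
    obtain N where N: "N \<ge> 0" "\<forall>r\<ge>N. \<forall>s\<ge>N. colength (r + 1) (s + 1) =
        mult_ab + colength r (s + 1) + colength (r + 1) s - colength r s"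
      using colength_mixed_difference by blast
    show ?thesis
    proof (intro exI allI impI)
      fix m n assume mn: "nat N \<le> m" "nat N \<le> n"
      then have "N \<le> int m" "N \<le> int n" by linarith+
      then have "colength (int m + 1) (int n + 1) = mult_ab + colength (int m) (int n + 1) +
          colength (int m + 1) (int n) - colength (int m) (int n)" using N(2) by blast
      then show "?l (Suc m) (Suc n) = mult_ab + ?l m (Suc n) + ?l (Suc m) n - ?l m n"
        by (simp only: of_nat_Suc add.commute[of 1])
    qed
  qed
  have "\<exists>k0. \<forall>k\<ge>k0. int k * int k * mult_ab + ?l r (s + k) + ?l (r + k) s - ?l r s - ?l (r + k) (s + k) = ?v"
    by (rule eventual_koszul_length[OF mixed]) (use g h eI eJ eIJ in simp_all)
  then obtain k0 where k0: "\<And>k. k \<ge> k0 \<Longrightarrow>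
      int k * int k * mult_ab + ?l r (s + k) + ?l (r + k) s - ?l r s - ?l (r + k) (s + k) = ?v" by blast
  have rs: "int r \<ge> 0" "int s \<ge> 0" by simp_all
  let ?len = "\<lambda>k. ideal_length R (koszul_boundaries (int r) (int s) k) (F (int r + int k) (int s + int k))"
  have v: "int (the_enat (?len k)) = ?v" if "k \<ge> k0" for k
    using koszul_length(2)[OF rs, of k] k0[OF that] by simp
  have len: "?len k = enat (nat ?v)" if "k \<ge> k0" for k
  proof -
    obtain m where m: "?len k = enat m" using koszul_length(1)[OF rs, of k] by auto
    then have "int m = ?v" using v[OF that] by simp
    then show ?thesis unfolding m by simp
  qed
  have H: "module_length R H = enat (nat ?v)"
    unfolding H_def by (rule local_cohomology_length[OF rs len]) simp_all
  then show "module_length R H \<noteq> \<infinity>" by simp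
  have "int (nat ?v) = ?v" using v[of k0] len[of k0] by simp
  then show "int (the_enat (module_length R H)) = ?v" unfolding H by simp
qed

theorem theorem3p7:
  fixes R :: "('a, 'b) ring_scheme" and \<mm> I J :: "'a set" and a b :: 'a
    and eI eJ eIJ :: "nat \<Rightarrow> int" and e :: "nat \<Rightarrow> nat \<Rightarrow> int" and g h :: "nat \<Rightarrow> int"
    and r s :: nat
  assumes "local_ring R \<mm>"
    and "analytically_unramified R \<mm>"
    and "cohen_macaulay R \<mm>"
    and "krull_dim R = 2"
    and "infinite (carrier (R Quot \<mm>))"
    and "primary_to R \<mm> I" and "primary_to R \<mm> J"
    and "good_joint_reduction R I J a b"
    and "normal_hilbert_coeffs R I eI"
    and "normal_hilbert_coeffs R J eJ"
    and "normal_hilbert_coeffs R (I \<cdot>\<^bsub>R\<^esub> J) eIJ"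
    and "bhattacharya_coeffs R I J e"
    and "is_g R I J (e 1 1) g"
    and "is_h R I J (e 1 1) h"
  shows "module_length R (rees_local_cohomology_comp R I J a b 2 (int r, int s)) \<noteq> \<infinity> \<and>
    len R (rees_local_cohomology_comp R I J a b 2 (int r, int s)) =
      (eI 2 + eJ 2 - eIJ 2) + g r + h s + int r * int s * e 1 1
        - len R (subquot R (carrier R) (nfilt R I J (int r) (int s)))"
proof -
  interpret local_ring R \<mm> by fact
  have depth: "depth R \<mm> = 2" using assms(3,4) unfolding cohen_macaulay_def by simp
  interpret F: joint_filtration R "nfilt R I J" a b
    by (rule joint_filtration_nfilt[OF depth assms(6,7,8)])
  note I = primary_toD(1)[OF assms(6)] and J = primary_toD(1)[OF assms(7)]
  have colen: "len R (subquot R (carrier R) (nfilt R I J p q)) = F.colength p q" for p q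
    unfolding len_def F.colength_def
    by (simp add: subquot_length[OF oneideal F.ideal_F ideal_subset_carrier[OF F.ideal_F]])
  have prod_one: "carrier R \<cdot>\<^bsub>R\<^esub> K = K" "K \<cdot>\<^bsub>R\<^esub> carrier R = K" if "ideal K R" for K
    using ideal_prod_one[OF that] ideal_prod_commute[OF that oneideal] by simp_all
  have left: "integral_closure R (ideal_pow R I p) = nfilt R I J p 0" for p
    unfolding nfilt_def ideal_pow_nonpos[OF order_refl] prod_one[OF ideal_ideal_pow[OF I]] ..
  have right: "integral_closure R (ideal_pow R J q) = nfilt R I J 0 q" for q
    unfolding nfilt_def ideal_pow_nonpos[OF order_refl] prod_one[OF ideal_ideal_pow[OF J]] ..
  have diag: "integral_closure R (ideal_pow R (I \<cdot>\<^bsub>R\<^esub> J) p) = nfilt R I J p p" for p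
    unfolding nfilt_def ideal_prod_pow_distrib[OF I J] ..
  have Kid: "ideal (ideal_pow R I p \<cdot>\<^bsub>R\<^esub> ideal_pow R J q) R" for p q
    by (intro ideal_prod_is_ideal ideal_ideal_pow I J)
  have "ideal_pow R I p \<cdot>\<^bsub>R\<^esub> ideal_pow R J q \<subseteq> ideal_pow R I p"
    "ideal_pow R I p \<cdot>\<^bsub>R\<^esub> ideal_pow R J q \<subseteq> ideal_pow R J q" for p q
    using ideal_prod_inter[OF ideal_ideal_pow[OF I] ideal_ideal_pow[OF J]] by blast+
  then have sub: "nfilt R I J p q \<subseteq> nfilt R I J p 0" "nfilt R I J p q \<subseteq> nfilt R I J 0 q" for p q
    unfolding left[symmetric] right[symmetric] unfolding nfilt_def
    by (intro integral_closure_mono Kid ideal_ideal_pow I J; blast)+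
  have diff: "len R (subquot R (nfilt R I J p q) (nfilt R I J p' q')) = F.colength p' q' - F.colength p q"
    if "nfilt R I J p' q' \<subseteq> nfilt R I J p q" for p q p' q'
  proof -
    have "ideal_length R (nfilt R I J p' q') (carrier R) =
        ideal_length R (nfilt R I J p' q') (nfilt R I J p q) + ideal_length R (nfilt R I J p q) (carrier R)"
      by (rule ideal_length_add[OF F.ideal_F F.ideal_F oneideal that ideal_subset_carrier[OF F.ideal_F]])
    moreover obtain m where m: "ideal_length R (nfilt R I J p' q') (carrier R) = enat m"
      using F.F_finite[of p' q'] by auto
    moreover obtain n where n: "ideal_length R (nfilt R I J p q) (carrier R) = enat n"
      using F.F_finite[of p q] by auto
    ultimately have eq: "enat m = ideal_length R (nfilt R I J p' q') (nfilt R I J p q) + enat n" by simp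
    then obtain k where k: "ideal_length R (nfilt R I J p' q') (nfilt R I J p q) = enat k"
      by (cases "ideal_length R (nfilt R I J p' q') (nfilt R I J p q)") simp_all
    have "m = k + n" using eq unfolding k by simp
    then show ?thesis
      unfolding len_def F.colength_def subquot_length[OF F.ideal_F F.ideal_F that] m n k by simp
  qed
  have main: "module_length R (rees_local_cohomology_comp R I J a b 2 (int r, int s)) \<noteq> \<infinity>"
    "int (the_enat (module_length R (rees_local_cohomology_comp R I J a b 2 (int r, int s)))) =
      (eI 2 + eJ 2 - eIJ 2) + g r + h s + int r * int s * e 1 1 - F.colength (int r) (int s)"
    unfolding rees_local_cohomology_comp_def F.gens_def[symmetric]
  proof -
    have g: "\<forall>r::nat. \<exists>N. \<forall>s::nat\<ge>N.
        F.colength (int r) (int s) - F.colength 0 (int s) = e 1 1 * int r * int s + g r"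
      using assms(13) unfolding is_g_def right diff[OF sub(2)] .
    have h: "\<forall>s::nat. \<exists>N. \<forall>r::nat\<ge>N.
        F.colength (int r) (int s) - F.colength (int r) 0 = e 1 1 * int r * int s + h s"
      using assms(14) unfolding is_h_def left diff[OF sub(1)] .
    have eI: "\<exists>N. \<forall>n\<ge>N. F.colength (int (n + 1)) 0 =
        eI 0 * int ((n + 2) choose 2) - eI 1 * int ((n + 1) choose 1) + eI 2"
      using assms(9) unfolding normal_hilbert_coeffs_def left colen .
    have eJ: "\<exists>N. \<forall>n\<ge>N. F.colength 0 (int (n + 1)) =
        eJ 0 * int ((n + 2) choose 2) - eJ 1 * int ((n + 1) choose 1) + eJ 2"
      using assms(10) unfolding normal_hilbert_coeffs_def right colen .
    have eIJ: "\<exists>N. \<forall>n\<ge>N. F.colength (int (n + 1)) (int (n + 1)) =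
        eIJ 0 * int ((n + 2) choose 2) - eIJ 1 * int ((n + 1) choose 1) + eIJ 2"
      using assms(11) unfolding normal_hilbert_coeffs_def diag colen .
    show "module_length R (restrict_scalars (\<lambda>c. laurent_monom R c (0, 0))
        (local_cohomology_comp (ext_rees R (nfilt R I J)) (ext_rees_comp R (nfilt R I J)) F.gens 2
          (int r, int s))) \<noteq> \<infinity>"
      by (rule F.eventual_length(1)[OF g h eI eJ eIJ])
    show "int (the_enat (module_length R (restrict_scalars (\<lambda>c. laurent_monom R c (0, 0))
        (local_cohomology_comp (ext_rees R (nfilt R I J)) (ext_rees_comp R (nfilt R I J)) F.gens 2
          (int r, int s))))) =
      (eI 2 + eJ 2 - eIJ 2) + g r + h s + int r * int s * e 1 1 - F.colength (int r) (int s)"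
      by (rule F.eventual_length(2)[OF g h eI eJ eIJ])
  qed
  then show ?thesis unfolding colen unfolding len_def by simp
qed

end
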